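(* Suppose $K$ satisfies (K1) and (K2), and let $\Omega\subset\mathbb R^d$ be a bounded open set with Lipschitz boundary. Then $\mathcal G^{(\varepsilon)}_K(\cdot;\Omega)$ $\Gamma$-converges to $\mathcal G_K(\cdot;\Omega)$ as $\varepsilon\to0^+$ (with respect to $L^1_{loc}(\mathbb R^d)$ convergence on $\mathcal X$). More precisely: (i) for any $u_\varepsilon\in\mathcal X_\varepsilon$ converging to $u\in\mathcal X$ in $L^1_{loc}(\mathbb R^d)$, $\liminf_{\varepsilon\to0^+}\mathcal G^{(\varepsilon)}_K(u_\varepsilon;\Omega)\ge\mathcal G_K(u;\Omega)$; (ii) for any $u\in\mathcal X$ there exist $u_\varepsilon\in\mathcal X_\varepsilon$ converging to $u$ in $L^1_{loc}(\mathbb R^d)$ with $\limsup_{\varepsilon\to0^+}\mathcal G^{(\varepsilon)}_K(u_\varepsilon;\Omega)\le\mathcal G_K(u;\Omega)$; (iii) for any sequence $\varepsilon_n\to0$ in $(0,1)$ and $u_n\in\mathcal X_{\varepsilon_n}$ with $\sup_n\mathcal G^{(\varepsilon_n)}_K(u_n;\Omega)\le C$ for some $C\ge0$, there exist a measurable set $E\subseteq\Omega$ and a diverging sequence $\{n_k\}$ such that $u_{n_k}\to\chi_E-\chi_{\mathbb R^d\setminus E}$ a.e. in $\Omega$ as $k\to+\infty$.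
   Context: $d\ge2$; $|\cdot|$ is the $\ell^1$ norm, $|x|_\infty=\max_n|x_n|$; $Q_r(x):=\{y:|y-x|_\infty\le r\}$, $\mathring Q_r(x)$ its interior. $K:\mathbb R^d\times\mathbb R^d\to[0,+\infty]$ is measurable with (K1) $K(x,y)=K(y,x)$ a.e.; (K2) $\lambda|x-y|^{-d-s}\le K(x,y)\le\Lambda|x-y|^{-d-s}$ a.e., for some $s\in(0,1)$, $\Lambda\ge\lambda>0$. For open $\Omega$ and measurable $u:\mathbb R^d\to\mathbb R$: $\mathcal K_K(u;\Omega):=\iint_{\mathbb R^{2d}\setminus(\mathbb R^d\setminus\Omega)^2}|u(x)-u(y)|K(x,y)\,dx\,dy$. $\mathcal X:=\{v\in L^\infty(\mathbb R^d):\|v\|_{L^\infty}\le1\}$ with the topology of $L^1_{loc}(\mathbb R^d)$ convergence; for $\varepsilon>0$, $\mathcal X_\varepsilon:=\{v\in\mathcal X: v \text{ is constant on } \mathring Q_{\varepsilon/2}(\varepsilon i) \text{ for every } i\in\mathbb Z^d\}$. For bounded open $\Omega$, $\mathcal G_K(\cdot;\Omega):\mathcal X\to[0,+\infty]$, $\mathcal G_K(v;\Omega):=\mathcal K_K(v;\Omega)$ if $v|_\Omega=\chi_E-\chi_{\mathbb R^d\setminus E}$ for some measurable $E\subseteq\Omega$, and $+\infty$ otherwise; $\mathcal G^{(\varepsilon)}_K(\cdot;\Omega)$ is the restriction of $\mathcal G_K(\cdot;\Omega)$ to $\mathcal X_\varepsilon$. *)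

theory Defs
  imports "HOL-Analysis.Analysis"
begin

definition l1norm :: "real^'n \<Rightarrow> real" where
  "l1norm x = (\<Sum>i\<in>UNIV. \<bar>x $ i\<bar>)"

definition cube :: "real \<Rightarrow> real^'n \<Rightarrow> (real^'n) set" where
  "cube r x = {y. \<forall>i. \<bar>y $ i - x $ i\<bar> \<le> r}"

definition open_cube :: "real \<Rightarrow> real^'n \<Rightarrow> (real^'n) set" where
  "open_cube r x = {y. \<forall>i. \<bar>y $ i - x $ i\<bar> < r}"

definition int_lattice :: "(real^'n) set" where
  "int_lattice = {z. \<forall>j. z $ j \<in> \<int>}"

definition kernel_hyp ::
  "((real^'n) \<times> (real^'n) \<Rightarrow> ennreal) \<Rightarrow> real \<Rightarrow> real \<Rightarrow> real \<Rightarrow> bool" where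
  "kernel_hyp K s lam Lam \<longleftrightarrow>
     K \<in> borel_measurable lebesgue \<and>
     0 < s \<and> s < 1 \<and> 0 < lam \<and> lam \<le> Lam \<and>
     (AE z in lebesgue. K z = K (snd z, fst z)) \<and>
     (AE z in lebesgue.
        ennreal (lam * l1norm (fst z - snd z) powr (- (real CARD('n) + s))) \<le> K z \<and>
        K z \<le> ennreal (Lam * l1norm (fst z - snd z) powr (- (real CARD('n) + s))))"

definition KK :: "((real^'n) \<times> (real^'n) \<Rightarrow> ennreal) \<Rightarrow> (real^'n \<Rightarrow> real) \<Rightarrow> (real^'n) set \<Rightarrow> ennreal" where
  "KK K u \<Omega> = (\<integral>\<^sup>+ z \<in> (UNIV - (-\<Omega>) \<times> (-\<Omega>)).
                   ennreal \<bar>u (fst z) - u (snd z)\<bar> * K z \<partial>lebesgue)"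

text \<open>The space X: (representatives of) elements of L^infinity with norm at most 1.\<close>
definition Xsp :: "(real^'n \<Rightarrow> real) set" where
  "Xsp = {v. v \<in> borel_measurable lebesgue \<and> (AE x in lebesgue. \<bar>v x\<bar> \<le> 1)}"

definition Xeps :: "real \<Rightarrow> (real^'n \<Rightarrow> real) set" where
  "Xeps eps = {v \<in> Xsp. \<forall>i \<in> int_lattice. \<exists>c. AE x in lebesgue.
                  x \<in> open_cube (eps / 2) (eps *\<^sub>R i) \<longrightarrow> v x = c}"

definition GK :: "((real^'n) \<times> (real^'n) \<Rightarrow> ennreal) \<Rightarrow> (real^'n) set \<Rightarrow> (real^'n \<Rightarrow> real) \<Rightarrow> ennreal" where
  "GK K \<Omega> v = (if v \<in> Xsp \<and> (\<exists>E. E \<in> sets lebesgue \<and> E \<subseteq> \<Omega> \<and>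
                    (AE x in lebesgue. x \<in> \<Omega> \<longrightarrow> v x = indicator E x - indicator (-E) x))
               then KK K v \<Omega> else \<infinity>)"

definition GKeps :: "real \<Rightarrow> ((real^'n) \<times> (real^'n) \<Rightarrow> ennreal) \<Rightarrow> (real^'n) set \<Rightarrow> (real^'n \<Rightarrow> real) \<Rightarrow> ennreal" where
  "GKeps eps K \<Omega> v = (if v \<in> Xeps eps then GK K \<Omega> v else \<infinity>)"

definition L1loc_tendsto :: "('b \<Rightarrow> real^'n \<Rightarrow> real) \<Rightarrow> (real^'n \<Rightarrow> real) \<Rightarrow> 'b filter \<Rightarrow> bool" where
  "L1loc_tendsto f u F \<longleftrightarrow> (\<forall>C. compact C \<longrightarrow>
     ((\<lambda>t. \<integral>\<^sup>+ x \<in> C. ennreal \<bar>f t x - u x\<bar> \<partial>lebesgue) \<longlongrightarrow> 0) F)"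

text \<open>Lipschitz boundary: near every boundary point, after a rigid motion, Omega is the
  strict subgraph of a Lipschitz function of the remaining d-1 coordinates.\<close>
definition lipschitz_boundary :: "(real^'n) set \<Rightarrow> bool" where
  "lipschitz_boundary \<Omega> \<longleftrightarrow> (\<forall>p \<in> frontier \<Omega>. \<exists>r>0. \<exists>(T :: real^'n \<Rightarrow> real^'n) (k :: 'n) (g :: real^'n \<Rightarrow> real) (L :: real).
      orthogonal_transformation T \<and> L-lipschitz_on UNIV g \<and>
      (\<forall>x t. g (x + t *\<^sub>R axis k 1) = g x) \<and>
      \<Omega> \<inter> ball p r = {x \<in> ball p r. T (x - p) $ k < g (T (x - p))})"

end

theory Submission
  imports Defs "HOL-Complex_Analysis.Great_Picard"
begin

text \<open>
  The lower bound is Fatou's lemma along an almost everywhere convergent subsequence.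

  For the recovery sequence, let \<open>v\<close> be equal to \<open>u\<close> in \<open>\<Omega>\<close> and to \<open>-1\<close> outside. A bounded Lipschitz
  domain has finite \<open>s\<close>-perimeter, so \<open>v\<close> has finite Gagliardo seminorm and the interaction of \<open>\<Omega>\<close>
  with its complement is handled by dominated convergence. Replace \<open>v\<close> in each cell by its majority
  value. For two different cells \<open>Q\<close>, \<open>Q'\<close> the integral of the kernel over \<open>Q \<times> Q'\<close> is comparable
  with the volume of \<open>Q \<times> Q'\<close> times any value of the kernel there (this uses \<open>s < 1\<close> when the cells are
  adjacent), and the jump of the majority value is at most twice the mean of \<open>\<bar>v(x) - v(y)\<bar>\<close> over
  \<open>Q \<times> Q'\<close>. Hence the energy of the discretisation close to the diagonal is bounded by the seminorm
  of \<open>v\<close> close to the diagonal, which is small, while away from the diagonal dominated convergence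
  applies.

  For compactness, the \<open>L\<^sup>1\<close> distance of a function to its cell averages is at most \<open>C \<epsilon>\<^sup>s\<close> times its
  seminorm, and the averages converge along a diagonal subsequence.
\<close>

section \<open>Integrals of the fractional kernel\<close>

text \<open>The obstacle is the diagonal: the kernel is not integrable there, so pointwise
  convergence of the discretised functions does not bound their energies from above, and an estimate
  uniform in \<open>\<epsilon>\<close> has to take the place of a dominating function. It is
  available only for functions with values \<open>\<plusminus>1\<close>, since it rests on the
  product form of the jump, and \<open>u\<close> is of this kind only in \<open>\<Omega>\<close>.
  Nor does the energy see pairs of points outside \<open>\<Omega>\<close>, so the seminorm of
  \<open>u\<close> itself may be infinite. The extension by \<open>-1\<close> cures both defects;
  its price is the perimeter of \<open>\<Omega>\<close>, and this is where the Lipschitz boundary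
  enters. The boundary also has measure zero, which makes the layer of cells straddling it
  negligible.

  Both places where \<open>s < 1\<close> matters, the perimeter of \<open>\<Omega>\<close> and the
  interaction of touching cells, are one estimate: if a shift by \<open>h\<close> carries out of a
  set at most a multiple of \<open>l1norm h\<close> of its mass, the singularity drops from order
  \<open>d + s\<close> to \<open>d + s - 1\<close>, which is below the dimension
  \<open>d\<close>.\<close>

lemma l1norm_nonneg [simp]: "0 \<le> l1norm x"
  by (simp add: l1norm_def sum_nonneg)

lemma l1norm_zero [simp]: "l1norm 0 = 0"
  by (simp add: l1norm_def)

lemma l1norm_eq_0_iff [simp]: "l1norm x = 0 \<longleftrightarrow> x = 0"
  by (simp add: l1norm_def sum_nonneg_eq_0_iff vec_eq_iff)

lemma l1norm_minus [simp]: "l1norm (- x) = l1norm x"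
  by (simp add: l1norm_def)

lemma l1norm_minus_commute: "l1norm (x - y) = l1norm (y - x)"
  using l1norm_minus[of "x - y"] by simp

lemma l1norm_triangle: "l1norm (x + y) \<le> l1norm x + l1norm y"
  unfolding l1norm_def sum.distrib[symmetric] by (intro sum_mono) (simp add: abs_triangle_ineq)

lemma component_le_l1norm: "\<bar>x $ i\<bar> \<le> l1norm x"
  unfolding l1norm_def by (rule member_le_sum) auto

lemma l1norm_le_card:
  fixes x :: "real^'n"
  assumes "\<And>i. \<bar>x $ i\<bar> \<le> c"
  shows "l1norm x \<le> real CARD('n) * c"
  unfolding l1norm_def using sum_mono[of UNIV "\<lambda>i. \<bar>x $ i\<bar>" "\<lambda>_. c"] assms by simp

lemma norm_le_l1norm: "norm x \<le> l1norm x"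
  unfolding l1norm_def by (rule norm_le_l1_cart)

lemma borel_measurable_l1norm [measurable]: "l1norm \<in> borel_measurable borel"
proof -
  have "continuous_on UNIV (l1norm :: real^'n \<Rightarrow> real)"
    unfolding l1norm_def by (intro continuous_intros)
  then show ?thesis by (rule borel_measurable_continuous_onI)
qed

text \<open>The common profile of the two bounds in \<open>kernel_hyp\<close>. Since
  \<open>0 powr a = 0\<close>, it is finite everywhere and vanishes at \<open>0\<close>; the
  diagonal, where this convention replaces a blow-up, is a null set.\<close>

definition wker :: "real \<Rightarrow> real^'n \<Rightarrow> real" where
  "wker s h = l1norm h powr (- (real CARD('n) + s))"

lemma wker_nonneg [simp]: "0 \<le> wker s h"
  by (simp add: wker_def)

lemma wker_minus_commute: "wker s (x - y) = wker s (y - x)"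
  by (simp add: wker_def l1norm_minus_commute)

lemma borel_measurable_wker [measurable]: "wker s \<in> borel_measurable borel"
  unfolding wker_def by measurable

lemma emeasure_l1norm_ball_le:
  fixes R :: real
  assumes "0 \<le> R"
  shows "emeasure lborel {h :: real^'n. l1norm h \<le> R} \<le> ennreal ((2 * R) ^ CARD('n))"
proof -
  let ?B = "cbox (\<chi> i. - R) (\<chi> i. R) :: (real^'n) set"
  have "{h :: real^'n. l1norm h \<le> R} \<subseteq> ?B"
  proof
    fix h :: "real^'n" assume "h \<in> {h. l1norm h \<le> R}"
    then have "\<bar>h $ i\<bar> \<le> R" for i using component_le_l1norm[of h i] by simp
    then show "h \<in> ?B" by (auto simp: mem_box_cart abs_le_iff minus_le_iff)
  qed
  then have "emeasure lborel {h :: real^'n. l1norm h \<le> R} \<le> emeasure lborel ?B"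
    by (intro emeasure_mono) auto
  also have "\<dots> = ennreal (measure lborel ?B)"
    using emeasure_lborel_cbox_finite[of "(\<chi> i. - R) :: real^'n" "\<chi> i. R"]
    by (simp add: emeasure_eq_ennreal_measure less_top)
  also have "measure lborel ?B = (2 * R) ^ CARD('n)"
    using assms by (subst content_cbox_cart) (auto simp: interval_eq_empty_cart not_less)
  finally show ?thesis .
qed

lemma suminf_ge_term_ennreal: "f j \<le> (\<Sum>j. f j :: ennreal)"
  using sum_le_suminf[OF summableI, of "{j}" f] by simp

lemma suminf_geometric_ennreal:
  assumes "0 \<le> c" "0 \<le> q" "q < 1"
  shows "(\<Sum>j. ennreal (c * q ^ j)) = ennreal (c / (1 - q))"
proof (rule suminf_ennreal_eq)
  show "(\<lambda>j. c * q ^ j) sums (c / (1 - q))"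
    using sums_mult[OF geometric_sums[of q], of c] assms by simp
qed (use assms in simp)

text \<open>Dyadic shells: between the radii \<open>R / 2 ^ Suc j\<close> and
  \<open>R / 2 ^ j\<close> the integrand is at most its value at the inner radius, the shell lies in
  a cube of side \<open>2 * R / 2 ^ j\<close>, and the resulting series is geometric with ratio
  \<open>(1/2) powr (d - p) < 1\<close>. The exact power of \<open>R\<close> matters later, for the
  estimate on cells.\<close>

lemma nn_integral_l1norm_powr_ball:
  fixes p :: real
  assumes "0 \<le> p" "p < real CARD('n)"
  obtains C where "0 \<le> C"
    "\<And>R. 0 < R \<Longrightarrow> (\<integral>\<^sup>+(h::real^'n). indicator {h. l1norm h \<le> R} h * ennreal (l1norm h powr - p) \<partial>lborel)
        \<le> ennreal (C * R powr (real CARD('n) - p))"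
proof -
  define d where "d = real CARD('n)"
  define q :: real where "q = (1/2) powr (d - p)"
  have q: "0 \<le> q" "q < 1"
    using assms powr_less_mono'[of "1/2" 0 "d - p"] unfolding q_def d_def by simp_all
  \<comment> \<open>\<open>2 powr d\<close> comes from the cube around a ball,
    \<open>2 powr p\<close> from evaluating at half the outer radius, and the rest is the geometric
    sum.\<close>
  define C where "C = 2 powr d * 2 powr p / (1 - q)"
  have "0 \<le> C" using q by (simp add: C_def)
  moreover have "(\<integral>\<^sup>+(h::real^'n). indicator {h. l1norm h \<le> R} h * ennreal (l1norm h powr - p) \<partial>lborel)
        \<le> ennreal (C * R powr (real CARD('n) - p))" if R: "0 < R" for R
  proof -
    let ?r = "\<lambda>j. R * (1/2) ^ j"
    have pw: "indicator {h. l1norm h \<le> R} h * ennreal (l1norm h powr - p)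
        \<le> (\<Sum>j. ennreal (?r (Suc j) powr - p) * indicator {h. l1norm h \<le> ?r j} h)" (is "?l \<le> (\<Sum>j. ?f j)")
      for h :: "real^'n"
    proof (cases "0 < l1norm h \<and> l1norm h \<le> R")
      case False
      then have "?l = 0" using l1norm_nonneg[of h]
        by (cases "l1norm h = 0") (auto simp: indicator_def less_le)
      then show ?thesis unfolding \<open>?l = 0\<close> by simp
    next
      case True
      then obtain n where n: "(1/2) ^ n < l1norm h / R"
        using real_arch_pow_inv[of "l1norm h / R" "1/2"] R by auto
      \<comment> \<open>The first dyadic radius below \<open>l1norm h\<close>. It is not
        \<open>R\<close> itself, so its predecessor exists and bounds \<open>l1norm h\<close> from
        above.\<close>
      define m where "m = (LEAST n. ?r n < l1norm h)"
      have m: "?r m < l1norm h" unfolding m_def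
        by (rule LeastI[of _ n]) (use n R in \<open>simp add: field_simps\<close>)
      with True have "m \<noteq> 0" by (cases m) auto
      then obtain j where j: "m = Suc j" by (cases m) auto
      then have j': "l1norm h \<le> ?r j"
        using not_less_Least[of j "\<lambda>n. ?r n < l1norm h"] unfolding m_def by auto
      have "l1norm h powr - p \<le> ?r (Suc j) powr - p"
        by (rule powr_mono2') (use m j R assms in auto)
      then have "?l \<le> ?f j" using True j' by (simp add: ennreal_leI)
      also have "\<dots> \<le> (\<Sum>j. ?f j)" by (rule suminf_ge_term_ennreal)
      finally show ?thesis .
    qed
    have "(\<integral>\<^sup>+(h::real^'n). indicator {h. l1norm h \<le> R} h * ennreal (l1norm h powr - p) \<partial>lborel)
      \<le> (\<integral>\<^sup>+(h::real^'n). (\<Sum>j. ennreal (?r (Suc j) powr - p) * indicator {h. l1norm h \<le> ?r j} h) \<partial>lborel)"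
      by (intro nn_integral_mono pw)
    also have "\<dots> = (\<Sum>j. ennreal (?r (Suc j) powr - p) * emeasure lborel {h::real^'n. l1norm h \<le> ?r j})"
      by (subst nn_integral_suminf) (auto simp: nn_integral_cmult_indicator)
    also have "\<dots> \<le> (\<Sum>j. ennreal (2 powr d * 2 powr p * R powr (d - p) * q ^ j))"
    proof (intro suminf_le summableI)
      fix j
      have r: "?r j > 0" using R by simp
      have "ennreal (?r (Suc j) powr - p) * emeasure lborel {h::real^'n. l1norm h \<le> ?r j}
        \<le> ennreal (?r (Suc j) powr - p) * ennreal ((2 * ?r j) ^ CARD('n))"
        by (intro mult_left_mono emeasure_l1norm_ball_le) (use r in auto)
      also have "\<dots> = ennreal (?r (Suc j) powr - p * (2 * ?r j) powr d)"
        using r by (simp add: ennreal_mult d_def powr_realpow)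
      also have "?r (Suc j) powr - p * (2 * ?r j) powr d = 2 powr d * 2 powr p * ?r j powr (d - p)"
      proof -
        have "(x / 2) powr - p * (2 * x) powr d = 2 powr d * 2 powr p * x powr (d - p)" if "x > 0" for x :: real
          using that by (simp add: powr_mult powr_diff powr_minus powr_divide field_simps)
        from this[OF r] show ?thesis by simp
      qed
      also have "?r j powr (d - p) = R powr (d - p) * q ^ j"
        using R by (simp add: powr_mult q_def powr_realpow[symmetric] powr_powr mult.commute)
      finally show "ennreal (?r (Suc j) powr - p) * emeasure lborel {h::real^'n. l1norm h \<le> ?r j}
        \<le> ennreal (2 powr d * 2 powr p * R powr (d - p) * q ^ j)" by (simp only: mult.assoc)
    qed
    also have "\<dots> = ennreal (C * R powr (d - p))"
      by (subst suminf_geometric_ennreal) (use q in \<open>auto simp: C_def\<close>)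
    finally show ?thesis by (simp add: d_def)
  qed
  ultimately show thesis by (rule that)
qed

text \<open>The same decomposition with growing shells
  \<open>2 ^ j \<le> l1norm h < 2 ^ Suc j\<close>; now \<open>p > d\<close> makes the ratio
  \<open>2 powr (d - p)\<close> less than \<open>1\<close>. The factor \<open>4 powr d\<close>
  combines the outer radius of a shell with the side of the enclosing cube.\<close>

lemma nn_integral_l1norm_powr_tail_finite:
  fixes p :: real
  assumes "real CARD('n) < p"
  shows "(\<integral>\<^sup>+(h::real^'n). indicator {h. 1 \<le> l1norm h} h * ennreal (l1norm h powr - p) \<partial>lborel) < \<infinity>"
proof -
  define d where "d = real CARD('n)"
  define q :: real where "q = 2 powr (d - p)"
  have q: "0 \<le> q" "q < 1"
    using assms unfolding q_def d_def by (simp_all add: powr_less_one)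
  let ?r = "\<lambda>j. 2 ^ j :: real"
  have pw: "indicator {h. 1 \<le> l1norm h} h * ennreal (l1norm h powr - p)
      \<le> (\<Sum>j. ennreal (?r j powr - p) * indicator {h. l1norm h \<le> ?r (Suc j)} h)" (is "?l \<le> (\<Sum>j. ?f j)")
    for h :: "real^'n"
  proof (cases "1 \<le> l1norm h")
    case True
    obtain n where n: "l1norm h < ?r n"
      using real_arch_pow[of 2 "l1norm h"] by auto
    define m where "m = (LEAST n. l1norm h < ?r n)"
    have m: "l1norm h < ?r m" unfolding m_def by (rule LeastI[of _ n]) (rule n)
    with True have "m \<noteq> 0" by (cases m) auto
    then obtain j where j: "m = Suc j" by (cases m) auto
    then have j': "?r j \<le> l1norm h"
      using not_less_Least[of j "\<lambda>n. l1norm h < ?r n"] unfolding m_def by auto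
    have "l1norm h powr - p \<le> ?r j powr - p"
      by (rule powr_mono2') (use j' assms in auto)
    then have "?l \<le> ?f j" using True m j by (simp add: ennreal_leI)
    also have "\<dots> \<le> (\<Sum>j. ?f j)" by (rule suminf_ge_term_ennreal)
    finally show ?thesis .
  qed auto
  have "(\<integral>\<^sup>+(h::real^'n). indicator {h. 1 \<le> l1norm h} h * ennreal (l1norm h powr - p) \<partial>lborel)
    \<le> (\<integral>\<^sup>+(h::real^'n). (\<Sum>j. ennreal (?r j powr - p) * indicator {h. l1norm h \<le> ?r (Suc j)} h) \<partial>lborel)"
    by (intro nn_integral_mono pw)
  also have "\<dots> = (\<Sum>j. ennreal (?r j powr - p) * emeasure lborel {h::real^'n. l1norm h \<le> ?r (Suc j)})"
    by (subst nn_integral_suminf) (auto simp: nn_integral_cmult_indicator)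
  also have "\<dots> \<le> (\<Sum>j. ennreal (4 powr d * q ^ j))"
  proof (intro suminf_le summableI)
    fix j
    have "ennreal (?r j powr - p) * emeasure lborel {h::real^'n. l1norm h \<le> ?r (Suc j)}
      \<le> ennreal (?r j powr - p) * ennreal ((2 * ?r (Suc j)) ^ CARD('n))"
      by (intro mult_left_mono emeasure_l1norm_ball_le) auto
    also have "\<dots> = ennreal (?r j powr - p * (4 * ?r j) powr d)"
      by (simp add: ennreal_mult d_def powr_realpow)
    also have "?r j powr - p * (4 * ?r j) powr d = 4 powr d * ?r j powr (d - p)"
      by (simp add: powr_mult powr_diff powr_minus field_simps)
    also have "?r j powr (d - p) = q ^ j"
      by (simp add: q_def powr_realpow[symmetric] powr_powr mult.commute)
    finally show "ennreal (?r j powr - p) * emeasure lborel {h::real^'n. l1norm h \<le> ?r (Suc j)}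
      \<le> ennreal (4 powr d * q ^ j)" .
  qed
  also have "\<dots> < \<infinity>"
    by (subst suminf_geometric_ennreal) (use q in auto)
  finally show ?thesis .
qed

section \<open>Fubini and changes of variables on pairs of points\<close>

lemma nn_integral_lborel_translation:
  fixes g :: "'a::euclidean_space \<Rightarrow> ennreal"
  assumes [measurable]: "g \<in> borel_measurable borel"
  shows "(\<integral>\<^sup>+y. g y \<partial>lborel) = (\<integral>\<^sup>+h. g (x + h) \<partial>lborel)"
  by (subst lborel_distr_plus[symmetric, of x]) (simp add: nn_integral_distr)

lemma nn_integral_lborel_pair:
  fixes f :: "'a::euclidean_space \<times> 'b::euclidean_space \<Rightarrow> ennreal"
  assumes [measurable]: "f \<in> borel_measurable borel"
  shows "(\<integral>\<^sup>+z. f z \<partial>lborel) = (\<integral>\<^sup>+x. \<integral>\<^sup>+y. f (x, y) \<partial>lborel \<partial>lborel)"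
proof -
  have "(\<integral>\<^sup>+z. f z \<partial>lborel) = (\<integral>\<^sup>+z. f z \<partial>(lborel \<Otimes>\<^sub>M lborel))"
    by (simp add: lborel_prod)
  also have "\<dots> = (\<integral>\<^sup>+x. \<integral>\<^sup>+y. f (x, y) \<partial>lborel \<partial>lborel)"
    by (rule lborel.nn_integral_fst[symmetric]) (simp add: lborel_prod)
  finally show ?thesis .
qed

lemma nn_integral_lborel_swap:
  fixes f :: "'a::euclidean_space \<Rightarrow> 'b::euclidean_space \<Rightarrow> ennreal"
  assumes "(\<lambda>z. f (fst z) (snd z)) \<in> borel_measurable borel"
  shows "(\<integral>\<^sup>+x. \<integral>\<^sup>+y. f x y \<partial>lborel \<partial>lborel) = (\<integral>\<^sup>+y. \<integral>\<^sup>+x. f x y \<partial>lborel \<partial>lborel)"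
  using lborel_pair.Fubini[of "\<lambda>z. f (fst z) (snd z)"] assms by (simp add: lborel_prod)

text \<open>The shear \<open>y = x + h\<close>. Integrating in \<open>x\<close> first turns the
  interaction of a set with its complement into an integral over \<open>h\<close> of the mass that
  the shift by \<open>h\<close> carries out of the set.\<close>

lemma nn_integral_difference_coordinates:
  fixes f :: "(real^'n) \<times> (real^'n) \<Rightarrow> ennreal"
  assumes [measurable]: "f \<in> borel_measurable borel"
  shows "(\<integral>\<^sup>+z. f z \<partial>lborel) = (\<integral>\<^sup>+h. \<integral>\<^sup>+x. f (x, x + h) \<partial>lborel \<partial>lborel)"
proof -
  have m [measurable]: "f \<in> borel_measurable (borel \<Otimes>\<^sub>M borel)"
    using assms by (simp add: borel_prod)
  have "(\<integral>\<^sup>+z. f z \<partial>lborel) = (\<integral>\<^sup>+x. \<integral>\<^sup>+y. f (x, y) \<partial>lborel \<partial>lborel)"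
    by (rule nn_integral_lborel_pair) simp
  also have "\<dots> = (\<integral>\<^sup>+x. \<integral>\<^sup>+h. f (x, x + h) \<partial>lborel \<partial>lborel)"
    by (intro nn_integral_cong nn_integral_lborel_translation) measurable
  also have "\<dots> = (\<integral>\<^sup>+h. \<integral>\<^sup>+x. f (x, x + h) \<partial>lborel \<partial>lborel)"
    by (rule nn_integral_lborel_swap) (simp add: borel_prod[symmetric])
  finally show ?thesis .
qed

text \<open>For fixed \<open>h\<close> the inner integral is the mass leaving \<open>A\<close>, at
  most \<open>C * l1norm h\<close>, and this factor lowers the exponent \<open>d + s\<close> by one.
  The set is general because the lemma serves both \<open>\<Omega>\<close> and a single
  cell.\<close>

lemma wker_perimeter_near:
  fixes A :: "(real^'n) set"
  assumes A [measurable]: "A \<in> sets borel" and C: "0 \<le> C"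
    and bd: "\<And>h. l1norm h \<le> R \<Longrightarrow> emeasure lborel {x\<in>A. x + h \<notin> A} \<le> ennreal (C * l1norm h)"
  shows "(\<integral>\<^sup>+z. indicator (A \<times> (- A)) z * indicator {z. l1norm (fst z - snd z) \<le> R} z
             * ennreal (wker s (fst z - snd z)) \<partial>lborel)
    \<le> ennreal C * (\<integral>\<^sup>+(h::real^'n). indicator {h. l1norm h \<le> R} h
           * ennreal (l1norm h powr - (real CARD('n) + s - 1)) \<partial>lborel)"
proof -
  let ?f = "\<lambda>z. indicator (A \<times> (- A)) z * indicator {z. l1norm (fst z - snd z) \<le> R} z
             * ennreal (wker s (fst z - snd z))"
  have m: "?f \<in> borel_measurable (borel \<Otimes>\<^sub>M borel)" by measurable
  have "(\<integral>\<^sup>+z. ?f z \<partial>lborel) = (\<integral>\<^sup>+h. \<integral>\<^sup>+x. ?f (x, x + h) \<partial>lborel \<partial>lborel)"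
    by (rule nn_integral_difference_coordinates) (use m in \<open>simp add: borel_prod\<close>)
  also have "\<dots> = (\<integral>\<^sup>+(h::real^'n). \<integral>\<^sup>+x. (indicator {h. l1norm h \<le> R} h * ennreal (wker s h))
       * indicator {x\<in>A. x + h \<notin> A} x \<partial>lborel \<partial>lborel)"
    by (intro nn_integral_cong) (auto simp: indicator_def wker_def)
  also have "\<dots> = (\<integral>\<^sup>+(h::real^'n). (indicator {h. l1norm h \<le> R} h * ennreal (wker s h))
       * emeasure lborel {x\<in>A. x + h \<notin> A} \<partial>lborel)"
    by (intro nn_integral_cong nn_integral_cmult_indicator) simp
  also have "\<dots> \<le> (\<integral>\<^sup>+(h::real^'n). ennreal C * (indicator {h. l1norm h \<le> R} h
           * ennreal (l1norm h powr - (real CARD('n) + s - 1))) \<partial>lborel)"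
  proof (intro nn_integral_mono)
    fix h :: "real^'n"
    show "(indicator {h. l1norm h \<le> R} h * ennreal (wker s h)) * emeasure lborel {x\<in>A. x + h \<notin> A}
      \<le> ennreal C * (indicator {h. l1norm h \<le> R} h * ennreal (l1norm h powr - (real CARD('n) + s - 1)))"
    proof (cases "l1norm h \<le> R")
      case True
      \<comment> \<open>At \<open>h = 0\<close> both sides vanish because
        \<open>0 powr a = 0\<close>.\<close>
      have e: "wker s h * (C * l1norm h) = C * l1norm h powr - (real CARD('n) + s - 1)"
      proof (cases "h = 0")
        case False
        then have p: "0 < l1norm h" using l1norm_nonneg[of h] by (simp add: less_le del: l1norm_nonneg)
        have "wker s h * l1norm h = l1norm h powr - (real CARD('n) + s) * l1norm h powr 1"
          using p by (simp add: wker_def)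
        also have "\<dots> = l1norm h powr - (real CARD('n) + s - 1)"
          by (subst powr_add[symmetric]) (simp add: algebra_simps)
        finally show ?thesis by (simp add: algebra_simps)
      qed (simp add: wker_def)
      have "ennreal (wker s h) * emeasure lborel {x\<in>A. x + h \<notin> A} \<le> ennreal (wker s h) * ennreal (C * l1norm h)"
        by (intro mult_left_mono bd True) simp
      also have "\<dots> = ennreal C * ennreal (l1norm h powr - (real CARD('n) + s - 1))"
        using C by (simp add: ennreal_mult[symmetric] e)
      finally show ?thesis using True by simp
    qed simp
  qed
  also have "\<dots> = ennreal C * (\<integral>\<^sup>+(h::real^'n). indicator {h. l1norm h \<le> R} h
           * ennreal (l1norm h powr - (real CARD('n) + s - 1)) \<partial>lborel)"
    by (rule nn_integral_cmult) measurable
  finally show ?thesis .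
qed

section \<open>Lipschitz domains\<close>

lemma emeasure_lborel_shift:
  fixes S :: "'a::euclidean_space set"
  assumes [measurable]: "S \<in> sets borel"
  shows "emeasure lborel {x. x - c \<in> S} = emeasure lborel S"
proof -
  have "emeasure lborel {x. x - c \<in> S} = (\<integral>\<^sup>+x. indicator {x. x - c \<in> S} x \<partial>lborel)"
    by (rule nn_integral_indicator[symmetric]) simp
  also have "\<dots> = (\<integral>\<^sup>+x. indicator S (x - c) \<partial>lborel)"
    by (intro nn_integral_cong) (simp add: indicator_def)
  also have "\<dots> = (\<integral>\<^sup>+x. indicator S x \<partial>lborel)"
    by (subst nn_integral_lborel_translation[where x=c]) auto
  finally show ?thesis by simp
qed

text \<open>The translates of the slab by multiples of its width in the direction \<open>v\<close> are disjoint,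
  and about \<open>1 / \<eta>\<close> of them fit into a fixed ball.\<close>
lemma emeasure_slab_le:
  fixes H :: "'a::euclidean_space \<Rightarrow> real"
  assumes [measurable]: "H \<in> borel_measurable borel"
    and H: "\<And>x t. H (x + t *\<^sub>R v) = H x + t"
    and v: "norm v \<le> 1" and \<eta>: "0 < \<eta>" "\<eta> \<le> 1"
  shows "emeasure lborel {x \<in> ball p r. a \<le> H x \<and> H x < a + \<eta>}
    \<le> ennreal (2 * measure lborel (ball p (r + 1)) * \<eta>)"
proof -
  let ?S = "{x \<in> ball p r. a \<le> H x \<and> H x < a + \<eta>}"
  \<comment> \<open>\<open>N * \<eta> \<le> 1\<close> keeps all translates within distance
    \<open>1\<close> of the slab, hence the radius \<open>r + 1\<close>;
    \<open>N \<ge> 1 / (2 * \<eta>)\<close>, valid because \<open>\<eta> \<le> 1\<close>, is the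
    source of the factor \<open>2\<close>.\<close>
  define N where "N = nat \<lfloor>1 / \<eta>\<rfloor>"
  have N: "1 \<le> real N" "real N * \<eta> \<le> 1" "1 \<le> 2 * \<eta> * real N"
  proof -
    have "1 \<le> 1 / \<eta>" using \<eta> by simp
    then have "1 \<le> \<lfloor>1 / \<eta>\<rfloor>" by linarith
    then have *: "real N = of_int \<lfloor>1 / \<eta>\<rfloor>" "1 \<le> \<lfloor>1 / \<eta>\<rfloor>"
      unfolding N_def by (auto intro!: of_nat_nat simp del: one_le_floor le_floor_iff zero_le_floor)
    then show "1 \<le> real N" by simp
    have "real N \<le> 1 / \<eta>" using * by simp
    then show "real N * \<eta> \<le> 1" using \<eta> by (simp add: field_simps)
    have "1 / \<eta> < real N + 1" using * by linarith
    also have "\<dots> \<le> 2 * real N" using \<open>1 \<le> real N\<close> by simp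
    finally show "1 \<le> 2 * \<eta> * real N" using \<eta> by (simp add: field_simps)
  qed
  define S where "S j = {x. x - (real j * \<eta>) *\<^sub>R v \<in> ?S}" for j :: nat
  have S0: "?S \<in> sets borel"
  proof -
    have "?S = ball p r \<inter> (H -` {a..<a + \<eta>} \<inter> space borel)" by auto
    also have "\<dots> \<in> sets borel" by (rule sets.Int[OF _ measurable_sets[OF assms(1)]]) auto
    finally show ?thesis .
  qed
  have Sm [measurable]: "S j \<in> sets borel" for j
  proof -
    have "S j = (\<lambda>x. x - (real j * \<eta>) *\<^sub>R v) -` ?S \<inter> space borel" by (auto simp: S_def)
    also have "\<dots> \<in> sets borel" by (rule measurable_sets[OF _ S0]) measurable
    finally show ?thesis .
  qed
  have SH: "a + real j * \<eta> \<le> H x \<and> H x < a + (real j + 1) * \<eta>" if "x \<in> S j" for j x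
    using that H[of "x - (real j * \<eta>) *\<^sub>R v" "real j * \<eta>"] by (auto simp: S_def algebra_simps)
  have disj: "disjoint_family_on S {..<N}"
  proof (unfold disjoint_family_on_def, safe)
    fix i j x assume ij: "i \<noteq> j" and x: "x \<in> S i" "x \<in> S j"
    have "real i * \<eta> < (real j + 1) * \<eta>" "real j * \<eta> < (real i + 1) * \<eta>"
      using SH[OF x(1)] SH[OF x(2)] by linarith+
    then have "real i < real j + 1" "real j < real i + 1"
      using \<eta> by (simp_all add: mult_less_cancel_right)
    with ij show "x \<in> {}" by linarith
  qed
  have sub: "(\<Union>j<N. S j) \<subseteq> ball p (r + 1)"
  proof
    fix x assume "x \<in> (\<Union>j<N. S j)"
    then obtain j where j: "j < N" "x \<in> S j" by auto
    have "norm ((real j * \<eta>) *\<^sub>R v) \<le> real j * \<eta>"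
      using v \<eta> by (simp add: mult_left_le)
    also have "\<dots> \<le> real N * \<eta>" using j \<eta> by simp
    finally have "norm ((real j * \<eta>) *\<^sub>R v) \<le> 1" using N by simp
    moreover have "dist p (x - (real j * \<eta>) *\<^sub>R v) < r"
      using j(2) unfolding S_def by simp
    moreover have "dist p x \<le> dist p (x - (real j * \<eta>) *\<^sub>R v) + norm ((real j * \<eta>) *\<^sub>R v)"
      using dist_triangle[of p x "x - (real j * \<eta>) *\<^sub>R v"] by (simp add: dist_norm)
    ultimately show "x \<in> ball p (r + 1)" by simp
  qed
  have fin: "emeasure lborel (ball p (r + 1)) = ennreal (measure lborel (ball p (r + 1)))"
    using emeasure_lborel_ball_finite[of p "r + 1"] by (simp add: emeasure_eq_ennreal_measure)
  have "of_nat N * emeasure lborel ?S = (\<Sum>j<N. emeasure lborel (S j))"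
    unfolding S_def by (subst emeasure_lborel_shift[OF S0]) simp
  also have "\<dots> = emeasure lborel (\<Union>j<N. S j)"
    using disj by (intro sum_emeasure) auto
  also have "\<dots> \<le> emeasure lborel (ball p (r + 1))"
    using sub by (intro emeasure_mono) auto
  finally have le: "of_nat N * emeasure lborel ?S \<le> ennreal (measure lborel (ball p (r + 1)))"
    using fin by simp
  have "emeasure lborel ?S \<le> ennreal (2 * \<eta> * real N) * emeasure lborel ?S"
  proof -
    have "ennreal 1 \<le> ennreal (2 * \<eta> * real N)" using N(3) by (rule ennreal_leI)
    from mult_right_mono[OF this, of "emeasure lborel ?S"] show ?thesis by simp
  qed
  also have "\<dots> = ennreal (2 * \<eta>) * (of_nat N * emeasure lborel ?S)"
    using \<eta> by (simp add: ennreal_mult mult.assoc ennreal_of_nat_eq_real_of_nat)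
  also have "\<dots> \<le> ennreal (2 * \<eta>) * ennreal (measure lborel (ball p (r + 1)))"
    by (intro mult_left_mono le) simp
  also have "\<dots> = ennreal (2 * measure lborel (ball p (r + 1)) * \<eta>)"
    using \<eta> by (simp add: ennreal_mult[symmetric] mult_ac)
  finally show ?thesis .
qed

text \<open>\<open>H\<close> below is the signed height over the graph: in the ball
  \<open>\<Omega>\<close> is \<open>H < 0\<close>, a step \<open>t\<close> in the vertical direction
  \<open>v\<close> adds \<open>t\<close> to \<open>H\<close>, and \<open>H\<close> is Lipschitz with
  constant \<open>1 + L\<close>. A point that a shift by \<open>h\<close> carries out of
  \<open>\<Omega>\<close> therefore lies in the slab \<open>- \<eta> \<le> H < 0\<close> with
  \<open>\<eta> = (1 + L) * l1norm h\<close>, and the frontier lies in slabs of arbitrarily small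
  width.\<close>

lemma lipschitz_boundary_chart:
  fixes \<Omega> :: "(real^'n) set"
  assumes lip: "lipschitz_boundary \<Omega>" and "open \<Omega>" and p: "p \<in> frontier \<Omega>"
  obtains r C \<delta> where "0 < r" "0 \<le> C" "0 < \<delta>"
    "\<And>h. l1norm h \<le> \<delta> \<Longrightarrow> emeasure lborel {x \<in> \<Omega> \<inter> ball p r. x + h \<in> ball p r - \<Omega>} \<le> ennreal (C * l1norm h)"
    "frontier \<Omega> \<inter> ball p r \<in> null_sets lborel"
proof -
  obtain r :: real and T :: "real^'n \<Rightarrow> real^'n" and k :: 'n and g :: "real^'n \<Rightarrow> real" and L :: real
    where r: "r > 0" and T: "orthogonal_transformation T" and g: "L-lipschitz_on UNIV g"
    and gk: "\<forall>x t. g (x + t *\<^sub>R axis k 1) = g x"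
    and \<Omega>: "\<Omega> \<inter> ball p r = {x \<in> ball p r. T (x - p) $ k < g (T (x - p))}"
    using bspec[OF lip[unfolded lipschitz_boundary_def] p] by blast
  have lin: "linear T" and nT: "\<And>x. norm (T x) = norm x"
    using T by (auto simp: orthogonal_transformation)
  obtain v where v: "T v = axis k 1"
    using orthogonal_transformation_surj[OF T] by (metis surjD)
  have nv: "norm v = 1" using nT[of v] v by simp
  have L0: "0 \<le> L" using g by (rule lipschitz_on_nonneg)
  define H where "H x = T (x - p) $ k - g (T (x - p))" for x
  have H: "H (x + t *\<^sub>R v) = H x + t" for x t
  proof -
    have "T (x + t *\<^sub>R v - p) = T (x - p) + t *\<^sub>R axis k 1"
      using linear_add[OF lin, of "x - p" "t *\<^sub>R v"] linear_cmul[OF lin, of t v] v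
      by (simp add: add_diff_eq diff_add_eq)
    then show ?thesis unfolding H_def by (simp add: gk)
  qed
  have Hlip: "\<bar>H (x + h) - H x\<bar> \<le> (1 + L) * norm h" for x h
  proof -
    have Th: "T (x + h - p) = T (x - p) + T h"
      using linear_add[OF lin, of "x - p" h] by (simp add: add_diff_eq diff_add_eq)
    have "\<bar>g (T (x + h - p)) - g (T (x - p))\<bar> \<le> L * norm h"
      using lipschitz_onD[OF g, of "T (x + h - p)" "T (x - p)"] by (simp add: dist_norm Th nT)
    moreover have "\<bar>T h $ k\<bar> \<le> norm h" using component_le_norm_cart[of "T h" k] by (simp add: nT)
    ultimately show ?thesis unfolding H_def Th by (simp add: algebra_simps)
  qed
  have Hcont: "continuous_on UNIV H"
  proof -
    have "(1 + L)-lipschitz_on UNIV H"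
    proof (rule lipschitz_onI)
      fix x y show "dist (H x) (H y) \<le> (1 + L) * dist x y"
        using Hlip[of y "x - y"] by (simp add: dist_norm)
    qed (use L0 in simp)
    then show ?thesis by (rule lipschitz_on_continuous_on)
  qed
  then have [measurable]: "H \<in> borel_measurable borel" by (rule borel_measurable_continuous_onI)
  have \<Omega>H: "x \<in> \<Omega> \<longleftrightarrow> H x < 0" if "x \<in> ball p r" for x
    using arg_cong[OF \<Omega>, of "\<lambda>A. x \<in> A"] that unfolding H_def by simp
  define M where "M = measure lborel (ball p (r + 1))"
  have M: "0 \<le> M" by (simp add: M_def)
  note slab = emeasure_slab_le[of H v, OF _ H, where p=p and r=r, folded M_def]
  have "emeasure lborel {x \<in> \<Omega> \<inter> ball p r. x + h \<in> ball p r - \<Omega>} \<le> ennreal ((2 * M * (1 + L)) * l1norm h)"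
    \<comment> \<open>The bound on \<open>h\<close> says exactly that \<open>\<eta> \<le> 1\<close>,
      as the slab estimate requires.\<close>
    if h: "l1norm h \<le> 1 / (1 + L)" for h
  proof (cases "h = 0")
    case True
    then have "{x \<in> \<Omega> \<inter> ball p r. x + h \<in> ball p r - \<Omega>} = {}" by auto
    then show ?thesis by (simp only: emeasure_empty) simp
  next
    case False
    define \<eta> where "\<eta> = (1 + L) * l1norm h"
    have \<eta>: "0 < \<eta>" "\<eta> \<le> 1"
    proof -
      have "0 < l1norm h" using False l1norm_nonneg[of h] by (simp add: less_le del: l1norm_nonneg)
      then show "0 < \<eta>" using L0 by (simp add: \<eta>_def)
      show "\<eta> \<le> 1" using h L0 by (simp add: \<eta>_def field_simps)
    qed
    have "{x \<in> \<Omega> \<inter> ball p r. x + h \<in> ball p r - \<Omega>} \<subseteq> {x \<in> ball p r. - \<eta> \<le> H x \<and> H x < - \<eta> + \<eta>}"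
    proof safe
      fix x assume x: "x \<in> \<Omega>" "x \<in> ball p r" and xh: "x + h \<in> ball p r" "x + h \<notin> \<Omega>"
      show "H x < - \<eta> + \<eta>" using x \<Omega>H by simp
      have "0 \<le> H (x + h)" using xh \<Omega>H by (simp add: not_less)
      moreover have "(1 + L) * norm h \<le> \<eta>"
        unfolding \<eta>_def using L0 norm_le_l1norm[of h] by (simp add: mult_left_mono)
      ultimately show "- \<eta> \<le> H x" using Hlip[of x h] by linarith
    qed
    then have "emeasure lborel {x \<in> \<Omega> \<inter> ball p r. x + h \<in> ball p r - \<Omega>}
      \<le> emeasure lborel {x \<in> ball p r. - \<eta> \<le> H x \<and> H x < - \<eta> + \<eta>}"
      by (intro emeasure_mono) auto
    also have "\<dots> \<le> ennreal (2 * M * \<eta>)" by (rule slab) (use nv \<eta> in auto)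
    finally show ?thesis by (simp add: \<eta>_def mult_ac)
  qed
  moreover have "frontier \<Omega> \<inter> ball p r \<in> null_sets lborel"
  proof -
    have sub: "frontier \<Omega> \<inter> ball p r \<subseteq> {x \<in> ball p r. 0 \<le> H x \<and> H x < 0 + \<eta>}" if "0 < \<eta>" for \<eta>
    proof safe
      fix x assume x: "x \<in> frontier \<Omega>" "x \<in> ball p r"
      then have "x \<notin> \<Omega>" using \<open>open \<Omega>\<close> by (simp add: frontier_def interior_open)
      then show "0 \<le> H x" using \<Omega>H x by (simp add: not_less)
      \<comment> \<open>A point of the ball with \<open>H > 0\<close> has a neighbourhood free of
        \<open>\<Omega>\<close>, so it is not in the closure.\<close>
      have "\<not> 0 < H x"
      proof
        assume "0 < H x"
        have "open (H -` {0<..} \<inter> ball p r)"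
          using Hcont by (intro open_Int open_vimage) (auto simp: )
        moreover have "x \<in> H -` {0<..} \<inter> ball p r" using x \<open>0 < H x\<close> by simp
        moreover have "x \<in> closure \<Omega>" using x by (simp add: frontier_def)
        ultimately obtain y where "y \<in> \<Omega>" "y \<in> H -` {0<..} \<inter> ball p r"
          unfolding closure_iff_nhds_not_empty by blast
        then show False using \<Omega>H[of y] by simp
      qed
      then show "H x < 0 + \<eta>" using that by simp
    qed
    have "emeasure lborel (frontier \<Omega> \<inter> ball p r) \<le> ennreal (2 * M * \<eta>)" if "0 < \<eta>" "\<eta> \<le> 1" for \<eta>
      by (rule order_trans[OF emeasure_mono[OF sub[OF that(1)]] slab]) (use that nv in auto)
    then have *: "emeasure lborel (frontier \<Omega> \<inter> ball p r) \<le> ennreal (2 * M * (1 / real (Suc n)))" for n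
      by this (simp_all add: divide_simps)
    have "(\<lambda>n. ennreal (2 * M * (1 / real (Suc n)))) \<longlonglongrightarrow> ennreal (2 * M * 0)"
      by (intro tendsto_ennrealI tendsto_mult tendsto_const LIMSEQ_Suc[OF lim_1_over_n])
    from LIMSEQ_le_const[OF this] * have "emeasure lborel (frontier \<Omega> \<inter> ball p r) \<le> 0" by simp
    then show ?thesis by (intro null_setsI) auto
  qed
  ultimately show thesis
    using that[of r "2 * M * (1 + L)" "1 / (1 + L)"] r M L0 by simp
qed

text \<open>The frontier is compact, so finitely many charts suffice. A shift that leaves
  \<open>\<Omega>\<close> crosses the frontier on the segment from \<open>x\<close> to
  \<open>x + h\<close>; the crossing point lies in the half-radius ball of some chart, and for short
  \<open>h\<close> both endpoints lie in its full ball, where the chart bound applies.\<close>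

lemma lipschitz_boundary_translation:
  fixes \<Omega> :: "(real^'n) set"
  assumes lip: "lipschitz_boundary \<Omega>" and op: "open \<Omega>" and bd: "bounded \<Omega>"
  obtains C \<delta> where "0 \<le> C" "0 < \<delta>"
    "\<And>h. l1norm h \<le> \<delta> \<Longrightarrow> emeasure lborel {x \<in> \<Omega>. x + h \<notin> \<Omega>} \<le> ennreal (C * l1norm h)"
    "frontier \<Omega> \<in> null_sets lborel"
proof -
  \<comment> \<open>All chart data in one predicate, so that radius, constant and threshold can be
    chosen as functions of the point.\<close>
  define Q where "Q p r C \<delta> \<longleftrightarrow> 0 < r \<and> 0 \<le> C \<and> (0::real) < \<delta> \<and>
    (\<forall>h. l1norm h \<le> \<delta> \<longrightarrow> emeasure lborel {x \<in> \<Omega> \<inter> ball p r. x + h \<in> ball p r - \<Omega>} \<le> ennreal (C * l1norm h)) \<and>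
    frontier \<Omega> \<inter> ball p r \<in> null_sets lborel" for p :: "real^'n" and r C \<delta>
  have "\<exists>t. Q p (fst t) (fst (snd t)) (snd (snd t))" if p: "p \<in> frontier \<Omega>" for p
  proof -
    obtain r C \<delta> where "Q p r C \<delta>"
      by (rule lipschitz_boundary_chart[OF lip op p]) (auto simp: Q_def)
    then show ?thesis by (intro exI[of _ "(r, C, \<delta>)"]) simp
  qed
  then obtain t where "\<And>p. p \<in> frontier \<Omega> \<Longrightarrow> Q p (fst (t p)) (fst (snd (t p))) (snd (snd (t p)))" by metis
  then obtain r C \<delta> where Q: "\<And>p. p \<in> frontier \<Omega> \<Longrightarrow> Q p (r p) (C p) (\<delta> p)"
    by (rule that[of "\<lambda>p. fst (t p)" "\<lambda>p. fst (snd (t p))" "\<lambda>p. snd (snd (t p))"])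
  note * = Q[unfolded Q_def]
  have "compact (frontier \<Omega>)" using bd by (simp add: compact_frontier_bounded)
  then obtain P where P: "P \<subseteq> frontier \<Omega>" "finite P" "frontier \<Omega> \<subseteq> (\<Union>p\<in>P. ball p (r p / 2))"
  proof (rule compactE_image)
    show "frontier \<Omega> \<subseteq> (\<Union>p\<in>frontier \<Omega>. ball p (r p / 2))" using * by force
  qed auto
  \<comment> \<open>With covering balls of half radius, \<open>r p / 4\<close> keeps both endpoints
    within \<open>r p\<close>; the inserted \<open>1\<close> takes care of an empty
    \<open>P\<close>.\<close>
  define d0 where "d0 = Min (insert 1 ((\<lambda>p. min (\<delta> p) (r p / 4)) ` P))"
  have d0: "0 < d0" "\<And>p. p \<in> P \<Longrightarrow> d0 \<le> \<delta> p" "\<And>p. p \<in> P \<Longrightarrow> d0 \<le> r p / 4"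
  proof -
    show "0 < d0" unfolding d0_def using P * by (subst Min_gr_iff) auto
    fix p assume "p \<in> P"
    then have "d0 \<le> min (\<delta> p) (r p / 4)" unfolding d0_def using P(2) by (intro Min_le) auto
    then show "d0 \<le> \<delta> p" "d0 \<le> r p / 4" by auto
  qed
  have "emeasure lborel {x \<in> \<Omega>. x + h \<notin> \<Omega>} \<le> ennreal ((\<Sum>p\<in>P. C p) * l1norm h)"
    if h: "l1norm h \<le> d0" for h
  proof -
    have [measurable]: "\<Omega> \<in> sets borel" using op by simp
    let ?A = "\<lambda>p. {x \<in> \<Omega> \<inter> ball p (r p). x + h \<in> ball p (r p) - \<Omega>}"
    have [measurable]: "ball p (r p) \<in> sets borel" for p by simp
    have Am: "?A p \<in> sets lborel" for p
    proof -
      have "?A p = {x. x \<in> \<Omega> \<and> x \<in> ball p (r p) \<and> x + h \<in> ball p (r p) \<and> x + h \<notin> \<Omega>}" by auto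
      also have "\<dots> \<in> sets borel" by measurable
      finally show ?thesis by simp
    qed
    have "{x \<in> \<Omega>. x + h \<notin> \<Omega>} \<subseteq> (\<Union>p\<in>P. ?A p)"
    proof safe
      fix x assume x: "x \<in> \<Omega>" "x + h \<notin> \<Omega>"
      have "closed_segment x (x + h) \<inter> frontier \<Omega> \<noteq> {}"
        using x by (intro connected_Int_frontier) auto
      then obtain y where y: "y \<in> closed_segment x (x + h)" "y \<in> frontier \<Omega>" by auto
      then obtain p where p: "p \<in> P" "dist p y < r p / 2" using P(3) by auto
      have nh: "norm h \<le> r p / 4" using norm_le_l1norm[of h] h d0(3)[OF p(1)] by linarith
      have rp: "0 < r p" using * P(1) p(1) by blast
      have "dist x y \<le> norm h" "dist (x + h) y \<le> norm h"
        using segment_bound[OF y(1)] by (simp_all add: dist_norm norm_minus_commute)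
      then have "dist p x < r p" "dist p (x + h) < r p"
        using dist_triangle[of p x y] dist_triangle[of p "x + h" y] nh p(2) rp
        by (simp_all add: dist_commute)
      then show "x \<in> (\<Union>p\<in>P. ?A p)" using p x by auto
    qed
    then have "emeasure lborel {x \<in> \<Omega>. x + h \<notin> \<Omega>} \<le> emeasure lborel (\<Union>p\<in>P. ?A p)"
      using P(2) Am by (intro emeasure_mono) auto
    also have "\<dots> \<le> (\<Sum>p\<in>P. emeasure lborel (?A p))"
      using P(2) Am by (intro emeasure_subadditive_finite) auto
    also have "\<dots> \<le> (\<Sum>p\<in>P. ennreal (C p * l1norm h))"
      using * P(1) d0(2) h by (intro sum_mono) (meson order_trans subsetD)
    also have "\<dots> = ennreal ((\<Sum>p\<in>P. C p) * l1norm h)"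
      using * P(1) by (subst sum_ennreal) (auto simp: sum_distrib_right)
    finally show ?thesis .
  qed
  moreover have "frontier \<Omega> \<in> null_sets lborel"
  proof -
    have 1: "(\<Union>p\<in>P. frontier \<Omega> \<inter> ball p (r p)) \<in> null_sets lborel"
      using P * by (intro null_sets_UN') (auto simp: countable_finite)
    have 2: "frontier \<Omega> \<subseteq> (\<Union>p\<in>P. frontier \<Omega> \<inter> ball p (r p))"
    proof
      fix x assume x: "x \<in> frontier \<Omega>"
      then obtain p where p: "p \<in> P" "dist p x < r p / 2" using P(3) by auto
      moreover have "0 < r p" using * P(1) p(1) by blast
      ultimately show "x \<in> (\<Union>p\<in>P. frontier \<Omega> \<inter> ball p (r p))"
        using x by (intro UN_I[of p]) auto
    qed
    show ?thesis by (rule null_sets_subset[OF 1 _ 2]) (simp add: borel_closed)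
  qed
  moreover have "0 \<le> (\<Sum>p\<in>P. C p)" using P(1) * by (intro sum_nonneg) auto
  ultimately show thesis using that d0(1) by blast
qed

text \<open>Pairs closer than \<open>\<delta>\<close> fall under \<open>wker_perimeter_near\<close>,
  whose exponent \<open>d + s - 1\<close> is below \<open>d\<close> since \<open>s < 1\<close>. For
  the others the kernel is dominated by an integrable function of the difference, and the first
  point ranges over a set of finite measure.\<close>

lemma lipschitz_boundary_finite_wker_perimeter:
  fixes \<Omega> :: "(real^'n) set"
  assumes lip: "lipschitz_boundary \<Omega>" and op: "open \<Omega>" and bd: "bounded \<Omega>" and s: "0 < s" "s < 1"
  shows "(\<integral>\<^sup>+z. indicator (\<Omega> \<times> (- \<Omega>)) z * ennreal (wker s (fst z - snd z)) \<partial>lborel) < \<infinity>"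
proof -
  have [measurable]: "\<Omega> \<in> sets borel" using op by simp
  obtain C \<delta> where C: "0 \<le> C" "0 < \<delta>"
    and tr: "\<And>h. l1norm h \<le> \<delta> \<Longrightarrow> emeasure lborel {x \<in> \<Omega>. x + h \<notin> \<Omega>} \<le> ennreal (C * l1norm h)"
    by (rule lipschitz_boundary_translation[OF lip op bd]) blast
  have card1: "1 \<le> real CARD('n)" using zero_less_card_finite[where 'a='n] by linarith
  obtain C1 where C1: "\<And>R. 0 < R \<Longrightarrow> (\<integral>\<^sup>+(h::real^'n). indicator {h. l1norm h \<le> R} h
       * ennreal (l1norm h powr - (real CARD('n) + s - 1)) \<partial>lborel)
        \<le> ennreal (C1 * R powr (real CARD('n) - (real CARD('n) + s - 1)))"
    by (rule nn_integral_l1norm_powr_ball[of "real CARD('n) + s - 1", where 'n='n])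
       ((use s card1 in linarith)+, blast)
  let ?D = "\<Omega> \<times> (- \<Omega>)" and ?w = "\<lambda>z. ennreal (wker s (fst z - snd z))"
  let ?near = "\<lambda>z. indicator ?D z * indicator {z. l1norm (fst z - snd z) \<le> \<delta>} z * ?w z"
  let ?c = "ennreal (\<delta> powr - (real CARD('n) + s))"
  \<comment> \<open>Dominates the kernel beyond distance \<open>\<delta>\<close>: a constant on the
    unit ball, since the kernel is at most its value at distance \<open>\<delta>\<close>, and the
    kernel itself outside.\<close>
  let ?g = "\<lambda>h::real^'n. indicator {h. l1norm h \<le> 1} h * ?c
    + indicator {h. 1 \<le> l1norm h} h * ennreal (l1norm h powr - (real CARD('n) + s))"
  have nm [measurable]: "?near \<in> borel_measurable borel" unfolding borel_prod[symmetric] by measurable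
  have "(\<integral>\<^sup>+z. indicator ?D z * ?w z \<partial>lborel)
    \<le> (\<integral>\<^sup>+z. ?near z + indicator \<Omega> (fst z) * ?g (snd z - fst z) \<partial>lborel)"
  proof (intro nn_integral_mono)
    fix z :: "(real^'n) \<times> (real^'n)"
    have w: "?w z \<le> ?g (snd z - fst z)" if "\<not> l1norm (fst z - snd z) \<le> \<delta>"
    proof (cases "1 \<le> l1norm (snd z - fst z)")
      case True
      then show ?thesis by (auto simp: indicator_def wker_def l1norm_minus_commute add_increasing)
    next
      case False
      have "wker s (fst z - snd z) \<le> \<delta> powr - (real CARD('n) + s)"
        unfolding wker_def by (rule powr_mono2') (use that C s in auto)
      then show ?thesis using False by (auto simp: indicator_def ennreal_leI)
    qed
    show "indicator ?D z * ?w z \<le> ?near z + indicator \<Omega> (fst z) * ?g (snd z - fst z)"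
    proof (cases "z \<in> ?D \<and> \<not> l1norm (fst z - snd z) \<le> \<delta>")
      case True
      then have "fst z \<in> \<Omega>" "z \<in> ?D" by auto
      then show ?thesis using w True by simp
    qed (auto simp: indicator_def add_increasing2)
  qed
  also have "\<dots> = (\<integral>\<^sup>+z. ?near z \<partial>lborel) + (\<integral>\<^sup>+z. indicator \<Omega> (fst z) * ?g (snd z - fst z) \<partial>lborel)"
    by (intro nn_integral_add) (unfold borel_prod[symmetric] measurable_lborel2, measurable)
  also have "\<dots> < \<infinity>"
  proof -
    have "(\<integral>\<^sup>+z. ?near z \<partial>lborel) \<le> ennreal C * ennreal (C1 * \<delta> powr (real CARD('n) - (real CARD('n) + s - 1)))"
      by (rule order_trans[OF wker_perimeter_near mult_left_mono]) (use C tr C1 in auto)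
    also have "\<dots> < \<infinity>" by (simp add: ennreal_mult_less_top)
    finally have 1: "(\<integral>\<^sup>+z. ?near z \<partial>lborel) < \<infinity>" .
    have "(\<integral>\<^sup>+z. indicator \<Omega> (fst z) * ?g (snd z - fst z) \<partial>lborel)
      = (\<integral>\<^sup>+h. \<integral>\<^sup>+x. indicator \<Omega> x * ?g h \<partial>lborel \<partial>lborel)"
      by (subst nn_integral_difference_coordinates) (simp_all, unfold borel_prod[symmetric], measurable)
    also have "\<dots> = (\<integral>\<^sup>+h. emeasure lborel \<Omega> * ?g h \<partial>lborel)"
      by (intro nn_integral_cong) (subst nn_integral_multc, auto)
    also have "\<dots> = emeasure lborel \<Omega> * (\<integral>\<^sup>+h. ?g h \<partial>lborel)"
      by (rule nn_integral_cmult) measurable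
    also have "(\<integral>\<^sup>+h. ?g h \<partial>lborel) = emeasure lborel {h::real^'n. l1norm h \<le> 1} * ?c
      + (\<integral>\<^sup>+(h::real^'n). indicator {h. 1 \<le> l1norm h} h * ennreal (l1norm h powr - (real CARD('n) + s)) \<partial>lborel)"
      by (subst nn_integral_add) (auto simp: nn_integral_multc)
    also have "emeasure lborel \<Omega> * \<dots> < \<infinity>"
    proof -
      have "emeasure lborel \<Omega> < \<infinity>" using bd by (rule emeasure_bounded_finite)
      moreover have "emeasure lborel {h::real^'n. l1norm h \<le> 1} < \<infinity>"
        using emeasure_l1norm_ball_le[of 1, where 'n='n] by (auto intro: le_less_trans)
      ultimately show ?thesis
        using nn_integral_l1norm_powr_tail_finite[of "real CARD('n) + s", where 'n='n] s
        by (simp add: ennreal_mult_less_top)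
    qed
    finally show ?thesis using 1 by simp
  qed
  finally show ?thesis .
qed

section \<open>Cells\<close>

lemma borel_measurable_vec_nth [measurable]: "(\<lambda>x::real^'n. x $ i) \<in> borel_measurable borel"
  by (intro borel_measurable_continuous_onI continuous_intros)

lemma real_card_ge_1: "1 \<le> real CARD('n::finite)"
  using zero_less_card_finite[where 'a='n] by linarith

text \<open>Rounding to the nearest point of the lattice \<open>\<epsilon> \<int>\<^sup>n\<close>. Its fibres are half-open cubes; they
  partition the space and contain the open cubes in the definition of \<open>Xeps\<close>.\<close>
definition ctr :: "real \<Rightarrow> real^'n \<Rightarrow> real^'n" where
  "ctr \<epsilon> x = (\<chi> i. \<epsilon> * of_int \<lfloor>x $ i / \<epsilon> + 1 / 2\<rfloor>)"

lemma borel_measurable_ctr [measurable]: "ctr \<epsilon> \<in> borel_measurable borel"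
proof (subst borel_measurable_euclidean_space, intro ballI)
  fix b :: "real^'n" assume "b \<in> Basis"
  then obtain i where "b = axis i 1" by (auto simp: Basis_vec_def)
  then have "(\<lambda>x. ctr \<epsilon> x \<bullet> b) = (\<lambda>x. \<epsilon> * of_int \<lfloor>x $ i / \<epsilon> + 1 / 2\<rfloor>)"
    by (simp add: inner_axis ctr_def)
  then show "(\<lambda>x. ctr \<epsilon> x \<bullet> b) \<in> borel_measurable borel" by simp
qed

lemma ctr_bounds:
  assumes "0 < \<epsilon>"
  shows "ctr \<epsilon> x $ i - \<epsilon> / 2 \<le> x $ i" "x $ i < ctr \<epsilon> x $ i + \<epsilon> / 2"
proof -
  have "of_int \<lfloor>x $ i / \<epsilon> + 1 / 2\<rfloor> \<le> x $ i / \<epsilon> + 1 / 2" by simp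
  from mult_left_mono[OF this, of \<epsilon>] assms
  show "ctr \<epsilon> x $ i - \<epsilon> / 2 \<le> x $ i" by (simp add: ctr_def algebra_simps)
  have "x $ i / \<epsilon> + 1 / 2 < of_int \<lfloor>x $ i / \<epsilon> + 1 / 2\<rfloor> + 1" by simp
  from mult_strict_left_mono[OF this, of \<epsilon>] assms
  show "x $ i < ctr \<epsilon> x $ i + \<epsilon> / 2" by (simp add: ctr_def algebra_simps)
qed

lemma ctr_eqI:
  assumes "0 < \<epsilon>" and i: "i \<in> int_lattice"
    and b: "\<And>j. (\<epsilon> *\<^sub>R i) $ j - \<epsilon> / 2 \<le> x $ j" "\<And>j. x $ j < (\<epsilon> *\<^sub>R i) $ j + \<epsilon> / 2"
  shows "ctr \<epsilon> x = \<epsilon> *\<^sub>R i"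
proof (subst vec_eq_iff, intro allI)
  fix j
  obtain k where k: "i $ j = of_int k" using i unfolding int_lattice_def by (auto elim: Ints_cases)
  have "of_int k \<le> x $ j / \<epsilon> + 1 / 2" "x $ j / \<epsilon> + 1 / 2 < of_int k + 1"
    using b[of j] assms(1) k by (simp_all add: field_simps)
  then have "\<lfloor>x $ j / \<epsilon> + 1 / 2\<rfloor> = k" by (simp add: floor_eq_iff)
  then show "ctr \<epsilon> x $ j = (\<epsilon> *\<^sub>R i) $ j" by (simp add: ctr_def k)
qed

lemma ctr_scaled_lattice:
  assumes "0 < \<epsilon>" "i \<in> int_lattice"
  shows "ctr \<epsilon> (\<epsilon> *\<^sub>R i) = \<epsilon> *\<^sub>R i"
  by (rule ctr_eqI[OF assms]) (use assms(1) in auto)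

lemma ctr_lattice: obtains i where "i \<in> int_lattice" "ctr \<epsilon> x = \<epsilon> *\<^sub>R i"
proof (rule that)
  show "(\<chi> i. of_int \<lfloor>x $ i / \<epsilon> + 1 / 2\<rfloor>) \<in> int_lattice" by (simp add: int_lattice_def)
  show "ctr \<epsilon> x = \<epsilon> *\<^sub>R (\<chi> i. of_int \<lfloor>x $ i / \<epsilon> + 1 / 2\<rfloor>)" by (simp add: ctr_def vec_eq_iff)
qed

lemma cell_eq:
  assumes "0 < \<epsilon>"
  shows "{y. ctr \<epsilon> y = ctr \<epsilon> x} = {y. \<forall>i. ctr \<epsilon> x $ i - \<epsilon> / 2 \<le> y $ i \<and> y $ i < ctr \<epsilon> x $ i + \<epsilon> / 2}"
proof safe
  fix y assume b: "\<forall>i. ctr \<epsilon> x $ i - \<epsilon> / 2 \<le> y $ i \<and> y $ i < ctr \<epsilon> x $ i + \<epsilon> / 2"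
  obtain i where i: "i \<in> int_lattice" "ctr \<epsilon> x = \<epsilon> *\<^sub>R i" by (rule ctr_lattice)
  show "ctr \<epsilon> y = ctr \<epsilon> x" unfolding i(2) by (rule ctr_eqI[OF assms i(1)]) (use b i(2) in auto)
qed (use ctr_bounds[OF assms] in metis)+

lemma same_cell_component:
  assumes "0 < \<epsilon>" "ctr \<epsilon> x = ctr \<epsilon> y"
  shows "\<bar>x $ i - y $ i\<bar> \<le> \<epsilon>"
  using ctr_bounds[OF assms(1), of x i] ctr_bounds[OF assms(1), of y i] assms(2) by (simp add: abs_le_iff)

lemma same_cell_l1norm:
  fixes x y :: "real^'n"
  assumes "0 < \<epsilon>" "ctr \<epsilon> x = ctr \<epsilon> y"
  shows "l1norm (x - y) \<le> real CARD('n) * \<epsilon>"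
  by (rule l1norm_le_card) (simp add: same_cell_component[OF assms])

text \<open>Half of the bound would do, up to strictness; the slack makes it strict, as the open
  balls in the later definition of \<open>recov\<close> require.\<close>

lemma dist_ctr_less:
  fixes x :: "real^'n"
  assumes "0 < \<epsilon>"
  shows "dist (ctr \<epsilon> x) x < real CARD('n) * \<epsilon>"
proof -
  have "\<bar>(ctr \<epsilon> x - x) $ i\<bar> \<le> \<epsilon> / 2" for i
    using ctr_bounds[OF assms, of x i] unfolding vector_minus_component by linarith
  then have "l1norm (ctr \<epsilon> x - x) \<le> real CARD('n) * (\<epsilon> / 2)" by (rule l1norm_le_card)
  also have "\<dots> < real CARD('n) * \<epsilon>" using assms by simp
  finally show ?thesis using norm_le_l1norm[of "ctr \<epsilon> x - x"] by (simp add: dist_norm)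
qed

lemma emeasure_cart_cbox:
  fixes a b :: "real^'n"
  assumes "\<And>i. a $ i \<le> b $ i"
  shows "emeasure lborel (cbox a b) = ennreal (\<Prod>i\<in>UNIV. b $ i - a $ i)"
proof -
  have "cbox a b \<noteq> {}" using assms by (simp add: interval_eq_empty_cart not_less)
  then have "measure lborel (cbox a b) = (\<Prod>i\<in>UNIV. b $ i - a $ i)" by (rule content_cbox_cart)
  then show ?thesis
    using emeasure_lborel_cbox_finite[of a b] by (simp add: emeasure_eq_ennreal_measure less_top)
qed

text \<open>The half-open cell is squeezed between an open and a closed box of the same
  measure.\<close>

lemma emeasure_cell:
  fixes x :: "real^'n"
  assumes "0 < \<epsilon>"
  shows "emeasure lborel {y. ctr \<epsilon> y = ctr \<epsilon> x} = ennreal (\<epsilon> ^ CARD('n))"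
proof -
  let ?a = "ctr \<epsilon> x - (\<chi> i. \<epsilon> / 2)" and ?b = "ctr \<epsilon> x + (\<chi> i. \<epsilon> / 2)"
  have cb: "emeasure lborel (cbox ?a ?b) = ennreal (\<epsilon> ^ CARD('n))"
    using assms by (subst emeasure_cart_cbox) simp_all
  have "emeasure lborel (box ?a ?b) = emeasure lborel (cbox ?a ?b)"
    by (simp add: emeasure_lborel_box_eq emeasure_lborel_cbox_eq)
  moreover have "emeasure lborel (box ?a ?b) \<le> emeasure lborel {y. ctr \<epsilon> y = ctr \<epsilon> x}"
    unfolding cell_eq[OF assms] by (intro emeasure_mono) (auto simp: mem_box_cart less_imp_le)
  moreover have "emeasure lborel {y. ctr \<epsilon> y = ctr \<epsilon> x} \<le> emeasure lborel (cbox ?a ?b)"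
    unfolding cell_eq[OF assms] by (intro emeasure_mono) (auto simp: mem_box_cart less_imp_le)
  ultimately show ?thesis using cb by simp
qed

text \<open>A point leaving its cell does so through some coordinate \<open>i\<close>, hence lies
  within \<open>\<bar>h $ i\<bar>\<close> of the face towards which that coordinate moves. Summing
  the slabs at these faces produces \<open>l1norm h\<close>. This is the shift hypothesis of
  \<open>wker_perimeter_near\<close> for a cell.\<close>

lemma emeasure_cell_translation:
  fixes x h :: "real^'n"
  assumes "0 < \<epsilon>"
  defines "Q \<equiv> {y. ctr \<epsilon> y = ctr \<epsilon> x}"
  shows "emeasure lborel {y\<in>Q. y + h \<notin> Q} \<le> ennreal (\<epsilon> ^ (CARD('n) - 1) * l1norm h)"
proof -
  let ?c = "ctr \<epsilon> x"
  \<comment> \<open>Slab \<open>i\<close> has thickness \<open>\<bar>h $ i\<bar>\<close>, at the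
    upper face if \<open>h $ i\<close> is nonnegative and at the lower face otherwise, and width
    \<open>\<epsilon>\<close> in the other coordinates.\<close>
  define a b where "a i = (\<chi> j. if j = i \<and> 0 \<le> h $ i then ?c $ j + \<epsilon> / 2 - h $ i else ?c $ j - \<epsilon> / 2)"
    and "b i = (\<chi> j. if j = i \<and> h $ i < 0 then ?c $ j - \<epsilon> / 2 - h $ i else ?c $ j + \<epsilon> / 2)" for i
  have B: "emeasure lborel (cbox (a i) (b i)) = ennreal (\<epsilon> ^ (CARD('n) - 1) * \<bar>h $ i\<bar>)" for i
  proof -
    have "emeasure lborel (cbox (a i) (b i)) = ennreal (\<Prod>j\<in>UNIV. b i $ j - a i $ j)"
      using assms(1) by (intro emeasure_cart_cbox) (auto simp: a_def b_def)
    also have "(\<Prod>j\<in>UNIV. b i $ j - a i $ j) = (b i $ i - a i $ i) * (\<Prod>j\<in>UNIV - {i}. b i $ j - a i $ j)"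
      by (rule prod.remove) auto
    also have "b i $ i - a i $ i = \<bar>h $ i\<bar>" by (auto simp: a_def b_def)
    also have "(\<Prod>j\<in>UNIV - {i}. b i $ j - a i $ j) = (\<Prod>j\<in>UNIV - {i}. \<epsilon>)"
      by (intro prod.cong) (auto simp: a_def b_def)
    also have "\<dots> = \<epsilon> ^ (CARD('n) - 1)" by (simp add: card_Diff_singleton)
    finally show ?thesis by (simp add: mult.commute)
  qed
  have "{y\<in>Q. y + h \<notin> Q} \<subseteq> (\<Union>i\<in>UNIV. cbox (a i) (b i))"
  proof safe
    fix y assume y: "y \<in> Q" "y + h \<notin> Q"
    have y1: "?c $ j - \<epsilon> / 2 \<le> y $ j" "y $ j < ?c $ j + \<epsilon> / 2" for j
      using y(1) unfolding Q_def cell_eq[OF assms(1)] by auto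
    obtain i where i: "y $ i + h $ i < ?c $ i - \<epsilon> / 2 \<or> ?c $ i + \<epsilon> / 2 \<le> y $ i + h $ i"
      using y(2) unfolding Q_def cell_eq[OF assms(1)] by (auto simp: not_le not_less)
    have "y \<in> cbox (a i) (b i)"
      unfolding mem_box_cart
    proof
      fix j show "a i $ j \<le> y $ j \<and> y $ j \<le> b i $ j"
        using i y1[of j] y1[of i] by (auto simp: a_def b_def)
    qed
    then show "y \<in> (\<Union>i\<in>UNIV. cbox (a i) (b i))" by auto
  qed
  then have "emeasure lborel {y\<in>Q. y + h \<notin> Q} \<le> emeasure lborel (\<Union>i\<in>UNIV. cbox (a i) (b i))"
    by (intro emeasure_mono) auto
  also have "\<dots> \<le> (\<Sum>i\<in>UNIV. emeasure lborel (cbox (a i) (b i)))"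
    by (intro emeasure_subadditive_finite) auto
  also have "\<dots> = ennreal (\<epsilon> ^ (CARD('n) - 1) * l1norm h)"
    using assms(1) by (simp add: B sum_ennreal l1norm_def sum_distrib_left)
  finally show ?thesis .
qed

text \<open>For separated cells all distances between their points are comparable, hence so are the
  kernel values. For touching cells the kernel is unbounded on the product, but its integral is at
  most the short-range perimeter of one cell, of order \<open>\<epsilon> powr (d - s)\<close>; this
  is \<open>\<epsilon> powr (2 * d)\<close> times the kernel at a distance of order
  \<open>\<epsilon>\<close>.\<close>

lemma different_cells_integral_le:
  assumes s: "0 < s" "s < 1"
  obtains C where "0 \<le> C"
    "\<And>\<epsilon> (x::real^'n) y. 0 < \<epsilon> \<Longrightarrow> ctr \<epsilon> x \<noteq> ctr \<epsilon> y \<Longrightarrow>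
      (\<integral>\<^sup>+z. indicator {z. ctr \<epsilon> (fst z) = ctr \<epsilon> x \<and> ctr \<epsilon> (snd z) = ctr \<epsilon> y} z
          * ennreal (wker s (fst z - snd z)) \<partial>lborel)
        \<le> ennreal (C * \<epsilon> ^ (2 * CARD('n)) * wker s (x - y))"
proof -
  define d where "d = real CARD('n)"
  define q where "q = d + s"
  have d1: "1 \<le> d" unfolding d_def by (rule real_card_ge_1)
  have q0: "0 < q" using d1 s by (simp add: q_def)
  have w: "wker s h = l1norm h powr - q" for h :: "real^'n" by (simp add: wker_def q_def d_def)
  obtain C1 where C1: "0 \<le> C1" "\<And>R. 0 < R \<Longrightarrow> (\<integral>\<^sup>+(h::real^'n). indicator {h. l1norm h \<le> R} h
       * ennreal (l1norm h powr - (real CARD('n) + s - 1)) \<partial>lborel)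
        \<le> ennreal (C1 * R powr (real CARD('n) - (real CARD('n) + s - 1)))"
    by (rule nn_integral_l1norm_powr_ball[of "real CARD('n) + s - 1", where 'n='n])
       ((use s d1[unfolded d_def] in linarith)+, blast)
  \<comment> \<open>The entries are the constants of the separated and of the touching case.\<close>
  define C where "C = max ((4 * d) powr q) (C1 * (2 * d) powr (d + 1))"
  have "0 \<le> C" by (simp add: C_def le_max_iff_disj)
  moreover have "(\<integral>\<^sup>+z. indicator {z. ctr \<epsilon> (fst z) = ctr \<epsilon> x \<and> ctr \<epsilon> (snd z) = ctr \<epsilon> y} z
          * ennreal (wker s (fst z - snd z)) \<partial>lborel)
        \<le> ennreal (C * \<epsilon> ^ (2 * CARD('n)) * wker s (x - y))" (is "?I \<le> _")
    if \<epsilon>: "0 < \<epsilon>" and ne: "ctr \<epsilon> x \<noteq> ctr \<epsilon> y" for \<epsilon> and x y :: "real^'n"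
  proof -
    let ?Q = "\<lambda>x. {y. ctr \<epsilon> y = ctr \<epsilon> x}"
    have xy: "x \<noteq> y" using ne by auto
    then have lpos: "0 < l1norm (x - y)" using l1norm_nonneg[of "x - y"] by (simp add: less_le del: l1norm_nonneg)
    have prodQ: "{z. ctr \<epsilon> (fst z) = ctr \<epsilon> x \<and> ctr \<epsilon> (snd z) = ctr \<epsilon> y} = ?Q x \<times> ?Q y" by auto
    have Qm [measurable]: "?Q x \<in> sets borel" for x :: "real^'n" by measurable
    show ?thesis
    proof (cases "\<exists>i. 2 * \<epsilon> \<le> \<bar>ctr \<epsilon> x $ i - ctr \<epsilon> y $ i\<bar>")
      case True
      \<comment> \<open>The largest coordinate difference of the centres. As
        \<open>M \<ge> 2 * \<epsilon>\<close>, points of the two cells differ by at most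
        \<open>2 * M\<close> in every coordinate and by at least \<open>M / 2\<close> in the maximal
        one; passing to \<open>l1norm\<close> costs a factor \<open>d\<close>, whence
        \<open>4 * d\<close>.\<close>
      define M where "M = Max (range (\<lambda>i. \<bar>ctr \<epsilon> x $ i - ctr \<epsilon> y $ i\<bar>))"
      have Mge: "\<bar>ctr \<epsilon> x $ i - ctr \<epsilon> y $ i\<bar> \<le> M" for i unfolding M_def by (rule Max_ge) auto
      have "M \<in> range (\<lambda>i. \<bar>ctr \<epsilon> x $ i - ctr \<epsilon> y $ i\<bar>)" unfolding M_def by (rule Max_in) auto
      then obtain i where i: "M = \<bar>ctr \<epsilon> x $ i - ctr \<epsilon> y $ i\<bar>" by auto
      have M2: "2 * \<epsilon> \<le> M" using True Mge by (meson order_trans)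
      have "\<bar>(x - y) $ j\<bar> \<le> 2 * M" for j
        using ctr_bounds[OF \<epsilon>, of x j] ctr_bounds[OF \<epsilon>, of y j] Mge[of j] M2 \<epsilon>
        unfolding vector_minus_component by linarith
      then have "l1norm (x - y) \<le> d * (2 * M)" unfolding d_def by (rule l1norm_le_card)
      then have up: "l1norm (x - y) / (4 * d) \<le> M / 2" using d1 by (simp add: field_simps)
      have wb: "wker s (x' - y') \<le> (4 * d) powr q * wker s (x - y)"
        if "ctr \<epsilon> x' = ctr \<epsilon> x" "ctr \<epsilon> y' = ctr \<epsilon> y" for x' y'
      proof -
        have "M / 2 \<le> \<bar>(x' - y') $ i\<bar>"
          using ctr_bounds[OF \<epsilon>, of x' i, unfolded that] ctr_bounds[OF \<epsilon>, of y' i, unfolded that] M2 i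
          unfolding vector_minus_component by linarith
        also have "\<dots> \<le> l1norm (x' - y')" by (rule component_le_l1norm)
        finally have "l1norm (x - y) / (4 * d) \<le> l1norm (x' - y')" using up by linarith
        then have "wker s (x' - y') \<le> (l1norm (x - y) / (4 * d)) powr - q"
          unfolding w using lpos d1 q0 by (intro powr_mono2') auto
        also have "\<dots> = (4 * d) powr q * wker s (x - y)"
          unfolding w using lpos d1 by (simp add: powr_divide powr_minus field_simps)
        finally show ?thesis .
      qed
      have "?I \<le> (\<integral>\<^sup>+z. ennreal ((4 * d) powr q * wker s (x - y)) * indicator (?Q x \<times> ?Q y) z \<partial>lborel)"
        unfolding prodQ using wb by (intro nn_integral_mono) (auto simp: indicator_def ennreal_leI)
      also have "\<dots> = ennreal ((4 * d) powr q * wker s (x - y)) * emeasure (lborel \<Otimes>\<^sub>M lborel) (?Q x \<times> ?Q y)"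
        by (subst nn_integral_cmult_indicator) (auto simp: lborel_prod borel_prod[symmetric])
      also have "emeasure (lborel \<Otimes>\<^sub>M lborel) (?Q x \<times> ?Q y) = ennreal (\<epsilon> ^ (2 * CARD('n)))"
        using \<epsilon> by (subst lborel.emeasure_pair_measure_Times)
          (auto simp: emeasure_cell[OF \<epsilon>] ennreal_mult[symmetric] mult_2 power_add)
      also have "ennreal ((4 * d) powr q * wker s (x - y)) * \<dots> = ennreal ((4 * d) powr q * \<epsilon> ^ (2 * CARD('n)) * wker s (x - y))"
        using \<epsilon> by (simp add: ennreal_mult[symmetric] mult_ac)
      also have "\<dots> \<le> ennreal (C * \<epsilon> ^ (2 * CARD('n)) * wker s (x - y))"
        using \<epsilon> by (intro ennreal_leI mult_right_mono) (auto simp: C_def)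
      finally show ?thesis .
    next
      case False
      \<comment> \<open>Centres lie on a lattice of mesh \<open>\<epsilon>\<close>, so a coordinate
        difference below \<open>2 * \<epsilon>\<close> is at most \<open>\<epsilon>\<close>.\<close>
      have near: "\<bar>ctr \<epsilon> x $ i - ctr \<epsilon> y $ i\<bar> \<le> \<epsilon>" for i
      proof -
        let ?k = "\<lfloor>x $ i / \<epsilon> + 1 / 2\<rfloor> - \<lfloor>y $ i / \<epsilon> + 1 / 2\<rfloor>"
        have e: "\<bar>ctr \<epsilon> x $ i - ctr \<epsilon> y $ i\<bar> = \<epsilon> * of_int \<bar>?k\<bar>"
          using \<epsilon> by (simp add: ctr_def abs_mult right_diff_distrib[symmetric])
        have "\<epsilon> * of_int \<bar>?k\<bar> < \<epsilon> * 2" using False e by (metis mult.commute not_le)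
        then have "\<bar>?k\<bar> \<le> 1" using \<epsilon> by simp
        then have "of_int \<bar>?k\<bar> \<le> (1::real)" by linarith
        then show ?thesis unfolding e using \<epsilon> by (simp add: mult_left_le)
      qed
      define R where "R = 2 * d * \<epsilon>"
      have R: "0 < R" using d1 \<epsilon> by (simp add: R_def)
      have nearl: "l1norm (x' - y') \<le> R" if "ctr \<epsilon> x' = ctr \<epsilon> x" "ctr \<epsilon> y' = ctr \<epsilon> y" for x' y'
      proof -
        have "\<bar>(x' - y') $ j\<bar> \<le> 2 * \<epsilon>" for j
          using ctr_bounds[OF \<epsilon>, of x' j, unfolded that] ctr_bounds[OF \<epsilon>, of y' j, unfolded that] near[of j]
          unfolding vector_minus_component by linarith
        then have "l1norm (x' - y') \<le> real CARD('n) * (2 * \<epsilon>)" by (rule l1norm_le_card)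
        then show ?thesis by (simp add: R_def d_def mult_ac)
      qed
      \<comment> \<open>The second cell is enlarged to the complement of the first; the range
        \<open>R\<close> keeps the integral local.\<close>
      have "?I \<le> (\<integral>\<^sup>+z. indicator (?Q x \<times> (- ?Q x)) z * indicator {z. l1norm (fst z - snd z) \<le> R} z
             * ennreal (wker s (fst z - snd z)) \<partial>lborel)"
        using ne nearl by (intro nn_integral_mono) (auto simp: indicator_def)
      also have "\<dots> \<le> ennreal (\<epsilon> ^ (CARD('n) - 1)) * (\<integral>\<^sup>+(h::real^'n). indicator {h. l1norm h \<le> R} h
           * ennreal (l1norm h powr - (real CARD('n) + s - 1)) \<partial>lborel)"
        using \<epsilon> by (intro wker_perimeter_near emeasure_cell_translation) auto
      also have "\<dots> \<le> ennreal (\<epsilon> ^ (CARD('n) - 1)) * ennreal (C1 * R powr (real CARD('n) - (real CARD('n) + s - 1)))"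
        by (intro mult_left_mono C1 R) simp
      also have "\<dots> = ennreal (\<epsilon> ^ (CARD('n) - 1) * C1 * R powr (1 - s))"
        using \<epsilon> C1(1) by (simp add: ennreal_mult[symmetric] mult_ac)
      also have "\<epsilon> ^ (CARD('n) - 1) * C1 * R powr (1 - s) = C1 * (2 * d) powr (d + 1) * \<epsilon> ^ (2 * CARD('n)) * R powr - q"
      proof -
        have 1: "\<epsilon> ^ (CARD('n) - 1) = \<epsilon> powr (d - 1)" "\<epsilon> ^ (2 * CARD('n)) = \<epsilon> powr (2 * d)"
          using \<epsilon> d1 by (simp_all add: d_def powr_realpow[symmetric] of_nat_diff Suc_le_eq)
        have 2: "R powr t = (2 * d) powr t * \<epsilon> powr t" for t
          unfolding R_def using \<epsilon> d1 by (simp add: powr_mult)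
        have "\<epsilon> powr (d - 1) * \<epsilon> powr (1 - s) = \<epsilon> powr (2 * d) * \<epsilon> powr - q"
          by (simp add: powr_add[symmetric] q_def)
        moreover have "(2 * d) powr (1 - s) = (2 * d) powr (d + 1) * (2 * d) powr - q"
          by (simp add: powr_add[symmetric] q_def)
        ultimately show ?thesis unfolding 1 2 by (simp add: mult_ac)
      qed
      also have "ennreal \<dots> \<le> ennreal (C * \<epsilon> ^ (2 * CARD('n)) * wker s (x - y))"
      proof (intro ennreal_leI mult_mono)
        show "R powr - q \<le> wker s (x - y)"
          unfolding w using lpos nearl[of x y] q0 by (intro powr_mono2') auto
      qed (use \<epsilon> \<open>0 \<le> C\<close> in \<open>auto simp: C_def\<close>)
      finally show ?thesis .
    qed
  qed
  ultimately show thesis by (rule that)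
qed

section \<open>Averages and majority values\<close>

definition avg :: "real \<Rightarrow> (real^'n \<Rightarrow> real) \<Rightarrow> real^'n \<Rightarrow> real" where
  "avg \<epsilon> v x = (\<integral>y. (if ctr \<epsilon> y = ctr \<epsilon> x then v y else 0) \<partial>lborel) / \<epsilon> ^ CARD('n)"

lemma avg_cong: "ctr \<epsilon> x = ctr \<epsilon> y \<Longrightarrow> avg \<epsilon> v x = avg \<epsilon> v y"
  by (simp add: avg_def)

lemma borel_measurable_avg [measurable]:
  fixes v :: "real^'n \<Rightarrow> real"
  assumes [measurable]: "v \<in> borel_measurable borel"
  shows "avg \<epsilon> v \<in> borel_measurable borel"
proof -
  have "(\<lambda>(x, y). if ctr \<epsilon> y = ctr \<epsilon> x then v y else 0) \<in> borel_measurable (borel \<Otimes>\<^sub>M (lborel :: (real^'n) measure))"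
    by measurable
  from lborel.borel_measurable_lebesgue_integral[OF this]
  show ?thesis unfolding avg_def by measurable
qed

lemma integrable_cell:
  fixes f :: "real^'n \<Rightarrow> real"
  assumes [measurable]: "f \<in> borel_measurable borel" and "\<And>y. \<bar>f y\<bar> \<le> B" and \<epsilon>: "0 < \<epsilon>"
  shows "integrable lborel (\<lambda>y. if ctr \<epsilon> y = ctr \<epsilon> x then f y else 0)"
proof (rule Bochner_Integration.integrable_bound)
  show "integrable lborel (\<lambda>y. B * indicator {y. ctr \<epsilon> y = ctr \<epsilon> x} y :: real)"
    by (intro integrable_mult_right integrable_real_indicator) (auto simp: emeasure_cell[OF \<epsilon>])
  show "AE y in lborel. norm (if ctr \<epsilon> y = ctr \<epsilon> x then f y else 0)
      \<le> norm (B * indicator {y. ctr \<epsilon> y = ctr \<epsilon> x} y :: real)"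
    using assms(2) by (intro AE_I2) (auto intro: order_trans[OF _ abs_ge_self])
qed measurable

lemma avg_affine:
  fixes v :: "real^'n \<Rightarrow> real"
  assumes "v \<in> borel_measurable borel" "\<And>y. \<bar>v y\<bar> \<le> B" and \<epsilon>: "0 < \<epsilon>"
  shows "avg \<epsilon> (\<lambda>y. a + c * v y) x = a + c * avg \<epsilon> v x"
proof -
  have i: "integrable lborel (\<lambda>y. c * (if ctr \<epsilon> y = ctr \<epsilon> x then v y else 0))"
    by (intro integrable_mult_right integrable_cell[OF assms])
  have "(\<lambda>y. if ctr \<epsilon> y = ctr \<epsilon> x then a + c * v y else 0)
     = (\<lambda>y. a * indicator {y. ctr \<epsilon> y = ctr \<epsilon> x} y + c * (if ctr \<epsilon> y = ctr \<epsilon> x then v y else 0))"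
    by auto
  then have "(\<integral>y. (if ctr \<epsilon> y = ctr \<epsilon> x then a + c * v y else 0) \<partial>lborel)
     = a * measure lborel {y. ctr \<epsilon> y = ctr \<epsilon> x} + c * (\<integral>y. (if ctr \<epsilon> y = ctr \<epsilon> x then v y else 0) \<partial>lborel)"
    using i by (simp add: emeasure_cell[OF \<epsilon>])
  also have "measure lborel {y. ctr \<epsilon> y = ctr \<epsilon> x} = \<epsilon> ^ CARD('n)"
    using \<epsilon> by (simp add: measure_def emeasure_cell[OF \<epsilon>])
  finally show ?thesis using \<epsilon> by (simp add: avg_def field_simps)
qed

lemma nn_integral_cell:
  fixes f :: "real^'n \<Rightarrow> real"
  assumes "f \<in> borel_measurable borel" "\<And>y. 0 \<le> f y" "\<And>y. f y \<le> B" and \<epsilon>: "0 < \<epsilon>"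
  shows "(\<integral>\<^sup>+y. (if ctr \<epsilon> y = ctr \<epsilon> x then ennreal (f y) else 0) \<partial>lborel) = ennreal (\<epsilon> ^ CARD('n) * avg \<epsilon> f x)"
proof -
  have "(\<integral>\<^sup>+y. (if ctr \<epsilon> y = ctr \<epsilon> x then ennreal (f y) else 0) \<partial>lborel)
    = (\<integral>\<^sup>+y. ennreal (if ctr \<epsilon> y = ctr \<epsilon> x then f y else 0) \<partial>lborel)"
    by (intro nn_integral_cong) auto
  also have "\<dots> = ennreal (\<integral>y. (if ctr \<epsilon> y = ctr \<epsilon> x then f y else 0) \<partial>lborel)"
    using assms by (intro nn_integral_eq_integral integrable_cell[of f B]) auto
  finally show ?thesis using \<epsilon> by (simp add: avg_def)
qed

lemma avg_nonneg: "(\<And>y. 0 \<le> v y) \<Longrightarrow> 0 < \<epsilon> \<Longrightarrow> 0 \<le> avg \<epsilon> v x"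
  unfolding avg_def by (intro divide_nonneg_pos integral_nonneg) auto

lemma abs_avg_le:
  fixes v :: "real^'n \<Rightarrow> real"
  assumes "v \<in> borel_measurable borel" "\<And>y. \<bar>v y\<bar> \<le> B" and \<epsilon>: "0 < \<epsilon>"
  shows "\<bar>avg \<epsilon> v x\<bar> \<le> B"
proof -
  have "0 \<le> B + c * v y" if "c = 1 \<or> c = -1" for c y
    using assms(2)[of y] that by (auto simp: abs_le_iff)
  then have "0 \<le> avg \<epsilon> (\<lambda>y. B + c * v y) x" if "c = 1 \<or> c = -1" for c
    using that \<epsilon> by (intro avg_nonneg) auto
  from this[of 1] this[of "-1"] show ?thesis
    unfolding avg_affine[OF assms] by (simp add: abs_le_iff)
qed

text \<open>Jensen's inequality with \<open>v x\<close> frozen. The right-hand side is a nonnegative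
  integral, so that Tonelli applies to it afterwards.\<close>

lemma avg_diff_le:
  fixes v :: "real^'n \<Rightarrow> real"
  assumes v [measurable]: "v \<in> borel_measurable borel" and b: "\<And>y. \<bar>v y\<bar> \<le> B" and \<epsilon>: "0 < \<epsilon>"
  shows "ennreal \<bar>avg \<epsilon> v x - v x\<bar>
    \<le> ennreal (1 / \<epsilon> ^ CARD('n)) * (\<integral>\<^sup>+y. (if ctr \<epsilon> y = ctr \<epsilon> x then ennreal \<bar>v y - v x\<bar> else 0) \<partial>lborel)"
proof -
  have b': "\<bar>v y - v x\<bar> \<le> 2 * B" for y using b[of y] b[of x] by linarith
  have "avg \<epsilon> v x - v x = avg \<epsilon> (\<lambda>y. - v x + 1 * v y) x" by (subst avg_affine[OF v b \<epsilon>]) simp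
  also have "\<bar>\<dots>\<bar> \<le> avg \<epsilon> (\<lambda>y. \<bar>v y - v x\<bar>) x"
  proof -
    have "\<bar>\<integral>y. (if ctr \<epsilon> y = ctr \<epsilon> x then v y - v x else 0) \<partial>lborel\<bar>
      \<le> (\<integral>y. \<bar>if ctr \<epsilon> y = ctr \<epsilon> x then v y - v x else 0\<bar> \<partial>lborel)"
      by (rule integral_abs_bound)
    also have "\<dots> = (\<integral>y. (if ctr \<epsilon> y = ctr \<epsilon> x then \<bar>v y - v x\<bar> else 0) \<partial>lborel)"
      by (intro Bochner_Integration.integral_cong) auto
    finally show ?thesis using \<epsilon> by (simp add: avg_def abs_divide divide_right_mono)
  qed
  finally have "ennreal \<bar>avg \<epsilon> v x - v x\<bar> \<le> ennreal (avg \<epsilon> (\<lambda>y. \<bar>v y - v x\<bar>) x)" by (rule ennreal_leI)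
  also have "\<dots> = ennreal (1 / \<epsilon> ^ CARD('n)) * ennreal (\<epsilon> ^ CARD('n) * avg \<epsilon> (\<lambda>y. \<bar>v y - v x\<bar>) x)"
    using \<epsilon> avg_nonneg[of "\<lambda>y. \<bar>v y - v x\<bar>" \<epsilon> x] by (simp add: ennreal_mult[symmetric])
  also have "ennreal (\<epsilon> ^ CARD('n) * avg \<epsilon> (\<lambda>y. \<bar>v y - v x\<bar>) x)
    = (\<integral>\<^sup>+y. (if ctr \<epsilon> y = ctr \<epsilon> x then ennreal \<bar>v y - v x\<bar> else 0) \<partial>lborel)"
    using b' \<epsilon> by (intro nn_integral_cell[of _ "2 * B", symmetric]) auto
  finally show ?thesis .
qed

text \<open>The Gagliardo seminorm of order \<open>s\<close> and integrability exponent
  \<open>1\<close>, restricted to pairs in \<open>D\<close>; in use, \<open>D\<close> is everything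
  or a strip around the diagonal.\<close>

definition seminorm_on :: "real \<Rightarrow> (real^'n \<Rightarrow> real) \<Rightarrow> ((real^'n) \<times> (real^'n)) set \<Rightarrow> ennreal" where
  "seminorm_on s v D = (\<integral>\<^sup>+z. indicator D z * ennreal (\<bar>v (fst z) - v (snd z)\<bar> * wker s (fst z - snd z)) \<partial>lborel)"

text \<open>A fractional Poincare inequality: two points of one cell are at most
  \<open>d * \<epsilon>\<close> apart, so the weight \<open>1 / \<epsilon> ^ d\<close> of the
  average is at most \<open>d powr (d + s) * \<epsilon> powr s\<close> times the kernel
  there.\<close>

lemma avg_L1_error:
  fixes v :: "real^'n \<Rightarrow> real"
  assumes v [measurable]: "v \<in> borel_measurable borel" and b: "\<And>y. \<bar>v y\<bar> \<le> B" and \<epsilon>: "0 < \<epsilon>" and s: "0 < s"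
  shows "(\<integral>\<^sup>+x. ennreal \<bar>avg \<epsilon> v x - v x\<bar> \<partial>lborel)
    \<le> ennreal (real CARD('n) powr (real CARD('n) + s) * \<epsilon> powr s) * seminorm_on s v UNIV"
proof -
  define d where "d = real CARD('n)"
  have d: "1 \<le> d" unfolding d_def by (rule real_card_ge_1)
  let ?c = "ennreal (1 / \<epsilon> ^ CARD('n))" and ?k = "ennreal (d powr (d + s) * \<epsilon> powr s)"
  let ?f = "\<lambda>x y. if ctr \<epsilon> y = ctr \<epsilon> x then ennreal \<bar>v y - v x\<bar> else 0"
  have fm: "(\<lambda>z. ?f (fst z) (snd z)) \<in> borel_measurable (borel \<Otimes>\<^sub>M borel)" by measurable
  have "(\<integral>\<^sup>+x. ennreal \<bar>avg \<epsilon> v x - v x\<bar> \<partial>lborel) \<le> (\<integral>\<^sup>+x. ?c * (\<integral>\<^sup>+y. ?f x y \<partial>lborel) \<partial>lborel)"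
    by (intro nn_integral_mono avg_diff_le[OF v b \<epsilon>])
  also have "\<dots> = ?c * (\<integral>\<^sup>+x. \<integral>\<^sup>+y. ?f x y \<partial>lborel \<partial>lborel)"
    by (rule nn_integral_cmult) measurable
  also have "(\<integral>\<^sup>+x. \<integral>\<^sup>+y. ?f x y \<partial>lborel \<partial>lborel) = (\<integral>\<^sup>+z. ?f (fst z) (snd z) \<partial>lborel)"
    using fm by (subst nn_integral_lborel_pair) (simp_all add: borel_prod cong: if_cong)
  also have "?c * \<dots> = (\<integral>\<^sup>+z. ?c * ?f (fst z) (snd z) \<partial>lborel)"
    using fm by (intro nn_integral_cmult[symmetric]) (simp add: borel_prod)
  also have "\<dots> \<le> (\<integral>\<^sup>+z. ?k * (indicator UNIV z * ennreal (\<bar>v (fst z) - v (snd z)\<bar> * wker s (fst z - snd z))) \<partial>lborel)"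
  proof (rule nn_integral_mono)
    fix z :: "(real^'n) \<times> (real^'n)"
    show "?c * ?f (fst z) (snd z) \<le> ?k * (indicator UNIV z * ennreal (\<bar>v (fst z) - v (snd z)\<bar> * wker s (fst z - snd z)))"
    \<comment> \<open>Diagonal points are split off because \<open>wker\<close> is \<open>0\<close>
      there; the jump vanishes as well.\<close>
    proof (cases "ctr \<epsilon> (snd z) = ctr \<epsilon> (fst z) \<and> fst z \<noteq> snd z")
      case True
      then have "l1norm (fst z - snd z) \<le> d * \<epsilon>" using same_cell_l1norm[OF \<epsilon>, of "fst z" "snd z"] by (simp add: d_def)
      moreover have "0 < l1norm (fst z - snd z)"
        using True l1norm_nonneg[of "fst z - snd z"] by (simp add: less_le del: l1norm_nonneg)
      ultimately have "(d * \<epsilon>) powr - (d + s) \<le> wker s (fst z - snd z)"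
        unfolding wker_def d_def using s by (intro powr_mono2') auto
      then have "d powr (d + s) * \<epsilon> powr s * (d * \<epsilon>) powr - (d + s) \<le> d powr (d + s) * \<epsilon> powr s * wker s (fst z - snd z)"
        by (intro mult_left_mono) auto
      moreover have "d powr (d + s) * \<epsilon> powr s * (d * \<epsilon>) powr - (d + s) = 1 / \<epsilon> ^ CARD('n)"
      proof -
        have "d powr (d + s) * \<epsilon> powr s * (d * \<epsilon>) powr - (d + s)
            = (d powr (d + s) * d powr - (d + s)) * (\<epsilon> powr s * \<epsilon> powr - (d + s))"
          using d \<epsilon> by (simp add: powr_mult)
        also have "d powr (d + s) * d powr - (d + s) = 1" using d by (subst powr_add[symmetric]) simp
        also have "\<epsilon> powr s * \<epsilon> powr - (d + s) = \<epsilon> powr - d" by (simp add: powr_add[symmetric])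
        also have "\<epsilon> powr - d = 1 / \<epsilon> ^ CARD('n)" using \<epsilon> by (simp add: powr_minus d_def powr_realpow field_simps)
        finally show ?thesis by simp
      qed
      ultimately have "1 / \<epsilon> ^ CARD('n) * \<bar>v (snd z) - v (fst z)\<bar>
        \<le> d powr (d + s) * \<epsilon> powr s * wker s (fst z - snd z) * \<bar>v (snd z) - v (fst z)\<bar>"
        by (intro mult_right_mono) auto
      then show ?thesis using True \<epsilon>
        by (simp add: ennreal_mult[symmetric] abs_minus_commute mult_ac ennreal_leI)
    qed auto
  qed
  also have "\<dots> = ?k * seminorm_on s v UNIV"
    unfolding seminorm_on_def by (intro nn_integral_cmult) (simp, unfold borel_prod[symmetric], measurable)
  finally show ?thesis unfolding d_def .
qed

text \<open>The majority value of the cell when \<open>v\<close> takes the values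
  \<open>\<plusminus>1\<close>; ties go to \<open>-1\<close>.\<close>

definition rnd :: "real \<Rightarrow> (real^'n \<Rightarrow> real) \<Rightarrow> real^'n \<Rightarrow> real" where
  "rnd \<epsilon> v x = (if 0 < avg \<epsilon> v x then 1 else -1)"

lemma rnd_cong: "ctr \<epsilon> x = ctr \<epsilon> y \<Longrightarrow> rnd \<epsilon> v x = rnd \<epsilon> v y"
  by (simp add: rnd_def avg_cong[of \<epsilon> x y])

lemma borel_measurable_rnd [measurable]:
  "v \<in> borel_measurable borel \<Longrightarrow> rnd \<epsilon> v \<in> borel_measurable borel"
  unfolding rnd_def by measurable

lemma rnd_values: "rnd \<epsilon> v x = 1 \<or> rnd \<epsilon> v x = -1"
  by (simp add: rnd_def)

text \<open>For values in \<open>{1, -1}\<close> one has \<open>\<bar>a - b\<bar> = 1 - a * b\<close>, so the mean oscillation between two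
  cells is \<open>1\<close> minus the product of the two averages, which is at least \<open>1\<close> if the averages
  have different signs.\<close>
lemma rnd_diff_le:
  fixes v :: "real^'n \<Rightarrow> real"
  assumes v [measurable]: "v \<in> borel_measurable borel" and pm: "\<And>y. v y = 1 \<or> v y = -1" and \<epsilon>: "0 < \<epsilon>"
  shows "ennreal \<bar>rnd \<epsilon> v x - rnd \<epsilon> v y\<bar> \<le> ennreal (2 / \<epsilon> ^ (2 * CARD('n))) *
     (\<integral>\<^sup>+z. (if ctr \<epsilon> (fst z) = ctr \<epsilon> x \<and> ctr \<epsilon> (snd z) = ctr \<epsilon> y
           then ennreal \<bar>v (fst z) - v (snd z)\<bar> else 0) \<partial>lborel)"
proof -
  let ?N = "\<epsilon> ^ CARD('n)"
  have b: "\<bar>v y\<bar> \<le> 1" for y using pm[of y] by auto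
  have a1: "\<bar>avg \<epsilon> v y\<bar> \<le> 1" for y by (rule abs_avg_le[OF v b \<epsilon>])
  let ?g = "\<lambda>z. if ctr \<epsilon> (fst z) = ctr \<epsilon> x \<and> ctr \<epsilon> (snd z) = ctr \<epsilon> y
           then ennreal \<bar>v (fst z) - v (snd z)\<bar> else 0"
  have gm: "?g \<in> borel_measurable (borel \<Otimes>\<^sub>M borel)" by measurable
  have ge: "0 \<le> 1 - c * t" "1 - c * t \<le> 2" if "\<bar>c\<bar> \<le> 1" "\<bar>t\<bar> \<le> 1" for c t :: real
  proof -
    have "\<bar>c * t\<bar> \<le> 1" using that by (simp add: abs_mult mult_le_one)
    then show "0 \<le> 1 - c * t" "1 - c * t \<le> 2" by (simp_all add: abs_le_iff)
  qed
  have "(\<integral>\<^sup>+z. ?g z \<partial>lborel) = (\<integral>\<^sup>+a. \<integral>\<^sup>+b. ?g (a, b) \<partial>lborel \<partial>lborel)"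
    using gm by (intro nn_integral_lborel_pair) (simp add: borel_prod)
  also have "\<dots> = (\<integral>\<^sup>+a. (if ctr \<epsilon> a = ctr \<epsilon> x then ennreal (?N * (1 - avg \<epsilon> v y * v a)) else 0) \<partial>lborel)"
  proof (intro nn_integral_cong)
    fix a
    have "(\<integral>\<^sup>+b. (if ctr \<epsilon> b = ctr \<epsilon> y then ennreal \<bar>v a - v b\<bar> else 0) \<partial>lborel)
      = (\<integral>\<^sup>+b. (if ctr \<epsilon> b = ctr \<epsilon> y then ennreal (1 + (- v a) * v b) else 0) \<partial>lborel)"
    proof (intro nn_integral_cong)
      fix b show "(if ctr \<epsilon> b = ctr \<epsilon> y then ennreal \<bar>v a - v b\<bar> else 0)
        = (if ctr \<epsilon> b = ctr \<epsilon> y then ennreal (1 + (- v a) * v b) else 0)"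
        using pm[of a] pm[of b] by auto
    qed
    also have "\<dots> = ennreal (?N * avg \<epsilon> (\<lambda>b. 1 + (- v a) * v b) y)"
      using ge[OF b b] \<epsilon> by (intro nn_integral_cell[of _ 2]) auto
    also have "avg \<epsilon> (\<lambda>b. 1 + (- v a) * v b) y = 1 - avg \<epsilon> v y * v a"
      by (subst avg_affine[OF v b \<epsilon>]) simp
    finally show "(\<integral>\<^sup>+b. ?g (a, b) \<partial>lborel)
      = (if ctr \<epsilon> a = ctr \<epsilon> x then ennreal (?N * (1 - avg \<epsilon> v y * v a)) else 0)" by (simp cong: if_cong)
  qed
  also have "\<dots> = ennreal (?N * avg \<epsilon> (\<lambda>a. ?N * (1 - avg \<epsilon> v y * v a)) x)"
    using ge[OF a1 b] \<epsilon> by (intro nn_integral_cell[of _ "?N * 2"]) (auto intro: mult_left_mono)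
  also have "avg \<epsilon> (\<lambda>a. ?N * (1 - avg \<epsilon> v y * v a)) x = ?N * (1 - avg \<epsilon> v y * avg \<epsilon> v x)"
    using avg_affine[OF v b \<epsilon>, of ?N "- ?N * avg \<epsilon> v y" x] by (simp add: algebra_simps)
  finally have e: "(\<integral>\<^sup>+z. ?g z \<partial>lborel) = ennreal (?N * (?N * (1 - avg \<epsilon> v y * avg \<epsilon> v x)))" .
  have "\<bar>rnd \<epsilon> v x - rnd \<epsilon> v y\<bar> \<le> 2 * (1 - avg \<epsilon> v y * avg \<epsilon> v x)"
    using ge(1)[OF a1 a1, of y x]
    by (auto simp: rnd_def not_less mult_nonneg_nonpos mult_nonpos_nonneg)
  then have "ennreal \<bar>rnd \<epsilon> v x - rnd \<epsilon> v y\<bar> \<le> ennreal (2 * (1 - avg \<epsilon> v y * avg \<epsilon> v x))"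
    by (rule ennreal_leI)
  also have "\<dots> = ennreal (2 / \<epsilon> ^ (2 * CARD('n))) * ennreal (?N * (?N * (1 - avg \<epsilon> v y * avg \<epsilon> v x)))"
  proof -
    have N2: "\<epsilon> ^ (2 * CARD('n)) = ?N * ?N" by (simp only: mult_2 power_add)
    have "2 * t = 2 / (?N * ?N) * (?N * (?N * t))" for t using \<epsilon> by simp
    then have "ennreal (2 * t) = ennreal (2 / (?N * ?N)) * ennreal (?N * (?N * t))" if "0 \<le> t" for t
      using \<epsilon> that by (subst ennreal_mult[symmetric]) auto
    from this[OF ge(1)[OF a1 a1]] show ?thesis unfolding N2 .
  qed
  finally show ?thesis unfolding e .
qed

lemma borel_measurable_nn_integral_lborel:
  fixes f :: "'a::euclidean_space \<Rightarrow> 'b::euclidean_space \<Rightarrow> ennreal"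
  assumes "(\<lambda>z. f (fst z) (snd z)) \<in> borel_measurable borel"
  shows "(\<lambda>x. \<integral>\<^sup>+y. f x y \<partial>lborel) \<in> borel_measurable borel"
proof (rule lborel.borel_measurable_nn_integral)
  have "sets (borel \<Otimes>\<^sub>M (lborel :: 'b measure)) = sets (borel :: ('a \<times> 'b) measure)"
    unfolding borel_prod[symmetric] by (intro sets_pair_measure_cong) simp_all
  from measurable_cong_sets[OF this refl]
  show "(\<lambda>(x, y). f x y) \<in> borel_measurable (borel \<Otimes>\<^sub>M lborel)"
    unfolding split_beta' using assms by blast
qed

text \<open>The jump of \<open>rnd\<close> at \<open>z\<close> is bounded by twice the mean jump of
  \<open>v\<close> over the pair of cells of \<open>z\<close>. Lying in the same pair of cells is a
  symmetric relation, so after exchanging the integrals the kernel is integrated over the pair of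
  cells of \<open>y\<close>, and \<open>different_cells_integral_le\<close> returns its value at
  \<open>y\<close>; the powers of \<open>\<epsilon>\<close> cancel. Each endpoint moves by at most
  \<open>d * \<epsilon>\<close>, which widens the strip by
  \<open>2 * d * \<epsilon>\<close>.\<close>

lemma rnd_seminorm_near:
  assumes s: "0 < s" "s < 1"
  obtains C where "0 \<le> C"
    "\<And>\<epsilon> \<delta> (v::real^'n \<Rightarrow> real). v \<in> borel_measurable borel \<Longrightarrow> (\<And>y. v y = 1 \<or> v y = -1) \<Longrightarrow> 0 < \<epsilon> \<Longrightarrow>
      seminorm_on s (rnd \<epsilon> v) {z. l1norm (fst z - snd z) < \<delta>}
      \<le> ennreal C * seminorm_on s v {z. l1norm (fst z - snd z) < \<delta> + 2 * real CARD('n) * \<epsilon>}"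
proof -
  obtain C where C: "0 \<le> C" "\<And>\<epsilon> (x::real^'n) y. 0 < \<epsilon> \<Longrightarrow> ctr \<epsilon> x \<noteq> ctr \<epsilon> y \<Longrightarrow>
      (\<integral>\<^sup>+z. indicator {z. ctr \<epsilon> (fst z) = ctr \<epsilon> x \<and> ctr \<epsilon> (snd z) = ctr \<epsilon> y} z
          * ennreal (wker s (fst z - snd z)) \<partial>lborel)
        \<le> ennreal (C * \<epsilon> ^ (2 * CARD('n)) * wker s (x - y))"
    by (rule different_cells_integral_le[OF s]) blast
  have "seminorm_on s (rnd \<epsilon> v) {z. l1norm (fst z - snd z) < \<delta>}
      \<le> ennreal (2 * C) * seminorm_on s v {z. l1norm (fst z - snd z) < \<delta> + 2 * real CARD('n) * \<epsilon>}"
    if v [measurable]: "v \<in> borel_measurable borel" and pm: "\<And>y. v y = 1 \<or> v y = -1" and \<epsilon>: "0 < \<epsilon>"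
    for \<epsilon> \<delta> and v :: "real^'n \<Rightarrow> real"
  proof -
    let ?m = "ennreal (2 / \<epsilon> ^ (2 * CARD('n)))"
    define S :: "((real^'n) \<times> (real^'n)) \<Rightarrow> ((real^'n) \<times> (real^'n)) \<Rightarrow> bool"
      where "S z y \<longleftrightarrow> ctr \<epsilon> (fst y) = ctr \<epsilon> (fst z) \<and> ctr \<epsilon> (snd y) = ctr \<epsilon> (snd z)" for z y
    \<comment> \<open>Pairs within one cell are dropped: \<open>rnd\<close> has no jump there, and
      the kernel estimate needs different cells.\<close>
    define A where "A z = (if l1norm (fst z - snd z) < \<delta> \<and> ctr \<epsilon> (fst z) \<noteq> ctr \<epsilon> (snd z)
        then ennreal (wker s (fst z - snd z)) else 0)" for z :: "(real^'n) \<times> (real^'n)"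
    define h where "h y = ennreal \<bar>v (fst y) - v (snd y)\<bar>" for y :: "(real^'n) \<times> (real^'n)"
    have Am [measurable]: "A \<in> borel_measurable (borel \<Otimes>\<^sub>M borel)" unfolding A_def by measurable
    have hm [measurable]: "h \<in> borel_measurable (borel \<Otimes>\<^sub>M borel)" unfolding h_def by measurable
    have Fm: "(\<lambda>p. A (fst p) * (if S (fst p) (snd p) then h (snd p) else 0))
        \<in> borel_measurable ((borel \<Otimes>\<^sub>M borel) \<Otimes>\<^sub>M (borel \<Otimes>\<^sub>M borel))"
      unfolding S_def by measurable
    have "seminorm_on s (rnd \<epsilon> v) {z. l1norm (fst z - snd z) < \<delta>}
      \<le> (\<integral>\<^sup>+z. ?m * (\<integral>\<^sup>+y. A z * (if S z y then h y else 0) \<partial>lborel) \<partial>lborel)"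
      unfolding seminorm_on_def
    proof (rule nn_integral_mono)
      fix z :: "(real^'n) \<times> (real^'n)"
      have e: "(\<integral>\<^sup>+y. A z * (if S z y then h y else 0) \<partial>lborel) = A z * (\<integral>\<^sup>+y. (if S z y then h y else 0) \<partial>lborel)"
        by (intro nn_integral_cmult) (simp add: borel_prod[symmetric] S_def)
      show "indicator {z. l1norm (fst z - snd z) < \<delta>} z
           * ennreal (\<bar>rnd \<epsilon> v (fst z) - rnd \<epsilon> v (snd z)\<bar> * wker s (fst z - snd z))
        \<le> ?m * (\<integral>\<^sup>+y. A z * (if S z y then h y else 0) \<partial>lborel)"
      proof (cases "l1norm (fst z - snd z) < \<delta> \<and> ctr \<epsilon> (fst z) \<noteq> ctr \<epsilon> (snd z)")
        case True
        have "ennreal \<bar>rnd \<epsilon> v (fst z) - rnd \<epsilon> v (snd z)\<bar> * ennreal (wker s (fst z - snd z))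
          \<le> (?m * (\<integral>\<^sup>+y. (if S z y then h y else 0) \<partial>lborel)) * ennreal (wker s (fst z - snd z))"
          unfolding S_def h_def by (intro mult_right_mono rnd_diff_le[OF v pm \<epsilon>]) simp
        then show ?thesis unfolding e using True by (simp add: A_def ennreal_mult mult_ac)
      next
        case False
        then have "indicator {z. l1norm (fst z - snd z) < \<delta>} z
           * ennreal (\<bar>rnd \<epsilon> v (fst z) - rnd \<epsilon> v (snd z)\<bar> * wker s (fst z - snd z)) = 0"
          using rnd_cong[of \<epsilon> "fst z" "snd z" v] by (auto simp: indicator_def)
        then show ?thesis by (simp only: zero_le)
      qed
    qed
    also have "\<dots> = ?m * (\<integral>\<^sup>+z. \<integral>\<^sup>+y. A z * (if S z y then h y else 0) \<partial>lborel \<partial>lborel)"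
      by (intro nn_integral_cmult) (use Fm in \<open>simp add: borel_prod borel_measurable_nn_integral_lborel\<close>)
    also have "(\<integral>\<^sup>+z. \<integral>\<^sup>+y. A z * (if S z y then h y else 0) \<partial>lborel \<partial>lborel)
       = (\<integral>\<^sup>+y. \<integral>\<^sup>+z. A z * (if S z y then h y else 0) \<partial>lborel \<partial>lborel)"
      by (rule nn_integral_lborel_swap) (use Fm in \<open>simp add: borel_prod\<close>)
    also have "\<dots> \<le> (\<integral>\<^sup>+y. ennreal (C * \<epsilon> ^ (2 * CARD('n))) *
       (indicator {z. l1norm (fst z - snd z) < \<delta> + 2 * real CARD('n) * \<epsilon>} y
         * ennreal (\<bar>v (fst y) - v (snd y)\<bar> * wker s (fst y - snd y))) \<partial>lborel)"
    proof (rule nn_integral_mono)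
      fix y :: "(real^'n) \<times> (real^'n)"
      let ?D = "{z. l1norm (fst z - snd z) < \<delta> + 2 * real CARD('n) * \<epsilon>}"
      have "(\<integral>\<^sup>+z. A z * (if S z y then h y else 0) \<partial>lborel) = (\<integral>\<^sup>+z. (if S z y then A z else 0) * h y \<partial>lborel)"
        by (intro nn_integral_cong) auto
      also have "\<dots> = (\<integral>\<^sup>+z. (if S z y then A z else 0) \<partial>lborel) * h y"
        by (intro nn_integral_multc) (simp add: borel_prod[symmetric] S_def)
      also have "(\<integral>\<^sup>+z. (if S z y then A z else 0) \<partial>lborel)
         \<le> indicator ?D y * ennreal (C * \<epsilon> ^ (2 * CARD('n)) * wker s (fst y - snd y))"
      proof (cases "ctr \<epsilon> (fst y) \<noteq> ctr \<epsilon> (snd y) \<and> y \<in> ?D")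
        case True
        have "(\<integral>\<^sup>+z. (if S z y then A z else 0) \<partial>lborel)
          \<le> (\<integral>\<^sup>+z. indicator {z. ctr \<epsilon> (fst z) = ctr \<epsilon> (fst y) \<and> ctr \<epsilon> (snd z) = ctr \<epsilon> (snd y)} z
            * ennreal (wker s (fst z - snd z)) \<partial>lborel)"
          by (intro nn_integral_mono) (auto simp: S_def A_def indicator_def)
        also have "\<dots> \<le> ennreal (C * \<epsilon> ^ (2 * CARD('n)) * wker s (fst y - snd y))"
          using True by (intro C(2) \<epsilon>) simp
        finally show ?thesis using True by simp
      next
        case False
        \<comment> \<open>Either both points of \<open>y\<close> share a cell, or \<open>y\<close>
          is too far from the diagonal for any \<open>z\<close> in its pair of cells to lie in the
          strip.\<close>
        have "(if S z y then A z else 0) = 0" for z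
        proof (rule ccontr)
          assume "\<not> ?thesis"
          then have z: "S z y" "l1norm (fst z - snd z) < \<delta>" "ctr \<epsilon> (fst z) \<noteq> ctr \<epsilon> (snd z)"
            by (auto simp: A_def split: if_splits)
          then have "y \<notin> ?D" using False by (auto simp: S_def)
          moreover have "l1norm (fst y - fst z) \<le> real CARD('n) * \<epsilon>" "l1norm (snd z - snd y) \<le> real CARD('n) * \<epsilon>"
            using z(1) unfolding S_def by (auto intro!: same_cell_l1norm[OF \<epsilon>])
          moreover have "l1norm (fst y - snd y) \<le> l1norm (fst y - fst z) + l1norm (fst z - snd z) + l1norm (snd z - snd y)"
            using l1norm_triangle[of "fst y - fst z" "fst z - snd z"]
              l1norm_triangle[of "fst y - snd z" "snd z - snd y"] by simp
          ultimately show False using z(2) by simp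
        qed
        then show ?thesis by simp
      qed
      finally have "(\<integral>\<^sup>+z. A z * (if S z y then h y else 0) \<partial>lborel)
        \<le> indicator ?D y * ennreal (C * \<epsilon> ^ (2 * CARD('n)) * wker s (fst y - snd y)) * h y"
        by (simp add: mult_right_mono)
      then show "(\<integral>\<^sup>+z. A z * (if S z y then h y else 0) \<partial>lborel) \<le> ennreal (C * \<epsilon> ^ (2 * CARD('n))) *
       (indicator ?D y * ennreal (\<bar>v (fst y) - v (snd y)\<bar> * wker s (fst y - snd y)))"
        using C(1) \<epsilon> by (simp add: h_def ennreal_mult mult_ac)
    qed
    also have "\<dots> = ennreal (C * \<epsilon> ^ (2 * CARD('n)))
         * seminorm_on s v {z. l1norm (fst z - snd z) < \<delta> + 2 * real CARD('n) * \<epsilon>}"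
      unfolding seminorm_on_def by (intro nn_integral_cmult) (simp, unfold borel_prod[symmetric], measurable)
    finally have "seminorm_on s (rnd \<epsilon> v) {z. l1norm (fst z - snd z) < \<delta>}
      \<le> ?m * (ennreal (C * \<epsilon> ^ (2 * CARD('n)))
         * seminorm_on s v {z. l1norm (fst z - snd z) < \<delta> + 2 * real CARD('n) * \<epsilon>})"
      by (simp add: mult_left_mono)
    also have "\<dots> = ennreal (2 * C) * seminorm_on s v {z. l1norm (fst z - snd z) < \<delta> + 2 * real CARD('n) * \<epsilon>}"
      using C(1) \<epsilon> by (simp add: mult.assoc[symmetric] ennreal_mult[symmetric])
    finally show ?thesis .
  qed
  then show thesis using that[of "2 * C"] C(1) by simp
qed

section \<open>Convergence of averages\<close>

lemma tendsto_zero_ennrealI: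
  fixes f :: "'a \<Rightarrow> ennreal"
  assumes "\<And>\<eta>::real. 0 < \<eta> \<Longrightarrow> eventually (\<lambda>n. f n \<le> ennreal \<eta>) F"
  shows "(f \<longlongrightarrow> 0) F"
proof (rule order_tendstoI)
  fix a :: ennreal assume "0 < a"
  then obtain b where b: "0 < b" "b < a" using dense by blast
  then obtain r where r: "b = ennreal r" "0 \<le> r" by (cases b) auto
  with b have "0 < r" by (simp add: ennreal_less_zero_iff)
  from assms[OF this] show "eventually (\<lambda>n. f n < a) F"
    by eventually_elim (use b r in \<open>auto intro: le_less_trans\<close>)
qed simp

lemma tendsto_zero_ennrealD:
  fixes f :: "'a \<Rightarrow> ennreal"
  assumes "(f \<longlongrightarrow> 0) F" "0 < \<eta>"
  shows "eventually (\<lambda>n. f n \<le> ennreal \<eta>) F"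
  using order_tendstoD(2)[OF assms(1), of "ennreal \<eta>"] assms(2)
  by (auto elim: eventually_mono simp: less_imp_le)

lemma cball_in_borel [measurable]: "cball a r \<in> sets (borel :: 'a::metric_space measure)"
  by simp

text \<open>Measurable functions are almost everywhere limits of continuous ones. Truncation to
  \<open>[-1, 1]\<close> preserves the limit, since \<open>u\<close> has its values there, and
  supplies the bound for dominated convergence on \<open>B\<close>.\<close>

lemma continuous_L1_approximation:
  fixes u :: "real^'n \<Rightarrow> real"
  assumes u [measurable]: "u \<in> borel_measurable borel" and b: "\<And>x. \<bar>u x\<bar> \<le> 1"
    and B: "bounded B" and Bm [measurable]: "B \<in> sets borel" and \<eta>: "0 < \<eta>"
  obtains g where "continuous_on UNIV g" "\<And>x. \<bar>g x\<bar> \<le> (1::real)"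
    "(\<integral>\<^sup>+x. indicator B x * ennreal \<bar>u x - g x\<bar> \<partial>lborel) \<le> ennreal \<eta>"
proof -
  have "u \<in> borel_measurable lebesgue" by (rule measurable_completion) simp
  then have "u measurable_on UNIV" by (simp add: lebesgue_measurable_imp_measurable_on)
  then obtain N g where N: "negligible N" and g: "\<And>n. continuous_on UNIV (g n)"
    and lim: "\<And>x. x \<notin> N \<Longrightarrow> (\<lambda>n. g n x) \<longlonglongrightarrow> u x"
    unfolding measurable_on_def by auto
  define h where "h n x = max (-1) (min 1 (g n x))" for n x
  have hc: "continuous_on UNIV (h n)" for n
    unfolding h_def by (intro continuous_intros g)
  then have hm [measurable]: "h n \<in> borel_measurable borel" for n by (rule borel_measurable_continuous_onI)
  have hb: "\<bar>h n x\<bar> \<le> 1" for n x by (auto simp: h_def)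
  have hl: "(\<lambda>n. h n x) \<longlonglongrightarrow> u x" if "x \<notin> N" for x
  proof -
    have "(\<lambda>n. h n x) \<longlonglongrightarrow> max (-1) (min 1 (u x))"
      unfolding h_def by (intro tendsto_intros lim that)
    moreover have "max (-1) (min 1 (u x)) = u x" using b[of x] by (auto simp: abs_le_iff)
    ultimately show ?thesis by simp
  qed
  have "AE x in lebesgue. x \<notin> N" using N by (simp add: AE_not_in negligible_iff_null_sets)
  then have ae: "AE x in lborel. x \<notin> N" by (simp add: AE_completion_iff)
  have "(\<lambda>n. \<integral>\<^sup>+x. norm (indicator B x * u x - indicator B x * h n x) \<partial>lborel) \<longlonglongrightarrow> 0"
  proof (rule nn_integral_dominated_convergence_norm[where w = "indicator B"])
    show "AE x in lborel. norm (indicator B x * h j x) \<le> indicator B x" for j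
      using hb by (auto simp: indicator_def)
    have "(\<integral>\<^sup>+x. ennreal (indicator B x) \<partial>lborel) = emeasure lborel B"
      by (simp add: ennreal_indicator)
    also have "\<dots> < \<infinity>" using B by (rule emeasure_bounded_finite)
    finally show "(\<integral>\<^sup>+x. ennreal (indicator B x) \<partial>lborel) < \<infinity>" .
    show "AE x in lborel. (\<lambda>i. indicator B x * h i x) \<longlonglongrightarrow> indicator B x * u x"
      using ae by eventually_elim (intro tendsto_intros hl)
  qed measurable
  from tendsto_zero_ennrealD[OF this \<eta>] obtain n
    where "(\<integral>\<^sup>+x. norm (indicator B x * u x - indicator B x * h n x) \<partial>lborel) \<le> ennreal \<eta>"
    by (auto simp: eventually_sequentially)
  also have "(\<integral>\<^sup>+x. norm (indicator B x * u x - indicator B x * h n x) \<partial>lborel)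
     = (\<integral>\<^sup>+x. indicator B x * ennreal \<bar>u x - h n x\<bar> \<partial>lborel)"
    by (intro nn_integral_cong) (auto simp: indicator_def)
  finally show thesis using that[of "h n"] hc hb by blast
qed

text \<open>No seminorm is assumed, so there is no rate; a continuous \<open>g\<close> close to
  \<open>u\<close> is used instead. The jump \<open>\<bar>u y - u x\<bar>\<close> splits into the
  errors of \<open>g\<close> at \<open>y\<close> and at \<open>x\<close> and the oscillation of
  \<open>g\<close> in one cell. Averaging the error at \<open>y\<close> and integrating over
  \<open>x\<close> gives back the total error, by Fubini and because all cells have equal
  measure.\<close>

lemma avg_L1loc_tendsto:
  fixes u :: "real^'n \<Rightarrow> real"
  assumes u [measurable]: "u \<in> borel_measurable borel" and b: "\<And>x. \<bar>u x\<bar> \<le> 1"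
    and e: "\<And>n. 0 < e n" "e \<longlonglongrightarrow> 0"
  shows "(\<lambda>n. \<integral>\<^sup>+x. indicator (cball 0 \<rho>) x * ennreal \<bar>avg (e n) u x - u x\<bar> \<partial>lborel) \<longlonglongrightarrow> 0"
proof (rule tendsto_zero_ennrealI)
  fix \<eta>' :: real assume \<eta>': "0 < \<eta>'"
  define d where "d = real CARD('n)"
  have d1: "1 \<le> d" unfolding d_def by (rule real_card_ge_1)
  \<comment> \<open>Cells of side at most \<open>1\<close> that meet the ball of radius
    \<open>\<rho>\<close> lie in the ball of radius \<open>\<rho> + d\<close>.\<close>
  let ?B = "cball 0 \<rho> :: (real^'n) set" and ?B' = "cball 0 (\<rho> + d) :: (real^'n) set"
  define m where "m = measure lborel ?B"
  have m: "emeasure lborel ?B = ennreal m" "0 \<le> m"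
    using emeasure_lborel_cball_finite[of "0::real^'n" \<rho>] by (simp_all add: m_def emeasure_eq_ennreal_measure)
  \<comment> \<open>Budget: two approximation errors \<open>\<eta>\<close>, and the oscillation
    \<open>\<eta>\<close> over a ball of measure \<open>m\<close>.\<close>
  define \<eta> where "\<eta> = \<eta>' / (2 + m)"
  have \<eta>: "0 < \<eta>" "(2 + m) * \<eta> = \<eta>'" using \<eta>' m by (simp_all add: \<eta>_def add_pos_nonneg)
  obtain g where g: "continuous_on UNIV g" "\<And>x. \<bar>g x\<bar> \<le> (1::real)"
    and gu: "(\<integral>\<^sup>+x. indicator ?B' x * ennreal \<bar>u x - g x\<bar> \<partial>lborel) \<le> ennreal \<eta>"
    by (rule continuous_L1_approximation[OF u b _ _ \<eta>(1), of ?B']) auto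
  have gm [measurable]: "g \<in> borel_measurable borel" using g(1) by (rule borel_measurable_continuous_onI)
  have "uniformly_continuous_on ?B' g"
    using g(1) by (intro compact_uniformly_continuous) (auto intro: continuous_on_subset)
  then obtain \<delta> where \<delta>: "0 < \<delta>" "\<And>x y. x \<in> ?B' \<Longrightarrow> y \<in> ?B' \<Longrightarrow> dist x y < \<delta> \<Longrightarrow> dist (g x) (g y) < \<eta>"
    using \<eta>(1) unfolding uniformly_continuous_on_def by metis
  \<comment> \<open>\<open>\<phi>\<close> carries the error at the averaged point \<open>y\<close>,
    \<open>\<psi>\<close> everything that depends on \<open>x\<close> alone.\<close>
  define \<phi> where "\<phi> x = indicator ?B' x * ennreal \<bar>u x - g x\<bar>" for x
  define \<psi> where "\<psi> x = indicator ?B x * (ennreal \<eta> + \<phi> x)" for x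
  have \<phi>m [measurable]: "\<phi> \<in> borel_measurable borel" unfolding \<phi>_def by measurable
  have \<psi>m [measurable]: "\<psi> \<in> borel_measurable borel" unfolding \<psi>_def by measurable
  have main: "(\<integral>\<^sup>+x. indicator ?B x * ennreal \<bar>avg \<epsilon> u x - u x\<bar> \<partial>lborel) \<le> ennreal \<eta>'"
    if \<epsilon>: "0 < \<epsilon>" "\<epsilon> \<le> 1" "d * \<epsilon> < \<delta>" for \<epsilon>
  proof -
    let ?N = "\<epsilon> ^ CARD('n)"
    have cancel: "ennreal (1 / ?N) * ennreal ?N = 1"
      using \<epsilon>(1) by (simp add: ennreal_mult[symmetric])
    let ?F = "\<lambda>x y. if ctr \<epsilon> y = ctr \<epsilon> x then \<phi> y else 0"
    let ?G = "\<lambda>x y. if ctr \<epsilon> y = ctr \<epsilon> x then \<psi> x else 0"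
    have Fm: "(\<lambda>z. ?F (fst z) (snd z)) \<in> borel_measurable borel" unfolding borel_prod[symmetric] by measurable
    have Gm: "(\<lambda>z. ?G (fst z) (snd z)) \<in> borel_measurable borel" unfolding borel_prod[symmetric] by measurable
    have cm: "(\<integral>\<^sup>+y. (if ctr \<epsilon> y = ctr \<epsilon> x then c else 0) \<partial>lborel) = c * ennreal ?N" for x :: "real^'n" and c
    proof -
      have "(\<integral>\<^sup>+y. (if ctr \<epsilon> y = ctr \<epsilon> x then c else 0) \<partial>lborel)
        = (\<integral>\<^sup>+y. c * indicator {y. ctr \<epsilon> y = ctr \<epsilon> x} y \<partial>lborel)"
        by (intro nn_integral_cong) auto
      then show ?thesis by (simp add: nn_integral_cmult_indicator emeasure_cell[OF \<epsilon>(1)])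
    qed
    have "(\<integral>\<^sup>+x. indicator ?B x * ennreal \<bar>avg \<epsilon> u x - u x\<bar> \<partial>lborel)
      \<le> (\<integral>\<^sup>+x. ennreal (1 / ?N) * (\<integral>\<^sup>+y. ?F x y + ?G x y \<partial>lborel) \<partial>lborel)"
    proof (intro nn_integral_mono)
      fix x :: "real^'n"
      show "indicator ?B x * ennreal \<bar>avg \<epsilon> u x - u x\<bar> \<le> ennreal (1 / ?N) * (\<integral>\<^sup>+y. ?F x y + ?G x y \<partial>lborel)"
      proof (cases "x \<in> ?B")
        case True
        have "ennreal \<bar>avg \<epsilon> u x - u x\<bar>
          \<le> ennreal (1 / ?N) * (\<integral>\<^sup>+y. (if ctr \<epsilon> y = ctr \<epsilon> x then ennreal \<bar>u y - u x\<bar> else 0) \<partial>lborel)"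
          by (rule avg_diff_le[OF u b \<epsilon>(1)])
        also have "\<dots> \<le> ennreal (1 / ?N) * (\<integral>\<^sup>+y. ?F x y + ?G x y \<partial>lborel)"
        proof (intro mult_left_mono nn_integral_mono)
          fix y
          show "(if ctr \<epsilon> y = ctr \<epsilon> x then ennreal \<bar>u y - u x\<bar> else 0) \<le> ?F x y + ?G x y"
          proof (cases "ctr \<epsilon> y = ctr \<epsilon> x")
            case same: True
            have dd: "dist y x \<le> d * \<epsilon>"
              using same_cell_l1norm[OF \<epsilon>(1) same] norm_le_l1norm[of "y - x"] by (simp add: dist_norm d_def)
            also have "\<dots> \<le> d" using \<epsilon>(2) d1 by (simp add: mult_left_le)
            finally have yB: "y \<in> ?B'" using True dist_triangle[of 0 y x] by (simp add: dist_commute)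
            have xB: "x \<in> ?B'" using True d1 by simp
            have "dist (g y) (g x) < \<eta>" using dd \<epsilon>(3) by (intro \<delta>(2) yB xB) simp
            then have "\<bar>u y - u x\<bar> \<le> \<bar>u y - g y\<bar> + (\<eta> + \<bar>u x - g x\<bar>)" by (simp add: dist_real_def)
            then have "ennreal \<bar>u y - u x\<bar> \<le> ennreal \<bar>u y - g y\<bar> + (ennreal \<eta> + ennreal \<bar>u x - g x\<bar>)"
              using \<eta>(1) by (simp add: ennreal_plus[symmetric] ennreal_leI del: ennreal_plus)
            then show ?thesis using same True xB yB by (simp add: \<phi>_def \<psi>_def)
          qed simp
        qed simp
        finally show ?thesis using True by simp
      qed simp
    qed
    also have "\<dots> = (\<integral>\<^sup>+x. ennreal (1 / ?N) * (\<integral>\<^sup>+y. ?F x y \<partial>lborel) + \<psi> x \<partial>lborel)"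
    proof (intro nn_integral_cong)
      fix x :: "real^'n"
      have "(\<integral>\<^sup>+y. ?F x y + ?G x y \<partial>lborel) = (\<integral>\<^sup>+y. ?F x y \<partial>lborel) + \<psi> x * ennreal ?N"
        by (subst nn_integral_add) (simp_all add: cm)
      then show "ennreal (1 / ?N) * (\<integral>\<^sup>+y. ?F x y + ?G x y \<partial>lborel)
         = ennreal (1 / ?N) * (\<integral>\<^sup>+y. ?F x y \<partial>lborel) + \<psi> x"
        using cancel by (simp add: distrib_left mult.left_commute[of _ "\<psi> x"])
    qed
    also have "\<dots> = (\<integral>\<^sup>+x. ennreal (1 / ?N) * (\<integral>\<^sup>+y. ?F x y \<partial>lborel) \<partial>lborel) + (\<integral>\<^sup>+x. \<psi> x \<partial>lborel)"
      by (intro nn_integral_add) (use borel_measurable_nn_integral_lborel[OF Fm] in auto)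
    also have "(\<integral>\<^sup>+x. ennreal (1 / ?N) * (\<integral>\<^sup>+y. ?F x y \<partial>lborel) \<partial>lborel)
       = ennreal (1 / ?N) * (\<integral>\<^sup>+x. \<integral>\<^sup>+y. ?F x y \<partial>lborel \<partial>lborel)"
      by (intro nn_integral_cmult) (use borel_measurable_nn_integral_lborel[OF Fm] in auto)
    also have "(\<integral>\<^sup>+x. \<integral>\<^sup>+y. ?F x y \<partial>lborel \<partial>lborel) = (\<integral>\<^sup>+y. \<integral>\<^sup>+x. ?F x y \<partial>lborel \<partial>lborel)"
      by (rule nn_integral_lborel_swap[OF Fm])
    also have "\<dots> = (\<integral>\<^sup>+y. \<phi> y * ennreal ?N \<partial>lborel)"
    proof (intro nn_integral_cong)
      fix y
      have "(\<integral>\<^sup>+x. ?F x y \<partial>lborel) = (\<integral>\<^sup>+x. (if ctr \<epsilon> x = ctr \<epsilon> y then \<phi> y else 0) \<partial>lborel)"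
        by (intro nn_integral_cong) auto
      then show "(\<integral>\<^sup>+x. ?F x y \<partial>lborel) = \<phi> y * ennreal ?N" unfolding cm .
    qed
    also have "\<dots> = (\<integral>\<^sup>+y. \<phi> y \<partial>lborel) * ennreal ?N" by (rule nn_integral_multc) simp
    also have "ennreal (1 / ?N) * \<dots> = (\<integral>\<^sup>+y. \<phi> y \<partial>lborel)"
      using cancel by (simp add: mult.left_commute[of _ "\<integral>\<^sup>+y. \<phi> y \<partial>lborel"])
    also have "(\<integral>\<^sup>+x. \<psi> x \<partial>lborel) \<le> ennreal (\<eta> * m) + ennreal \<eta>"
    proof -
      have "(\<integral>\<^sup>+x. \<psi> x \<partial>lborel) \<le> (\<integral>\<^sup>+x. ennreal \<eta> * indicator ?B x + \<phi> x \<partial>lborel)"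
        by (intro nn_integral_mono) (auto simp: \<psi>_def indicator_def)
      also have "\<dots> = ennreal \<eta> * emeasure lborel ?B + (\<integral>\<^sup>+x. \<phi> x \<partial>lborel)"
        by (subst nn_integral_add) (auto simp: nn_integral_cmult_indicator)
      also have "\<dots> \<le> ennreal (\<eta> * m) + ennreal \<eta>"
        using gu \<eta>(1) m by (intro add_mono) (auto simp: \<phi>_def ennreal_mult)
      finally show ?thesis .
    qed
    also have "(\<integral>\<^sup>+y. \<phi> y \<partial>lborel) + (ennreal (\<eta> * m) + ennreal \<eta>) \<le> ennreal \<eta> + (ennreal (\<eta> * m) + ennreal \<eta>)"
      using gu unfolding \<phi>_def by (intro add_right_mono)
    also have "\<dots> = ennreal \<eta>'"
      using \<eta> m by (simp add: ennreal_plus[symmetric] algebra_simps del: ennreal_plus)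
    finally show ?thesis by (simp add: add_left_mono)
  qed
  have "eventually (\<lambda>n. e n < min 1 (\<delta> / d)) sequentially"
    using e(2) \<delta>(1) d1 by (intro order_tendstoD) auto
  then show "eventually (\<lambda>n. (\<integral>\<^sup>+x. indicator ?B x * ennreal \<bar>avg (e n) u x - u x\<bar> \<partial>lborel) \<le> ennreal \<eta>') sequentially"
  proof eventually_elim
    case (elim n)
    then show ?case using e(1)[of n] d1 by (intro main) (auto simp: field_simps)
  qed
qed

section \<open>Subsequences converging almost everywhere\<close>

lemma strict_mono_choice:
  fixes P :: "nat \<Rightarrow> nat \<Rightarrow> bool"
  assumes "\<And>k. eventually (P k) sequentially"
  obtains r where "strict_mono r" "\<And>k. P k (r k)"
proof -
  have "\<exists>r. \<forall>k. P k (r k) \<and> r k < r (Suc k)"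
  proof (rule dependent_nat_choice)
    show "\<exists>n. P 0 n" using assms[of 0] by (auto simp: eventually_sequentially)
    fix n k
    from eventually_conj[OF assms[of "Suc k"] eventually_gt_at_top[of n]]
    show "\<exists>m. P (Suc k) m \<and> n < m" by (auto simp: eventually_sequentially)
  qed
  then show thesis using that by (auto simp: strict_mono_Suc_iff)
qed

lemma AE_suminf_finite:
  fixes f :: "nat \<Rightarrow> 'a \<Rightarrow> ennreal"
  assumes [measurable]: "\<And>k. f k \<in> borel_measurable M" and le: "\<And>k. (\<integral>\<^sup>+x. f k x \<partial>M) \<le> ennreal ((1/2) ^ k)"
  shows "AE x in M. (\<Sum>k. f k x) \<noteq> \<infinity>"
proof (rule nn_integral_PInf_AE)
  have "(\<integral>\<^sup>+x. (\<Sum>k. f k x) \<partial>M) = (\<Sum>k. \<integral>\<^sup>+x. f k x \<partial>M)" by (rule nn_integral_suminf) simp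
  also have "\<dots> \<le> (\<Sum>k. ennreal (1 * (1/2) ^ k))" using le by (intro suminf_le summableI) simp
  also have "\<dots> < \<infinity>" by (subst suminf_geometric_ennreal) auto
  finally show "(\<integral>\<^sup>+x. (\<Sum>k. f k x) \<partial>M) \<noteq> \<infinity>" by simp
qed measurable

lemma suminf_ennreal_finite_summable:
  assumes "\<And>k. 0 \<le> a k" "(\<Sum>k. ennreal (a k)) \<noteq> \<infinity>"
  shows "summable a"
  using assms by (intro summable_suminf_not_top) (auto simp: top_ennreal_def)

text \<open>Taking the \<open>k\<close>-th term with error at most \<open>(1/2) ^ k\<close> on the
  ball of radius \<open>k\<close> makes the errors summable almost everywhere. Every point lies in
  all but finitely many of the balls, so one subsequence works on the whole space.\<close>

lemma L1loc_AE_subseq: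
  fixes f :: "nat \<Rightarrow> real^'n \<Rightarrow> real"
  assumes [measurable]: "\<And>n. f n \<in> borel_measurable borel" "u \<in> borel_measurable borel"
    and lim: "\<And>\<rho>. (\<lambda>n. \<integral>\<^sup>+x. indicator (cball 0 \<rho>) x * ennreal \<bar>f n x - u x\<bar> \<partial>lborel) \<longlonglongrightarrow> 0"
  obtains r where "strict_mono r" "AE x in lborel. (\<lambda>k. f (r k) x) \<longlonglongrightarrow> u x"
proof -
  define P where "P k n \<longleftrightarrow> (\<integral>\<^sup>+x. indicator (cball 0 (real k)) x * ennreal \<bar>f n x - u x\<bar> \<partial>lborel)
     \<le> ennreal ((1/2) ^ k)" for k n
  have ev: "eventually (P k) sequentially" for k
    unfolding P_def by (intro tendsto_zero_ennrealD lim) simp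
  obtain r where r: "strict_mono r" and
    rk: "\<And>k. (\<integral>\<^sup>+x. indicator (cball 0 (real k)) x * ennreal \<bar>f (r k) x - u x\<bar> \<partial>lborel) \<le> ennreal ((1/2) ^ k)"
    by (rule strict_mono_choice[of P, OF ev]) (auto simp: P_def)
  have "AE x in lborel. (\<Sum>k. indicator (cball 0 (real k)) x * ennreal \<bar>f (r k) x - u x\<bar>) \<noteq> \<infinity>"
    by (rule AE_suminf_finite[OF _ rk]) measurable
  then have "AE x in lborel. (\<lambda>k. f (r k) x) \<longlonglongrightarrow> u x"
  proof eventually_elim
    case (elim x)
    let ?a = "\<lambda>k. indicator (cball 0 (real k)) x * \<bar>f (r k) x - u x\<bar>"
    have "(\<Sum>k. ennreal (?a k)) \<noteq> \<infinity>"
      using elim by (simp add: ennreal_mult'' ennreal_indicator)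
    then have "summable ?a" by (intro suminf_ennreal_finite_summable) auto
    then have lim: "?a \<longlonglongrightarrow> 0" by (rule summable_LIMSEQ_zero)
    obtain k0 :: nat where k0: "norm x \<le> real k0" using real_arch_simple by blast
    have "eventually (\<lambda>k. ?a k = \<bar>f (r k) x - u x\<bar>) sequentially"
      using eventually_ge_at_top[of k0] by eventually_elim (use k0 in \<open>auto simp: indicator_def\<close>)
    from Lim_transform_eventually[OF lim this]
    have "(\<lambda>k. \<bar>f (r k) x - u x\<bar>) \<longlonglongrightarrow> 0" .
    then show ?case by (simp add: tendsto_rabs_zero_iff LIM_zero_iff)
  qed
  with r show thesis by (rule that)
qed

section \<open>Lower semicontinuity\<close>

lemma AE_lborel_fst:
  fixes P :: "'a::euclidean_space \<Rightarrow> bool"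
  assumes "AE x in lborel. P x"
  shows "AE z in (lborel :: ('a \<times> 'b::euclidean_space) measure). P (fst z)"
proof -
  obtain N where N: "N \<in> null_sets lborel" "{x. \<not> P x} \<subseteq> N"
    using assms by (auto elim!: AE_E simp: null_sets_def)
  have "N \<times> (UNIV :: 'b set) \<in> null_sets (lborel \<Otimes>\<^sub>M lborel)"
    using N(1) by (intro null_setsI) (auto simp: lborel.emeasure_pair_measure_Times null_sets_def)
  then show ?thesis
    unfolding lborel_prod by (rule AE_I') (use N(2) in auto)
qed

lemma AE_lborel_snd:
  fixes P :: "'b::euclidean_space \<Rightarrow> bool"
  assumes "AE x in lborel. P x"
  shows "AE z in (lborel :: ('a::euclidean_space \<times> 'b) measure). P (snd z)"
proof -
  obtain N where N: "N \<in> null_sets lborel" "{x. \<not> P x} \<subseteq> N"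
    using assms by (auto elim!: AE_E simp: null_sets_def)
  have "(UNIV :: 'a set) \<times> N \<in> null_sets (lborel \<Otimes>\<^sub>M lborel)"
    using N(1) by (intro null_setsI) (auto simp: lborel.emeasure_pair_measure_Times null_sets_def)
  then show ?thesis
    unfolding lborel_prod by (rule AE_I') (use N(2) in auto)
qed

text \<open>The form of \<open>KK\<close> for Borel representatives. Lebesgue measure on pairs is a
  completion of the product measure, not itself a product, so Fubini is always applied over
  \<open>lborel\<close>.\<close>

definition energy :: "((real^'n) \<times> (real^'n) \<Rightarrow> ennreal) \<Rightarrow> (real^'n \<Rightarrow> real) \<Rightarrow> ((real^'n) \<times> (real^'n)) set \<Rightarrow> ennreal" where
  "energy K v D = (\<integral>\<^sup>+z. indicator D z * (ennreal \<bar>v (fst z) - v (snd z)\<bar> * K z) \<partial>lborel)"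

lemma borel_measurable_energy_integrand:
  fixes v :: "real^'n \<Rightarrow> real"
  assumes [measurable]: "K \<in> borel_measurable borel" "v \<in> borel_measurable borel" "D \<in> sets borel"
  shows "(\<lambda>z. indicator D z * (ennreal \<bar>v (fst z) - v (snd z)\<bar> * K z)) \<in> borel_measurable borel"
proof -
  have "(\<lambda>z::(real^'n) \<times> (real^'n). ennreal \<bar>v (fst z) - v (snd z)\<bar>) \<in> borel_measurable (borel \<Otimes>\<^sub>M borel)"
    by measurable
  then have [measurable]: "(\<lambda>z::(real^'n) \<times> (real^'n). ennreal \<bar>v (fst z) - v (snd z)\<bar>) \<in> borel_measurable borel"
    by (simp add: borel_prod)
  show ?thesis by measurable
qed

lemma energy_domain_borel:
  fixes \<Omega> :: "'a::euclidean_space set"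
  assumes "open \<Omega>"
  shows "UNIV - (- \<Omega>) \<times> (- \<Omega>) \<in> sets borel"
  using assms by (intro borel_open open_Diff closed_Times) auto

lemma KK_eq_energy:
  assumes K: "AE z in lborel. K z = K0 z" and v: "AE x in lborel. v x = v0 x"
  shows "KK K v \<Omega> = energy K0 v0 (UNIV - (- \<Omega>) \<times> (- \<Omega>))"
proof -
  have "KK K v \<Omega> = (\<integral>\<^sup>+z. (ennreal \<bar>v (fst z) - v (snd z)\<bar> * K z) * indicator (UNIV - (- \<Omega>) \<times> (- \<Omega>)) z \<partial>lborel)"
    unfolding KK_def by (rule nn_integral_completion)
  also have "\<dots> = energy K0 v0 (UNIV - (- \<Omega>) \<times> (- \<Omega>))"
    unfolding energy_def
  proof (rule nn_integral_cong_AE)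
    show "AE z in lborel. (ennreal \<bar>v (fst z) - v (snd z)\<bar> * K z) * indicator (UNIV - (- \<Omega>) \<times> (- \<Omega>)) z
      = indicator (UNIV - (- \<Omega>) \<times> (- \<Omega>)) z * (ennreal \<bar>v0 (fst z) - v0 (snd z)\<bar> * K0 z)"
      using K AE_lborel_fst[OF v] AE_lborel_snd[OF v] by eventually_elim (simp add: mult_ac)
  qed
  finally show ?thesis .
qed

lemma kernel_borel_representative:
  fixes K :: "(real^'n) \<times> (real^'n) \<Rightarrow> ennreal"
  assumes "kernel_hyp K s lam Lam"
  obtains K0 where "K0 \<in> borel_measurable borel" "AE z in lborel. K z = K0 z"
    "AE z in lborel. ennreal (lam * wker s (fst z - snd z)) \<le> K0 z"
    "AE z in lborel. K0 z \<le> ennreal (Lam * wker s (fst z - snd z))"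
proof -
  have Km: "K \<in> borel_measurable lebesgue" using assms by (simp add: kernel_hyp_def)
  then obtain K0 where K0: "K0 \<in> borel_measurable lborel" "AE z in lborel. K z = K0 z"
    using completion_ex_borel_measurable[of K lborel] by auto
  have "AE z in lborel. ennreal (lam * wker s (fst z - snd z)) \<le> K z \<and> K z \<le> ennreal (Lam * wker s (fst z - snd z))"
    using assms unfolding kernel_hyp_def wker_def AE_completion_iff by blast
  with K0(2) have "AE z in lborel. ennreal (lam * wker s (fst z - snd z)) \<le> K0 z \<and> K0 z \<le> ennreal (Lam * wker s (fst z - snd z))"
    by eventually_elim simp
  then show thesis using K0 by (intro that[of K0]) auto
qed

lemma Xsp_borel_representative:
  fixes v :: "real^'n \<Rightarrow> real"
  assumes "v \<in> Xsp"
  obtains v0 where "v0 \<in> borel_measurable borel" "\<And>x. \<bar>v0 x\<bar> \<le> 1" "AE x in lborel. v x = v0 x"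
proof -
  have vm: "v \<in> borel_measurable lebesgue" and vb: "AE x in lborel. \<bar>v x\<bar> \<le> 1"
    using assms by (simp_all add: Xsp_def AE_completion_iff)
  obtain g where g: "g \<in> borel_measurable lborel" "AE x in lborel. v x = g x"
    using completion_ex_borel_measurable_real[OF vm] by auto
  have [measurable]: "g \<in> borel_measurable borel" using g(1) by simp
  show thesis
  proof (rule that)
    \<comment> \<open>Clipping turns the almost everywhere bound into the pointwise one that the
      lemmas on averages assume.\<close>
    show "(\<lambda>x. max (-1) (min 1 (g x))) \<in> borel_measurable borel" by measurable
    show "AE x in lborel. v x = max (-1) (min 1 (g x))"
      using g(2) vb by eventually_elim (auto simp: abs_le_iff)
  qed auto
qed

lemma XspI: "v \<in> borel_measurable borel \<Longrightarrow> (\<And>x. \<bar>v x\<bar> \<le> 1) \<Longrightarrow> v \<in> Xsp"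
  by (simp add: Xsp_def measurable_completion)

lemma L1loc_integral_eq:
  assumes "AE x in lborel. f x = f0 x" "AE x in lborel. u x = u0 x"
  shows "(\<integral>\<^sup>+x\<in>C. ennreal \<bar>f x - u x\<bar> \<partial>lebesgue) = (\<integral>\<^sup>+x. indicator C x * ennreal \<bar>f0 x - u0 x\<bar> \<partial>lborel)"
proof -
  have "(\<integral>\<^sup>+x\<in>C. ennreal \<bar>f x - u x\<bar> \<partial>lebesgue) = (\<integral>\<^sup>+x. ennreal \<bar>f x - u x\<bar> * indicator C x \<partial>lborel)"
    by (rule nn_integral_completion)
  also have "\<dots> = (\<integral>\<^sup>+x. indicator C x * ennreal \<bar>f0 x - u0 x\<bar> \<partial>lborel)"
  proof (rule nn_integral_cong_AE)
    show "AE x in lborel. ennreal \<bar>f x - u x\<bar> * indicator C x = indicator C x * ennreal \<bar>f0 x - u0 x\<bar>"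
      using assms by eventually_elim (simp add: mult_ac)
  qed
  finally show ?thesis .
qed

section \<open>Passage between one-sided limits and sequences\<close>

lemma L1loc_tendsto_at_rightD:
  assumes L: "L1loc_tendsto f u (at_right 0)" and e: "\<And>n. 0 < e n" "e \<longlonglongrightarrow> (0::real)"
    and f0: "\<And>n. AE x in lborel. f (e n) x = f0 n x" and u0: "AE x in lborel. u x = u0 x"
  shows "(\<lambda>n. \<integral>\<^sup>+x. indicator (cball 0 \<rho>) x * ennreal \<bar>f0 n x - u0 x\<bar> \<partial>lborel) \<longlonglongrightarrow> 0"
proof -
  have "((\<lambda>t. \<integral>\<^sup>+x\<in>cball 0 \<rho>. ennreal \<bar>f t x - u x\<bar> \<partial>lebesgue) \<longlongrightarrow> 0) (at_right 0)"
    using L unfolding L1loc_tendsto_def by simp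
  moreover have "e n \<noteq> 0" for n using e(1)[of n] by simp
  then have "filterlim e (at_right 0) sequentially"
    using e by (simp add: filterlim_at)
  ultimately have "(\<lambda>n. \<integral>\<^sup>+x\<in>cball 0 \<rho>. ennreal \<bar>f (e n) x - u x\<bar> \<partial>lebesgue) \<longlonglongrightarrow> 0"
    by (rule filterlim_compose)
  then show ?thesis unfolding L1loc_integral_eq[OF f0 u0] .
qed

lemma L1loc_tendsto_at_rightI:
  fixes f :: "real \<Rightarrow> real^'n \<Rightarrow> real"
  assumes lim: "\<And>e \<rho>. (\<And>n. 0 < e n) \<Longrightarrow> e \<longlonglongrightarrow> 0 \<Longrightarrow>
       (\<lambda>n. \<integral>\<^sup>+x. indicator (cball 0 \<rho>) x * ennreal \<bar>f (e n) x - u0 x\<bar> \<partial>lborel) \<longlonglongrightarrow> 0"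
    and u0: "AE x in lborel. u x = u0 x"
  shows "L1loc_tendsto f u (at_right 0)"
  unfolding L1loc_tendsto_def tendsto_at_iff_sequentially comp_def
proof (intro allI impI)
  fix C :: "(real^'n) set" and e :: "nat \<Rightarrow> real"
  assume C: "compact C" and e0: "\<forall>i. e i \<in> {0<..} - {0}" and e: "e \<longlonglongrightarrow> 0"
  obtain \<rho> where "\<forall>x\<in>C. norm x \<le> \<rho>"
    using compact_imp_bounded[OF C] unfolding bounded_iff by blast
  then have \<rho>: "C \<subseteq> cball 0 \<rho>" by auto
  show "(\<lambda>n. \<integral>\<^sup>+x\<in>C. ennreal \<bar>f (e n) x - u x\<bar> \<partial>lebesgue) \<longlonglongrightarrow> 0"
  proof (rule tendsto_sandwich[OF _ _ tendsto_const])
    show "(\<lambda>n. \<integral>\<^sup>+x. indicator (cball 0 \<rho>) x * ennreal \<bar>f (e n) x - u0 x\<bar> \<partial>lborel) \<longlonglongrightarrow> 0"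
      using e0 e by (intro lim) auto
    show "eventually (\<lambda>n. (\<integral>\<^sup>+x\<in>C. ennreal \<bar>f (e n) x - u x\<bar> \<partial>lebesgue)
      \<le> (\<integral>\<^sup>+x. indicator (cball 0 \<rho>) x * ennreal \<bar>f (e n) x - u0 x\<bar> \<partial>lborel)) sequentially"
    proof (intro always_eventually allI)
      fix n
      show "(\<integral>\<^sup>+x\<in>C. ennreal \<bar>f (e n) x - u x\<bar> \<partial>lebesgue)
        \<le> (\<integral>\<^sup>+x. indicator (cball 0 \<rho>) x * ennreal \<bar>f (e n) x - u0 x\<bar> \<partial>lborel)"
        unfolding L1loc_integral_eq[OF AE_I2[OF refl] u0]
        by (intro nn_integral_mono mult_right_mono) (use \<rho> in \<open>auto simp: indicator_def\<close>)
    qed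
  qed simp
qed

text \<open>A failure along a null sequence persists along its subsequences. Both inequalities can
  therefore be proved along a subsequence that converges almost everywhere.\<close>

lemma eventually_at_right_0_seqI:
  assumes "\<And>e. (\<And>n. 0 < e n) \<Longrightarrow> e \<longlonglongrightarrow> (0::real) \<Longrightarrow> (\<And>n. \<not> P (e n)) \<Longrightarrow> False"
  shows "eventually P (at_right 0)"
proof (rule ccontr)
  assume "\<not> eventually P (at_right 0)"
  then have "\<exists>x. 0 < x \<and> x < b \<and> \<not> P x" if "0 < b" for b :: real
    using that unfolding eventually_at_right_field by blast
  then have "\<exists>x. 0 < x \<and> x < 1 / real (Suc n) \<and> \<not> P x" for n by simp
  then obtain e where e: "\<And>n. 0 < e n" "\<And>n. e n < 1 / real (Suc n)" "\<And>n. \<not> P (e n)" by metis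
  have "e \<longlonglongrightarrow> 0"
  proof (rule tendsto_sandwich[OF _ _ tendsto_const])
    show "(\<lambda>n. 1 / real (Suc n)) \<longlonglongrightarrow> 0" by (rule LIMSEQ_Suc[OF lim_1_over_n])
  qed (use e(1,2) in \<open>auto intro!: always_eventually less_imp_le\<close>)
  with e assms show False by blast
qed

text \<open>A finite value excludes the branch \<open>\<infinity>\<close> of \<open>GK\<close>; this
  is how an energy bound yields the values \<open>\<plusminus>1\<close> in
  \<open>\<Omega>\<close>.\<close>

lemma GK_finite_representative:
  fixes v :: "real^'n \<Rightarrow> real"
  assumes fin: "GK K \<Omega> v \<le> y" "y < \<infinity>" and K: "AE z in lborel. K z = K0 z"
  obtains v0 where "v0 \<in> borel_measurable borel" "\<And>x. \<bar>v0 x\<bar> \<le> 1" "AE x in lborel. v x = v0 x"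
    "AE x in lborel. x \<in> \<Omega> \<longrightarrow> v0 x = 1 \<or> v0 x = -1"
    "energy K0 v0 (UNIV - (- \<Omega>) \<times> (- \<Omega>)) \<le> y"
proof -
  have "GK K \<Omega> v \<noteq> \<infinity>" using fin by auto
  then have X: "v \<in> Xsp" and G: "GK K \<Omega> v = KK K v \<Omega>"
    and E: "\<exists>E. E \<in> sets lebesgue \<and> E \<subseteq> \<Omega> \<and> (AE x in lebesgue. x \<in> \<Omega> \<longrightarrow> v x = indicator E x - indicator (- E) x)"
    unfolding GK_def by (auto split: if_splits)
  from E obtain E where E: "AE x in lborel. x \<in> \<Omega> \<longrightarrow> v x = indicator E x - indicator (- E) x"
    by (auto simp: AE_completion_iff)
  obtain v0 where v0: "v0 \<in> borel_measurable borel" "\<And>x. \<bar>v0 x\<bar> \<le> 1" "AE x in lborel. v x = v0 x"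
    by (rule Xsp_borel_representative[OF X]) blast
  show thesis
  proof (rule that[OF v0])
    show "AE x in lborel. x \<in> \<Omega> \<longrightarrow> v0 x = 1 \<or> v0 x = -1"
      using E v0(3) by eventually_elim (auto simp: indicator_def)
    show "energy K0 v0 (UNIV - (- \<Omega>) \<times> (- \<Omega>)) \<le> y"
      using fin G KK_eq_energy[OF K v0(3), of \<Omega>] by simp
  qed
qed

lemma GK_eq_energy:
  fixes v :: "real^'n \<Rightarrow> real"
  assumes v0 [measurable]: "v0 \<in> borel_measurable borel" "v \<in> Xsp" "AE x in lborel. v x = v0 x"
    and pm: "AE x in lborel. x \<in> \<Omega> \<longrightarrow> v0 x = 1 \<or> v0 x = -1"
    and K: "AE z in lborel. K z = K0 z" and [measurable]: "\<Omega> \<in> sets borel"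
  shows "GK K \<Omega> v = energy K0 v0 (UNIV - (- \<Omega>) \<times> (- \<Omega>))"
proof -
  let ?E = "{x \<in> \<Omega>. v0 x = 1}"
  have "?E \<in> sets lborel" by measurable
  then have "?E \<in> sets lebesgue" by (rule sets_completionI_sets)
  moreover have "AE x in lebesgue. x \<in> \<Omega> \<longrightarrow> v x = indicator ?E x - indicator (- ?E) x"
    unfolding AE_completion_iff using assms(3) pm by eventually_elim (auto simp: indicator_def)
  ultimately have "GK K \<Omega> v = KK K v \<Omega>" using assms(2) unfolding GK_def by (auto intro!: exI[of _ ?E])
  then show ?thesis by (simp add: KK_eq_energy[OF K assms(3)])
qed

text \<open>Fatou. Finiteness of \<open>K\<close> almost everywhere makes multiplication by
  \<open>K z\<close> continuous, also where the limit of the differences is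
  \<open>0\<close>.\<close>

lemma energy_liminf:
  assumes [measurable]: "K \<in> borel_measurable borel" "\<And>k. v k \<in> borel_measurable borel" "D \<in> sets borel"
    and fin: "AE z in lborel. K z < \<infinity>" and lim: "AE x in lborel. (\<lambda>k. v k x) \<longlonglongrightarrow> u x"
    and le: "\<And>k. energy K (v k) D \<le> y"
  shows "energy K u D \<le> y"
proof -
  let ?f = "\<lambda>k z. indicator D z * (ennreal \<bar>v k (fst z) - v k (snd z)\<bar> * K z)"
  have fm: "?f k \<in> borel_measurable lborel" for k
    using borel_measurable_energy_integrand[OF assms(1,2,3)] by simp
  have "energy K u D = (\<integral>\<^sup>+z. liminf (\<lambda>k. ?f k z) \<partial>lborel)"
    unfolding energy_def
  proof (rule nn_integral_cong_AE)
    show "AE z in lborel. indicator D z * (ennreal \<bar>u (fst z) - u (snd z)\<bar> * K z) = liminf (\<lambda>k. ?f k z)"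
      using fin AE_lborel_fst[OF lim] AE_lborel_snd[OF lim]
    proof eventually_elim
      case (elim z)
      have "(\<lambda>k. indicator D z * (K z * ennreal \<bar>v k (fst z) - v k (snd z)\<bar>))
         \<longlonglongrightarrow> indicator D z * (K z * ennreal \<bar>u (fst z) - u (snd z)\<bar>)"
        using elim by (intro ennreal_tendsto_cmult tendsto_ennrealI tendsto_intros) (auto simp: indicator_def)
      then have "(\<lambda>k. ?f k z) \<longlonglongrightarrow> indicator D z * (ennreal \<bar>u (fst z) - u (snd z)\<bar> * K z)"
        by (simp add: mult.commute)
      then show ?case by (intro lim_imp_Liminf[symmetric]) auto
    qed
  qed
  also have "\<dots> \<le> liminf (\<lambda>k. \<integral>\<^sup>+z. ?f k z \<partial>lborel)" by (rule nn_integral_liminf[OF fm])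
  also have "\<dots> = liminf (\<lambda>k. energy K (v k) D)" by (simp add: energy_def)
  also have "\<dots> \<le> liminf (\<lambda>k. y)" by (intro Liminf_mono always_eventually allI le)
  also have "\<dots> = y" by (simp add: Liminf_const)
  finally show ?thesis .
qed

text \<open>If the inequality fails, some \<open>y < GK K \<Omega> u\<close> bounds the energies
  along a null sequence, and a convergent subsequence contradicts \<open>energy_liminf\<close>. The
  values \<open>\<plusminus>1\<close> pass to the limit because \<open>{1, -1}\<close> is closed, so
  \<open>GK\<close> at \<open>u\<close> is in its energy branch; this also settles the case
  \<open>GK K \<Omega> u = \<infinity>\<close>.\<close>

lemma gamma_liminf:
  fixes u :: "real^'n \<Rightarrow> real"
  assumes K: "kernel_hyp K s lam Lam" and \<Omega>: "open \<Omega>"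
    and u: "u \<in> Xsp" and L: "L1loc_tendsto ue u (at_right 0)"
  shows "GK K \<Omega> u \<le> Liminf (at_right 0) (\<lambda>eps. GKeps eps K \<Omega> (ue eps))"
  unfolding le_Liminf_iff
proof (intro allI impI, rule eventually_at_right_0_seqI)
  fix y and e :: "nat \<Rightarrow> real"
  assume y: "y < GK K \<Omega> u" and e: "\<And>n. 0 < e n" "e \<longlonglongrightarrow> 0"
    and "\<And>n. \<not> y < GKeps (e n) K \<Omega> (ue (e n))"
  have yfin: "y < \<infinity>" using y by (auto intro: less_le_trans)
  have le: "GK K \<Omega> (ue (e n)) \<le> y" for n
  proof -
    have *: "GKeps (e n) K \<Omega> (ue (e n)) \<le> y" using \<open>\<not> y < GKeps (e n) K \<Omega> (ue (e n))\<close> by (simp add: not_less)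
    then have "ue (e n) \<in> Xeps (e n)" using yfin unfolding GKeps_def by (auto split: if_splits simp: top_unique)
    then show ?thesis using * by (simp add: GKeps_def)
  qed
  let ?D = "UNIV - (- \<Omega>) \<times> (- \<Omega>)"
  have [measurable]: "\<Omega> \<in> sets borel" using \<Omega> by simp
  have Dm: "?D \<in> sets borel" using \<Omega> by (rule energy_domain_borel)
  obtain K0 where K0: "K0 \<in> borel_measurable borel" "AE z in lborel. K z = K0 z"
    "AE z in lborel. K0 z \<le> ennreal (Lam * wker s (fst z - snd z))"
    by (rule kernel_borel_representative[OF K]) blast
  have K0fin: "AE z in lborel. K0 z < \<infinity>" using K0(3) by eventually_elim (auto intro: le_less_trans)
  have "\<forall>n. \<exists>v. v \<in> borel_measurable borel \<and> (AE x in lborel. ue (e n) x = v x) \<and>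
    (AE x in lborel. x \<in> \<Omega> \<longrightarrow> v x = 1 \<or> v x = -1) \<and> energy K0 v ?D \<le> y"
    by (intro allI, rule GK_finite_representative[OF le yfin K0(2)]) blast
  from choice[OF this]
  obtain v where v: "\<And>n. v n \<in> borel_measurable borel" "\<And>n. AE x in lborel. ue (e n) x = v n x"
    "\<And>n. AE x in lborel. x \<in> \<Omega> \<longrightarrow> v n x = 1 \<or> v n x = -1" "\<And>n. energy K0 (v n) ?D \<le> y"
    by auto
  obtain u0 where u0: "u0 \<in> borel_measurable borel" "AE x in lborel. u x = u0 x"
    by (rule Xsp_borel_representative[OF u]) blast
  obtain r where r: "strict_mono r" and lim: "AE x in lborel. (\<lambda>k. v (r k) x) \<longlonglongrightarrow> u0 x"
    by (rule L1loc_AE_subseq[OF v(1) u0(1) L1loc_tendsto_at_rightD[OF L e v(2) u0(2)]]) blast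
  have "AE x in lborel. \<forall>n. x \<in> \<Omega> \<longrightarrow> v n x = 1 \<or> v n x = -1" unfolding AE_all_countable using v(3) by blast
  with lim have pm: "AE x in lborel. x \<in> \<Omega> \<longrightarrow> u0 x = 1 \<or> u0 x = -1"
  proof eventually_elim
    case (elim x)
    have "u0 x \<in> {1, -1}" if "x \<in> \<Omega>"
      by (rule closed_sequentially[OF _ _ elim(1)]) (use elim(2) that in \<open>auto intro: finite_imp_closed\<close>)
    then show ?case by auto
  qed
  have "energy K0 u0 ?D \<le> y" by (rule energy_liminf[OF K0(1) v(1) Dm K0fin lim v(4)])
  then have "GK K \<Omega> u \<le> y" using GK_eq_energy[OF u0(1) u u0(2) pm K0(2)] by simp
  with y show False by simp
qed

section \<open>Recovery sequence\<close>

lemma nn_integral_lborel_prod_swap: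
  fixes f :: "'a::euclidean_space \<times> 'a \<Rightarrow> ennreal"
  assumes f: "f \<in> borel_measurable borel"
  shows "(\<integral>\<^sup>+z. f (snd z, fst z) \<partial>lborel) = (\<integral>\<^sup>+z. f z \<partial>lborel)"
proof -
  have [measurable]: "f \<in> borel_measurable (borel \<Otimes>\<^sub>M borel)" using f by (simp add: borel_prod)
  have "(\<lambda>z. f (snd z, fst z)) \<in> borel_measurable (borel \<Otimes>\<^sub>M borel)" by measurable
  then have fs: "(\<lambda>z. f (snd z, fst z)) \<in> borel_measurable borel" by (simp add: borel_prod)
  have "(\<integral>\<^sup>+z. f (snd z, fst z) \<partial>lborel) = (\<integral>\<^sup>+x. \<integral>\<^sup>+y. f (y, x) \<partial>lborel \<partial>lborel)"
    using nn_integral_lborel_pair[OF fs] by simp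
  also have "\<dots> = (\<integral>\<^sup>+y. \<integral>\<^sup>+x. f (y, x) \<partial>lborel \<partial>lborel)"
    by (rule nn_integral_lborel_swap) (use fs in simp)
  also have "\<dots> = (\<integral>\<^sup>+z. f z \<partial>lborel)" by (rule nn_integral_lborel_pair[OF f, symmetric])
  finally show ?thesis .
qed

text \<open>The fractional perimeter of \<open>\<Omega>\<close>, taken with the
  \<open>l1norm\<close> kernel.\<close>

definition perim :: "real \<Rightarrow> (real^'n) set \<Rightarrow> ennreal" where
  "perim s \<Omega> = (\<integral>\<^sup>+z. indicator (\<Omega> \<times> (- \<Omega>)) z * ennreal (wker s (fst z - snd z)) \<partial>lborel)"

text \<open>The energy domain contains both orientations of a pair with exactly one point in
  \<open>\<Omega>\<close>, hence two terms here and the factor \<open>2\<close> in the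
  integral.\<close>

definition crossing :: "real \<Rightarrow> (real^'n) set \<Rightarrow> (real^'n) \<times> (real^'n) \<Rightarrow> ennreal" where
  "crossing s \<Omega> z = indicator (\<Omega> \<times> (- \<Omega>)) z * ennreal (wker s (fst z - snd z))
     + indicator ((- \<Omega>) \<times> \<Omega>) z * ennreal (wker s (fst z - snd z))"

lemma borel_measurable_perim_integrand:
  fixes A B :: "(real^'n) set"
  assumes [measurable]: "A \<in> sets borel" "B \<in> sets borel"
  shows "(\<lambda>z. indicator (A \<times> B) z * ennreal (wker s (fst z - snd z))) \<in> borel_measurable borel"
proof -
  have "(\<lambda>z. indicator (A \<times> B) z * ennreal (wker s (fst z - snd z))) \<in> borel_measurable (borel \<Otimes>\<^sub>M borel)"
    by measurable
  then show ?thesis by (simp add: borel_prod)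
qed

lemma borel_measurable_crossing [measurable]:
  "\<Omega> \<in> sets borel \<Longrightarrow> crossing s \<Omega> \<in> borel_measurable borel"
  unfolding crossing_def by (intro borel_measurable_add borel_measurable_perim_integrand) auto

lemma nn_integral_crossing:
  assumes \<Omega>: "\<Omega> \<in> sets borel"
  shows "(\<integral>\<^sup>+z. crossing s \<Omega> z \<partial>lborel) = 2 * perim s \<Omega>"
proof -
  have m: "(\<lambda>z. indicator (\<Omega> \<times> (- \<Omega>)) z * ennreal (wker s (fst z - snd z))) \<in> borel_measurable borel"
    "(\<lambda>z. indicator ((- \<Omega>) \<times> \<Omega>) z * ennreal (wker s (fst z - snd z))) \<in> borel_measurable borel"
    using \<Omega> by (auto intro!: borel_measurable_perim_integrand)
  have "(\<integral>\<^sup>+z. indicator ((- \<Omega>) \<times> \<Omega>) z * ennreal (wker s (fst z - snd z)) \<partial>lborel) = perim s \<Omega>"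
    unfolding perim_def nn_integral_lborel_prod_swap[OF m(1), symmetric]
    by (intro nn_integral_cong) (auto simp: indicator_def wker_minus_commute)
  then show ?thesis
    unfolding crossing_def using m by (subst nn_integral_add) (simp_all add: perim_def mult_2)
qed

text \<open>The function \<open>v\<close> of the overview. It is \<open>\<plusminus>1\<close> at
  every point, also on the null set of \<open>\<Omega>\<close> where \<open>u\<close> is not,
  because the rounding lemmas ask for pointwise values.\<close>

definition rext :: "(real^'n) set \<Rightarrow> (real^'n \<Rightarrow> real) \<Rightarrow> real^'n \<Rightarrow> real" where
  "rext \<Omega> u x = (if x \<in> \<Omega> \<and> 0 < u x then 1 else -1)"

lemma rext_values: "rext \<Omega> u x = 1 \<or> rext \<Omega> u x = -1"
  by (simp add: rext_def)

lemma borel_measurable_rext [measurable]: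
  assumes [measurable]: "\<Omega> \<in> sets borel" "u \<in> borel_measurable borel"
  shows "rext \<Omega> u \<in> borel_measurable borel"
  unfolding rext_def by measurable

lemma AE_rext_eq:
  assumes "AE x in lborel. x \<in> \<Omega> \<longrightarrow> u x = 1 \<or> u x = -1"
  shows "AE x in lborel. x \<in> \<Omega> \<longrightarrow> u x = rext \<Omega> u x"
  using assms by eventually_elim (auto simp: rext_def)

text \<open>Pairs inside \<open>\<Omega>\<close> are paid for by the energy and the lower kernel
  bound, pairs outside have no jump, and crossing pairs have jump at most \<open>2\<close>; the two
  orientations double this to \<open>4 * perim s \<Omega>\<close>.\<close>

lemma rext_seminorm_le:
  assumes \<Omega>: "open \<Omega>" and K [measurable]: "K \<in> borel_measurable borel" and v [measurable]: "v \<in> borel_measurable borel"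
    and lam: "0 < lam" "AE z in lborel. ennreal (lam * wker s (fst z - snd z)) \<le> K z"
    and pm: "AE x in lborel. x \<in> \<Omega> \<longrightarrow> v x = 1 \<or> v x = -1"
  shows "seminorm_on s (rext \<Omega> v) UNIV
    \<le> ennreal (1 / lam) * energy K v (UNIV - (- \<Omega>) \<times> (- \<Omega>)) + 4 * perim s \<Omega>"
proof -
  let ?D = "UNIV - (- \<Omega>) \<times> (- \<Omega>)"
  have [measurable]: "\<Omega> \<in> sets borel" using \<Omega> by simp
  have em [measurable]: "(\<lambda>z. indicator ?D z * (ennreal \<bar>v (fst z) - v (snd z)\<bar> * K z)) \<in> borel_measurable borel"
    using energy_domain_borel[OF \<Omega>] by (intro borel_measurable_energy_integrand) auto
  have "seminorm_on s (rext \<Omega> v) UNIV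
    \<le> (\<integral>\<^sup>+z. ennreal (1 / lam) * (indicator ?D z * (ennreal \<bar>v (fst z) - v (snd z)\<bar> * K z)) + 2 * crossing s \<Omega> z \<partial>lborel)"
    unfolding seminorm_on_def
  proof (rule nn_integral_mono_AE)
    show "AE z in lborel. indicator UNIV z * ennreal (\<bar>rext \<Omega> v (fst z) - rext \<Omega> v (snd z)\<bar> * wker s (fst z - snd z))
      \<le> ennreal (1 / lam) * (indicator ?D z * (ennreal \<bar>v (fst z) - v (snd z)\<bar> * K z)) + 2 * crossing s \<Omega> z"
      using lam(2) AE_lborel_fst[OF AE_rext_eq[OF pm]] AE_lborel_snd[OF AE_rext_eq[OF pm]]
    proof eventually_elim
      case (elim z)
      obtain x y where z: "z = (x, y)" by (cases z)
      let ?a = "\<bar>rext \<Omega> v x - rext \<Omega> v y\<bar>"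
      have a2: "?a \<le> 2" using rext_values[of \<Omega> v x] rext_values[of \<Omega> v y] by auto
      consider "x \<in> \<Omega>" "y \<in> \<Omega>" | "x \<notin> \<Omega>" "y \<notin> \<Omega>" | "x \<in> \<Omega> \<longleftrightarrow> y \<notin> \<Omega>" by blast
      then show ?case
      proof cases
        case 1
        have "ennreal (?a * wker s (x - y)) = ennreal (1 / lam) * (ennreal ?a * ennreal (lam * wker s (x - y)))"
          using lam(1) by (simp add: ennreal_mult[symmetric])
        also have "\<dots> \<le> ennreal (1 / lam) * (ennreal ?a * K z)"
          using elim(1) z by (intro mult_left_mono) auto
        also have "ennreal ?a = ennreal \<bar>v x - v y\<bar>" using elim(2,3) 1 z by simp
        finally show ?thesis using 1 z by (simp add: add_increasing2)
      next
        case 2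
        then show ?thesis by (simp add: z rext_def)
      next
        case 3
        have "ennreal (?a * wker s (x - y)) \<le> ennreal (2 * wker s (x - y))"
          using a2 by (intro ennreal_leI mult_right_mono) auto
        also have "\<dots> = 2 * crossing s \<Omega> z"
          using 3 by (auto simp: crossing_def z ennreal_mult)
        finally show ?thesis by (simp add: z add_increasing)
      qed
    qed
  qed
  also have "\<dots> = ennreal (1 / lam) * energy K v ?D + 2 * (2 * perim s \<Omega>)"
    by (subst nn_integral_add) (simp_all add: nn_integral_cmult nn_integral_crossing energy_def)
  finally show ?thesis by (simp add: mult.assoc[symmetric])
qed

lemma Xeps_cellI:
  fixes v :: "real^'n \<Rightarrow> real"
  assumes "0 < \<epsilon>" "v \<in> borel_measurable borel" "\<And>x. \<bar>v x\<bar> \<le> 1"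
    and cell: "\<And>x y. ctr \<epsilon> x = ctr \<epsilon> y \<Longrightarrow> v x = v y"
  shows "v \<in> Xeps \<epsilon>"
  unfolding Xeps_def
proof (intro CollectI conjI ballI)
  show "v \<in> Xsp" using assms by (intro XspI)
  fix i :: "real^'n" assume i: "i \<in> int_lattice"
  note 1 = ctr_scaled_lattice[OF assms(1) i]
  have "v x = v (\<epsilon> *\<^sub>R i)" if x: "x \<in> open_cube (\<epsilon> / 2) (\<epsilon> *\<^sub>R i)" for x
  proof (rule cell)
    have b: "\<bar>x $ j - (\<epsilon> *\<^sub>R i) $ j\<bar> < \<epsilon> / 2" for j using x by (simp add: open_cube_def)
    have "(\<epsilon> *\<^sub>R i) $ j - \<epsilon> / 2 \<le> x $ j" "x $ j < (\<epsilon> *\<^sub>R i) $ j + \<epsilon> / 2" for j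
      using b[of j] by linarith+
    then show "ctr \<epsilon> x = ctr \<epsilon> (\<epsilon> *\<^sub>R i)" unfolding 1 by (intro ctr_eqI[OF assms(1) i])
  qed
  then show "\<exists>c. AE x in lebesgue. x \<in> open_cube (\<epsilon> / 2) (\<epsilon> *\<^sub>R i) \<longrightarrow> v x = c" by blast
qed

text \<open>Finite energy forces the values \<open>\<plusminus>1\<close> only in \<open>\<Omega>\<close>; elsewhere \<open>u\<close> is arbitrary and only the
  averages converge to it.\<close>
definition recov :: "(real^'n) set \<Rightarrow> (real^'n \<Rightarrow> real) \<Rightarrow> real \<Rightarrow> real^'n \<Rightarrow> real" where
  "recov \<Omega> u \<epsilon> x = (if ctr \<epsilon> x \<in> (\<Union>y\<in>\<Omega>. ball y (real CARD('n) * \<epsilon>)) then rnd \<epsilon> (rext \<Omega> u) x else avg \<epsilon> u x)"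

lemma pred_near_domain [measurable]:
  "Measurable.pred borel (\<lambda>x::real^'n. ctr \<epsilon> x \<in> (\<Union>y\<in>\<Omega>. ball y (real CARD('n) * \<epsilon>)))"
proof -
  have [measurable]: "(\<Union>y\<in>\<Omega>. ball y (real CARD('n) * \<epsilon>)) \<in> sets (borel :: (real^'n) measure)"
    by (intro borel_open) auto
  show ?thesis by measurable
qed

lemma borel_measurable_recov [measurable]:
  assumes [measurable]: "\<Omega> \<in> sets borel" "u \<in> borel_measurable borel"
  shows "recov \<Omega> u \<epsilon> \<in> borel_measurable borel"
  unfolding recov_def
  by (rule measurable_If[OF _ _ pred_near_domain[unfolded pred_def]]) measurable

lemma abs_recov_le:
  fixes u :: "real^'n \<Rightarrow> real"
  assumes "u \<in> borel_measurable borel" "\<And>x. \<bar>u x\<bar> \<le> 1" "0 < \<epsilon>"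
  shows "\<bar>recov \<Omega> u \<epsilon> x\<bar> \<le> 1"
  using abs_avg_le[OF assms] rnd_values[of \<epsilon> "rext \<Omega> u" x] by (auto simp: recov_def)

text \<open>The case distinction in \<open>recov\<close> is made at the centre, so it is constant on
  cells. Every point is closer than \<open>d * \<epsilon>\<close> to its centre, so no cell meeting
  \<open>\<Omega>\<close> is left to the averages.\<close>

lemma recov_in_domain:
  fixes x :: "real^'n"
  assumes "0 < \<epsilon>" "x \<in> \<Omega>"
  shows "recov \<Omega> u \<epsilon> x = rnd \<epsilon> (rext \<Omega> u) x"
  using dist_ctr_less[OF assms(1), of x] assms(2) by (auto simp: recov_def dist_commute)

lemma recov_Xeps:
  fixes u :: "real^'n \<Rightarrow> real"
  assumes "\<Omega> \<in> sets borel" "u \<in> borel_measurable borel" "\<And>x. \<bar>u x\<bar> \<le> 1" "0 < \<epsilon>"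
  shows "recov \<Omega> u \<epsilon> \<in> Xeps \<epsilon>"
proof (rule Xeps_cellI)
  fix x y :: "real^'n" assume "ctr \<epsilon> x = ctr \<epsilon> y"
  then show "recov \<Omega> u \<epsilon> x = recov \<Omega> u \<epsilon> y"
    using rnd_cong[of \<epsilon> x y "rext \<Omega> u"] avg_cong[of \<epsilon> x y u] by (simp add: recov_def)
qed (use assms abs_recov_le[OF assms(2-4)] in auto)

text \<open>Three regions: in \<open>\<Omega>\<close> rounding at most doubles the error of the
  average, far outside \<open>recov\<close> is the average of \<open>u\<close>, and in the layer
  between, where the difference is at most \<open>2\<close>, the measure tends to zero because the
  layer shrinks to a subset of the frontier.\<close>

lemma recov_L1loc_tendsto:
  fixes u :: "real^'n \<Rightarrow> real"
  assumes \<Omega>: "open \<Omega>" and fr: "frontier \<Omega> \<in> null_sets lborel"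
    and u [measurable]: "u \<in> borel_measurable borel" and b: "\<And>x. \<bar>u x\<bar> \<le> 1"
    and pm: "AE x in lborel. x \<in> \<Omega> \<longrightarrow> u x = 1 \<or> u x = -1"
    and e: "\<And>n. 0 < e n" "e \<longlonglongrightarrow> 0"
  shows "(\<lambda>n. \<integral>\<^sup>+x. indicator (cball 0 \<rho>) x * ennreal \<bar>recov \<Omega> u (e n) x - u x\<bar> \<partial>lborel) \<longlonglongrightarrow> 0"
proof -
  have \<Omega>m [measurable]: "\<Omega> \<in> sets borel" using \<Omega> by simp
  let ?B = "cball 0 \<rho> :: (real^'n) set" and ?r = "rext \<Omega> u" and ?d = "real CARD('n)"
  \<comment> \<open>The layer: points outside \<open>\<Omega>\<close> that still receive the
    majority value. All of them are within \<open>2 * d * e n\<close> of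
    \<open>\<Omega>\<close>.\<close>
  let ?N = "\<lambda>n. {x. x \<notin> \<Omega> \<and> ctr (e n) x \<in> (\<Union>y\<in>\<Omega>. ball y (?d * e n))}"
  let ?I1 = "\<lambda>n. \<integral>\<^sup>+x. indicator ?B x * ennreal \<bar>avg (e n) ?r x - ?r x\<bar> \<partial>lborel"
  let ?I2 = "\<lambda>n. \<integral>\<^sup>+x. indicator ?B x * ennreal \<bar>avg (e n) u x - u x\<bar> \<partial>lborel"
  let ?I3 = "\<lambda>n. \<integral>\<^sup>+x. indicator ?B x * indicator (?N n) x \<partial>lborel"
  have Nm [measurable]: "?N n \<in> sets borel" for n by measurable
  have rb: "\<bar>?r x\<bar> \<le> 1" for x using rext_values[of \<Omega> u x] by auto
  have 1: "?I1 \<longlonglongrightarrow> 0" by (rule avg_L1loc_tendsto[OF _ rb e]) measurable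
  have 2: "?I2 \<longlonglongrightarrow> 0" by (rule avg_L1loc_tendsto[OF u b e])
  have 3: "?I3 \<longlonglongrightarrow> 0"
  proof -
    have "?I3 \<longlonglongrightarrow> (\<integral>\<^sup>+(x::real^'n). 0 \<partial>lborel)"
    proof (rule nn_integral_dominated_convergence[where w = "indicator ?B"])
      show "(\<integral>\<^sup>+x. indicator ?B x \<partial>lborel) < \<infinity>"
        using emeasure_lborel_cball_finite[of "0::real^'n" \<rho>] by simp
      show "AE x in lborel. indicator ?B x * indicator (?N j) x \<le> (indicator ?B x :: ennreal)" for j
        by (auto simp: indicator_def)
      show "AE x in lborel. (\<lambda>n. indicator ?B x * indicator (?N n) x :: ennreal) \<longlonglongrightarrow> 0"
        using AE_not_in[OF fr]
      proof eventually_elim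
        case (elim x)
        have "eventually (\<lambda>n. x \<notin> ?N n) sequentially"
        proof (cases "x \<in> \<Omega>")
          case False
          then have "x \<notin> closure \<Omega>" using elim \<Omega> by (simp add: frontier_def interior_open)
          then obtain t where t: "0 < t" "\<And>y. y \<in> \<Omega> \<Longrightarrow> t \<le> dist y x"
            unfolding closure_approachable by (auto simp: not_less)
          have d0: "0 < ?d" using real_card_ge_1[where 'n='n] by linarith
          have "eventually (\<lambda>n. e n < t / (2 * ?d)) sequentially"
            using e(2) t(1) d0 by (intro order_tendstoD) auto
          then show ?thesis
          proof eventually_elim
            case (elim n)
            then have small: "2 * ?d * e n < t" using d0 by (simp add: field_simps)
            show ?case
            proof
              assume "x \<in> ?N n"
              then obtain y where y: "y \<in> \<Omega>" "dist y (ctr (e n) x) < ?d * e n" by auto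
              have "dist y x \<le> dist y (ctr (e n) x) + dist (ctr (e n) x) x" by (rule dist_triangle)
              then show False using y(2) dist_ctr_less[OF e(1), of n x] small t(2)[OF y(1)] by linarith
            qed
          qed
        qed simp
        then have "eventually (\<lambda>n. indicator ?B x * indicator (?N n) x = (0::ennreal)) sequentially"
          by eventually_elim (simp add: indicator_def)
        then show ?case by (rule tendsto_eventually)
      qed
    qed measurable
    then show ?thesis by simp
  qed
  have "(\<lambda>n. 2 * ?I1 n + ?I2 n + 2 * ?I3 n) \<longlonglongrightarrow> 2 * 0 + 0 + 2 * 0"
    by (intro tendsto_add ennreal_tendsto_cmult 1 2 3) auto
  then have lim: "(\<lambda>n. 2 * ?I1 n + ?I2 n + 2 * ?I3 n) \<longlonglongrightarrow> 0" by simp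
  show ?thesis
  proof (rule tendsto_sandwich[OF _ _ tendsto_const lim])
    show "eventually (\<lambda>n. (\<integral>\<^sup>+x. indicator ?B x * ennreal \<bar>recov \<Omega> u (e n) x - u x\<bar> \<partial>lborel)
      \<le> 2 * ?I1 n + ?I2 n + 2 * ?I3 n) sequentially"
    proof (intro always_eventually allI)
      fix n
      have "(\<integral>\<^sup>+x. indicator ?B x * ennreal \<bar>recov \<Omega> u (e n) x - u x\<bar> \<partial>lborel)
        \<le> (\<integral>\<^sup>+x. 2 * (indicator ?B x * ennreal \<bar>avg (e n) ?r x - ?r x\<bar>)
            + indicator ?B x * ennreal \<bar>avg (e n) u x - u x\<bar> + 2 * (indicator ?B x * indicator (?N n) x) \<partial>lborel)"
      proof (rule nn_integral_mono_AE)
        show "AE x in lborel. indicator ?B x * ennreal \<bar>recov \<Omega> u (e n) x - u x\<bar>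
          \<le> 2 * (indicator ?B x * ennreal \<bar>avg (e n) ?r x - ?r x\<bar>)
            + indicator ?B x * ennreal \<bar>avg (e n) u x - u x\<bar> + 2 * (indicator ?B x * indicator (?N n) x)"
          using AE_rext_eq[OF pm]
        proof eventually_elim
          case (elim x)
          show ?case
          proof (cases "x \<in> ?B")
            case B: True
            consider "x \<in> \<Omega>" | "x \<in> ?N n" | "x \<notin> \<Omega>" "x \<notin> ?N n" by blast
            then show ?thesis
            proof cases
              case 1
              \<comment> \<open>A wrong rounding costs \<open>2\<close>, but then the average is on
                the wrong side of \<open>0\<close> or equal to it, so it is already off by at least
                \<open>1\<close>.\<close>
              have "\<bar>recov \<Omega> u (e n) x - u x\<bar> \<le> 2 * \<bar>avg (e n) ?r x - ?r x\<bar>"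
                using elim 1 rext_values[of \<Omega> u x] by (auto simp: recov_in_domain[OF e(1) 1] rnd_def)
              then have "ennreal \<bar>recov \<Omega> u (e n) x - u x\<bar> \<le> ennreal (2 * \<bar>avg (e n) ?r x - ?r x\<bar>)"
                by (rule ennreal_leI)
              then show ?thesis using B by (simp add: ennreal_mult add_increasing2)
            next
              case 2
              have "\<bar>recov \<Omega> u (e n) x - u x\<bar> \<le> 2"
                using abs_recov_le[OF u b e(1), of \<Omega> n x] b[of x] by linarith
              then have "ennreal \<bar>recov \<Omega> u (e n) x - u x\<bar> \<le> ennreal 2" by (rule ennreal_leI)
              then show ?thesis using B 2 by (simp add: add_increasing)
            next
              case 3
              then have "recov \<Omega> u (e n) x = avg (e n) u x" by (auto simp: recov_def)
              then show ?thesis using B by (simp add: add_increasing add_increasing2)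
            qed
          qed simp
        qed
      qed
      also have "\<dots> = 2 * ?I1 n + ?I2 n + 2 * ?I3 n"
      proof -
        have m: "(\<lambda>x. indicator ?B x * ennreal \<bar>avg (e n) ?r x - ?r x\<bar>) \<in> borel_measurable lborel"
          "(\<lambda>x. indicator ?B x * ennreal \<bar>avg (e n) u x - u x\<bar>) \<in> borel_measurable lborel" by measurable
        have "(\<lambda>x. indicator ?B x * indicator (?N n) x :: ennreal) \<in> borel_measurable lborel"
          using Nm[of n] by (intro borel_measurable_times_ennreal borel_measurable_indicator) auto
        with m show ?thesis
          by (simp only: nn_integral_add nn_integral_cmult borel_measurable_add borel_measurable_times_ennreal borel_measurable_const)
      qed
      finally show "(\<integral>\<^sup>+x. indicator ?B x * ennreal \<bar>recov \<Omega> u (e n) x - u x\<bar> \<partial>lborel)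
        \<le> 2 * ?I1 n + ?I2 n + 2 * ?I3 n" .
    qed
  qed simp
qed

lemma borel_measurable_seminorm_integrand:
  fixes v :: "real^'n \<Rightarrow> real"
  assumes [measurable]: "v \<in> borel_measurable borel"
  shows "(\<lambda>z. indicator {z. l1norm (fst z - snd z) < t} z * ennreal (\<bar>v (fst z) - v (snd z)\<bar> * wker s (fst z - snd z)))
    \<in> borel_measurable borel"
proof -
  have "(\<lambda>z. indicator {z. l1norm (fst z - snd z) < t} z * ennreal (\<bar>v (fst z) - v (snd z)\<bar> * wker s (fst z - snd z)))
    \<in> borel_measurable (borel \<Otimes>\<^sub>M borel)"
    by measurable
  then show ?thesis by (simp add: borel_prod)
qed

text \<open>Dominated convergence with the full integrand as majorant: the strips shrink to the
  diagonal, where the jump vanishes.\<close>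

lemma seminorm_near_tendsto_0:
  fixes v :: "real^'n \<Rightarrow> real"
  assumes v [measurable]: "v \<in> borel_measurable borel" and fin: "seminorm_on s v UNIV < \<infinity>"
  shows "(\<lambda>k. seminorm_on s v {z. l1norm (fst z - snd z) < 1 / real (Suc k)}) \<longlonglongrightarrow> 0"
proof -
  let ?g = "\<lambda>z. ennreal (\<bar>v (fst z) - v (snd z)\<bar> * wker s (fst z - snd z))"
  have "?g \<in> borel_measurable (borel \<Otimes>\<^sub>M borel)" by measurable
  then have gm: "?g \<in> borel_measurable borel" by (simp add: borel_prod)
  have "(\<lambda>k. \<integral>\<^sup>+z. indicator {z. l1norm (fst z - snd z) < 1 / real (Suc k)} z * ?g z \<partial>lborel)
    \<longlonglongrightarrow> (\<integral>\<^sup>+(z::(real^'n) \<times> (real^'n)). 0 \<partial>lborel)"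
  proof (rule nn_integral_dominated_convergence[where w = ?g])
    show "(\<integral>\<^sup>+z. ?g z \<partial>lborel) < \<infinity>" using fin by (simp add: seminorm_on_def)
    show "AE z in lborel. indicator {z. l1norm (fst z - snd z) < 1 / real (Suc j)} z * ?g z \<le> ?g z" for j
      by (intro AE_I2) (auto simp: indicator_def)
    show "AE z in lborel. (\<lambda>k. indicator {z. l1norm (fst z - snd z) < 1 / real (Suc k)} z * ?g z) \<longlonglongrightarrow> 0"
    proof (intro AE_I2)
      fix z :: "(real^'n) \<times> (real^'n)"
      show "(\<lambda>k. indicator {z. l1norm (fst z - snd z) < 1 / real (Suc k)} z * ?g z) \<longlonglongrightarrow> 0"
      proof (cases "fst z = snd z")
        case False
        then have "0 < l1norm (fst z - snd z)"
          using l1norm_nonneg[of "fst z - snd z"] by (simp add: less_le del: l1norm_nonneg)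
        then have "eventually (\<lambda>k. 1 / real (Suc k) < l1norm (fst z - snd z)) sequentially"
          by (intro order_tendstoD(2)[OF LIMSEQ_Suc[OF lim_1_over_n]])
        then have "eventually (\<lambda>k. indicator {z. l1norm (fst z - snd z) < 1 / real (Suc k)} z * ?g z = 0) sequentially"
          by eventually_elim (simp add: indicator_def)
        then show ?thesis by (rule tendsto_eventually)
      qed simp
    qed
  qed (use gm borel_measurable_seminorm_integrand[OF v] in auto)
  then show ?thesis by (simp add: seminorm_on_def)
qed

text \<open>The energy domain is cut into the pairs of \<open>\<Omega> \<times> \<Omega>\<close>
  closer than \<open>\<delta>\<close> and the rest \<open>F\<close>. On \<open>F\<close> there is an
  integrable majorant. On the near part \<open>recov\<close> is the rounding of the extension
  \<open>r\<close>, and \<open>rnd_seminorm_near\<close> bounds its contribution by the small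
  seminorm of \<open>r\<close> on a wider strip.\<close>

lemma recov_energy_limsup:
  fixes u :: "real^'n \<Rightarrow> real"
  assumes s: "0 < s" "s < 1" and \<Omega>: "open \<Omega>" "bounded \<Omega>" and per: "perim s \<Omega> < \<infinity>"
    and K: "K \<in> borel_measurable borel" and lam: "0 < lam" "lam \<le> Lam"
    and Kl: "AE z in lborel. ennreal (lam * wker s (fst z - snd z)) \<le> K z"
    and Ku: "AE z in lborel. K z \<le> ennreal (Lam * wker s (fst z - snd z))"
    and u: "u \<in> borel_measurable borel" and b: "\<And>x. \<bar>u x\<bar> \<le> 1"
    and pm: "AE x in lborel. x \<in> \<Omega> \<longrightarrow> u x = 1 \<or> u x = -1"
    and fin: "energy K u (UNIV - (- \<Omega>) \<times> (- \<Omega>)) < \<infinity>"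
    and e: "\<And>n. 0 < e n" "e \<longlonglongrightarrow> 0"
    and lim: "AE x in lborel. (\<lambda>n. recov \<Omega> u (e n) x) \<longlonglongrightarrow> u x"
    and \<eta>: "0 < \<eta>"
  shows "eventually (\<lambda>n. energy K (recov \<Omega> u (e n)) (UNIV - (- \<Omega>) \<times> (- \<Omega>))
     \<le> energy K u (UNIV - (- \<Omega>) \<times> (- \<Omega>)) + ennreal \<eta>) sequentially"
proof -
  let ?D = "UNIV - (- \<Omega>) \<times> (- \<Omega>)" and ?d = "real CARD('n)"
  have \<Omega>m: "\<Omega> \<in> sets borel" using \<Omega> by simp
  have Dm: "?D \<in> sets borel" by (rule energy_domain_borel[OF \<Omega>(1)])
  define r where "r = rext \<Omega> u"
  define v where "v n = recov \<Omega> u (e n)" for n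
  have rm: "r \<in> borel_measurable borel" unfolding r_def using \<Omega>m u by (rule borel_measurable_rext)
  have rpm: "r y = 1 \<or> r y = -1" for y unfolding r_def by (rule rext_values)
  have vm: "v n \<in> borel_measurable borel" for n unfolding v_def using \<Omega>m u by (rule borel_measurable_recov)
  have vb: "\<bar>v n x\<bar> \<le> 1" for n x unfolding v_def by (rule abs_recov_le[OF u b e(1)])
  have v\<Omega>: "v n x = rnd (e n) r x" if "x \<in> \<Omega>" for n x
    unfolding v_def r_def by (rule recov_in_domain[OF e(1) that])
  have rfin: "seminorm_on s r UNIV < \<infinity>"
  proof -
    have "seminorm_on s r UNIV \<le> ennreal (1 / lam) * energy K u ?D + 4 * perim s \<Omega>"
      unfolding r_def by (rule rext_seminorm_le[OF \<Omega>(1) K u lam(1) Kl pm])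
    also have "\<dots> < \<infinity>" using fin per by (simp add: ennreal_mult_less_top)
    finally show ?thesis .
  qed
  obtain C where C: "0 \<le> C" "\<And>\<epsilon> \<delta> (v::real^'n \<Rightarrow> real). v \<in> borel_measurable borel \<Longrightarrow> (\<And>y. v y = 1 \<or> v y = -1) \<Longrightarrow> 0 < \<epsilon> \<Longrightarrow>
      seminorm_on s (rnd \<epsilon> v) {z. l1norm (fst z - snd z) < \<delta>}
      \<le> ennreal C * seminorm_on s v {z. l1norm (fst z - snd z) < \<delta> + 2 * ?d * \<epsilon>}"
    by (rule rnd_seminorm_near[OF s, where 'n='n]) blast
  have LC: "0 \<le> Lam * C" using lam C(1) by simp
  \<comment> \<open>Multiplied by \<open>Lam * C\<close> this bound is at most
    \<open>\<eta> / 2\<close>; the added \<open>1\<close> avoids division by zero.\<close>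
  obtain k where k: "seminorm_on s r {z. l1norm (fst z - snd z) < 1 / real (Suc k)} \<le> ennreal (\<eta> / 2 / (Lam * C + 1))"
  proof -
    have "eventually (\<lambda>k. seminorm_on s r {z. l1norm (fst z - snd z) < 1 / real (Suc k)}
       \<le> ennreal (\<eta> / 2 / (Lam * C + 1))) sequentially"
      using \<eta> LC by (intro tendsto_zero_ennrealD[OF seminorm_near_tendsto_0[OF rm rfin]]) simp
    then show thesis using that by (auto simp: eventually_sequentially)
  qed
  \<comment> \<open>Half the width just found, so that the strip widened by
    \<open>2 * d * e n\<close> still fits once \<open>e n\<close> is small.\<close>
  define \<delta> where "\<delta> = 1 / real (Suc k) / 2"
  have "2 * (x / 2) = x" for x :: real by simp
  then have \<delta>: "0 < \<delta>" "2 * \<delta> = 1 / real (Suc k)" unfolding \<delta>_def by (simp, blast)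
  let ?near = "{z::(real^'n) \<times> (real^'n). l1norm (fst z - snd z) < \<delta>}"
  define F where "F = ?D - (\<Omega> \<times> \<Omega> \<inter> ?near)"
  have nm: "?near \<in> sets borel"
  proof -
    have "(\<lambda>z::(real^'n) \<times> (real^'n). l1norm (fst z - snd z)) \<in> borel_measurable (borel \<Otimes>\<^sub>M borel)" by measurable
    then have [measurable]: "(\<lambda>z::(real^'n) \<times> (real^'n). l1norm (fst z - snd z)) \<in> borel_measurable borel"
      by (simp add: borel_prod)
    show ?thesis by measurable
  qed
  have OO: "\<Omega> \<times> \<Omega> \<in> sets borel" using \<Omega> by (intro borel_open open_Times)
  have Fm: "F \<in> sets borel" unfolding F_def using Dm nm OO by auto
  define c where "c = \<delta> powr - (?d + s)"
  \<comment> \<open>The jump is at most \<open>2\<close> and the kernel at most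
    \<open>Lam * wker\<close>. On \<open>F\<close> inside \<open>\<Omega> \<times> \<Omega>\<close>
    the points are at least \<open>\<delta>\<close> apart, so \<open>wker\<close> is at most
    \<open>c\<close> on a set of finite measure; the crossing pairs have finite total weight by
    \<open>per\<close>.\<close>
  define G where "G z = ennreal (2 * Lam) * (crossing s \<Omega> z + ennreal c * indicator (\<Omega> \<times> \<Omega>) z)" for z
  have Gm: "G \<in> borel_measurable borel"
    unfolding G_def using borel_measurable_crossing[OF \<Omega>m] OO by measurable
  have Gfin: "(\<integral>\<^sup>+z. G z \<partial>lborel) < \<infinity>"
  proof -
    have "(\<integral>\<^sup>+z. G z \<partial>lborel) = ennreal (2 * Lam) * (2 * perim s \<Omega> + ennreal c * emeasure lborel (\<Omega> \<times> \<Omega>))"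
      unfolding G_def using borel_measurable_crossing[OF \<Omega>m] OO
      by (subst nn_integral_cmult) (simp_all add: nn_integral_add nn_integral_crossing[OF \<Omega>m] nn_integral_cmult_indicator)
    moreover have "emeasure lborel (\<Omega> \<times> \<Omega>) < \<infinity>"
      using \<Omega>(2) by (intro emeasure_bounded_finite bounded_Times)
    ultimately show ?thesis using per by (simp add: ennreal_mult_less_top)
  qed
  have far: "(\<lambda>n. energy K (v n) F) \<longlonglongrightarrow> energy K u F"
    unfolding energy_def
  proof (rule nn_integral_dominated_convergence[OF _ _ _ _ Gfin])
    show "AE z in lborel. indicator F z * (ennreal \<bar>v j (fst z) - v j (snd z)\<bar> * K z) \<le> G z" for j
      using Ku
    proof eventually_elim
      case (elim z)
      show ?case
      proof (cases "z \<in> F")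
        case True
        have "\<bar>v j (fst z) - v j (snd z)\<bar> \<le> 2"
          using vb[of j "fst z"] vb[of j "snd z"] by linarith
        then have "ennreal \<bar>v j (fst z) - v j (snd z)\<bar> * K z \<le> ennreal 2 * ennreal (Lam * wker s (fst z - snd z))"
          by (intro mult_mono ennreal_leI elim) auto
        also have "\<dots> = ennreal (2 * Lam) * ennreal (wker s (fst z - snd z))"
          using lam by (simp add: ennreal_mult mult.assoc)
        also have "\<dots> \<le> G z"
          unfolding G_def
        proof (intro mult_left_mono)
          show "ennreal (wker s (fst z - snd z)) \<le> crossing s \<Omega> z + ennreal c * indicator (\<Omega> \<times> \<Omega>) z"
          proof (cases "z \<in> \<Omega> \<times> \<Omega>")
            case in\<Omega>: True
            then have "\<delta> \<le> l1norm (fst z - snd z)" using True by (auto simp: F_def not_less)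
            then have "wker s (fst z - snd z) \<le> c"
              unfolding wker_def c_def using \<delta>(1) s by (intro powr_mono2') auto
            then show ?thesis using in\<Omega> by (simp add: add_increasing ennreal_leI)
          next
            case False
            then have "z \<in> \<Omega> \<times> (- \<Omega>) \<or> z \<in> (- \<Omega>) \<times> \<Omega>" using True by (cases z) (auto simp: F_def)
            then show ?thesis by (auto simp: crossing_def)
          qed
        qed simp
        finally show ?thesis using True by simp
      qed simp
    qed
    show "AE z in lborel. (\<lambda>n. indicator F z * (ennreal \<bar>v n (fst z) - v n (snd z)\<bar> * K z))
       \<longlonglongrightarrow> indicator F z * (ennreal \<bar>u (fst z) - u (snd z)\<bar> * K z)"
      using Ku AE_lborel_fst[OF lim] AE_lborel_snd[OF lim]
    proof eventually_elim
      case (elim z)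
      have "K z < \<infinity>" using elim(1) by (auto intro: le_less_trans)
      then have "(\<lambda>n. indicator F z * (K z * ennreal \<bar>v n (fst z) - v n (snd z)\<bar>))
         \<longlonglongrightarrow> indicator F z * (K z * ennreal \<bar>u (fst z) - u (snd z)\<bar>)"
        using elim(2,3) unfolding v_def
        by (intro ennreal_tendsto_cmult tendsto_ennrealI tendsto_intros) (auto simp: indicator_def)
      then show ?case by (simp add: mult.commute)
    qed
  qed (use Gm borel_measurable_energy_integrand[OF K vm Fm] borel_measurable_energy_integrand[OF K u Fm] in auto)
  have uF: "energy K u F \<le> energy K u ?D"
    unfolding energy_def by (intro nn_integral_mono mult_right_mono) (auto simp: F_def indicator_def)
  \<comment> \<open>Strict because the energy is finite; a strict bound on the limit passes to large
    \<open>n\<close>.\<close>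
  have "energy K u F < energy K u ?D + ennreal (\<eta> / 2)"
  proof -
    obtain a where a: "energy K u ?D = ennreal a" "0 \<le> a" using fin by (cases "energy K u ?D") auto
    have "ennreal a < ennreal (a + \<eta> / 2)" using \<eta> a(2) by (simp add: ennreal_less_iff)
    then show ?thesis using uF a \<eta> by (simp add: le_less_trans)
  qed
  from order_tendstoD(2)[OF far this]
  have evF: "eventually (\<lambda>n. energy K (v n) F < energy K u ?D + ennreal (\<eta> / 2)) sequentially" .
  have d0: "0 < ?d" using real_card_ge_1[where 'n='n] by linarith
  have "eventually (\<lambda>n. e n < \<delta> / (2 * ?d)) sequentially"
    using e(2) \<delta>(1) d0 by (intro order_tendstoD) auto
  then have "eventually (\<lambda>n. energy K (v n) ?D \<le> energy K u ?D + ennreal \<eta>) sequentially"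
    using evF
  proof eventually_elim
    case (elim n)
    then have small: "2 * ?d * e n < \<delta>" using d0 by (simp add: field_simps)
    have "energy K (v n) ?D \<le> (\<integral>\<^sup>+z. indicator F z * (ennreal \<bar>v n (fst z) - v n (snd z)\<bar> * K z)
       + ennreal Lam * (indicator ?near z * ennreal (\<bar>rnd (e n) r (fst z) - rnd (e n) r (snd z)\<bar> * wker s (fst z - snd z))) \<partial>lborel)"
      unfolding energy_def
    proof (rule nn_integral_mono_AE)
      show "AE z in lborel. indicator ?D z * (ennreal \<bar>v n (fst z) - v n (snd z)\<bar> * K z)
        \<le> indicator F z * (ennreal \<bar>v n (fst z) - v n (snd z)\<bar> * K z)
          + ennreal Lam * (indicator ?near z * ennreal (\<bar>rnd (e n) r (fst z) - rnd (e n) r (snd z)\<bar> * wker s (fst z - snd z)))"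
        using Ku
      proof eventually_elim
        case (elim z)
        show ?case
        proof (cases "z \<in> \<Omega> \<times> \<Omega> \<inter> ?near")
          case True
          then have *: "fst z \<in> \<Omega>" "snd z \<in> \<Omega>" "z \<in> ?near" "z \<notin> F" "z \<in> ?D" by (auto simp: F_def)
          have "ennreal \<bar>v n (fst z) - v n (snd z)\<bar> * K z
            \<le> ennreal \<bar>v n (fst z) - v n (snd z)\<bar> * ennreal (Lam * wker s (fst z - snd z))"
            by (intro mult_left_mono elim) simp
          also have "\<dots> = ennreal Lam * ennreal (\<bar>rnd (e n) r (fst z) - rnd (e n) r (snd z)\<bar> * wker s (fst z - snd z))"
            using lam by (simp add: v\<Omega>[OF *(1)] v\<Omega>[OF *(2)] ennreal_mult mult_ac)
          finally show ?thesis using * by simp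
        next
          case False
          then have "indicator ?D z = (indicator F z :: ennreal)" by (auto simp: F_def indicator_def)
          then show ?thesis by (simp add: add_increasing2)
        qed
      qed
    qed
    also have "\<dots> = energy K (v n) F + ennreal Lam * seminorm_on s (rnd (e n) r) ?near"
      unfolding energy_def seminorm_on_def
      using borel_measurable_energy_integrand[OF K vm[of n] Fm]
        borel_measurable_seminorm_integrand[OF borel_measurable_rnd[OF rm], of \<delta> "e n" s]
      by (subst nn_integral_add) (simp_all add: nn_integral_cmult)
    also have "\<dots> \<le> (energy K u ?D + ennreal (\<eta> / 2)) + ennreal (\<eta> / 2)"
    proof (intro add_mono)
      show "energy K (v n) F \<le> energy K u ?D + ennreal (\<eta> / 2)" using elim(2) by simp
      have "seminorm_on s (rnd (e n) r) ?near
        \<le> ennreal C * seminorm_on s r {z. l1norm (fst z - snd z) < \<delta> + 2 * ?d * e n}"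
        by (rule C(2)[OF rm rpm e(1)])
      also have "seminorm_on s r {z. l1norm (fst z - snd z) < \<delta> + 2 * ?d * e n}
        \<le> seminorm_on s r {z. l1norm (fst z - snd z) < 1 / real (Suc k)}"
        unfolding seminorm_on_def \<delta>(2)[symmetric]
        by (intro nn_integral_mono mult_right_mono) (use small in \<open>auto simp: indicator_def\<close>)
      also note k
      finally have "seminorm_on s (rnd (e n) r) ?near \<le> ennreal C * ennreal (\<eta> / 2 / (Lam * C + 1))"
        by (simp add: mult_left_mono)
      then have "ennreal Lam * seminorm_on s (rnd (e n) r) ?near \<le> ennreal Lam * (ennreal C * ennreal (\<eta> / 2 / (Lam * C + 1)))"
        by (intro mult_left_mono) auto
      also have "\<dots> = ennreal (Lam * C * (\<eta> / 2 / (Lam * C + 1)))"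
        using lam C(1) \<eta> by (simp add: ennreal_mult[symmetric] mult.assoc)
      also have "\<dots> \<le> ennreal (\<eta> / 2)"
        using LC \<eta> by (intro ennreal_leI) (simp add: field_simps)
      finally show "ennreal Lam * seminorm_on s (rnd (e n) r) ?near \<le> ennreal (\<eta> / 2)" .
    qed
    also have "\<dots> = energy K u ?D + ennreal \<eta>"
      using \<eta> by (simp add: add.assoc ennreal_plus[symmetric] del: ennreal_plus)
    finally show ?case .
  qed
  then show ?thesis unfolding v_def .
qed

lemma gamma_limsup:
  fixes u :: "real^'n \<Rightarrow> real"
  assumes K: "kernel_hyp K s lam Lam" and \<Omega>: "open \<Omega>" "bounded \<Omega>" "lipschitz_boundary \<Omega>" and u: "u \<in> Xsp"
  shows "\<exists>ue. (\<forall>eps>0. ue eps \<in> Xeps eps) \<and> L1loc_tendsto ue u (at_right 0) \<and>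
    Limsup (at_right 0) (\<lambda>eps. GKeps eps K \<Omega> (ue eps)) \<le> GK K \<Omega> u"
proof -
  have s: "0 < s" "s < 1" and lam: "0 < lam" "lam \<le> Lam" using K by (simp_all add: kernel_hyp_def)
  have \<Omega>m: "\<Omega> \<in> sets borel" using \<Omega> by simp
  show ?thesis
  proof (cases "GK K \<Omega> u < \<infinity>")
    case False
    obtain u0 where u0: "u0 \<in> borel_measurable borel" "\<And>x. \<bar>u0 x\<bar> \<le> 1" "AE x in lborel. u x = u0 x"
      by (rule Xsp_borel_representative[OF u]) blast
    \<comment> \<open>With infinite energy at \<open>u\<close> only the convergence has to be
      achieved, and plain averages do that.\<close>
    have "\<forall>eps>0. avg eps u0 \<in> Xeps eps"
      using u0(1,2) by (auto intro!: Xeps_cellI abs_avg_le avg_cong)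
    moreover have "L1loc_tendsto (\<lambda>eps. avg eps u0) u (at_right 0)"
      by (rule L1loc_tendsto_at_rightI[OF avg_L1loc_tendsto[OF u0(1,2)] u0(3)])
    moreover have "GK K \<Omega> u = \<infinity>" using False by (simp add: not_less top_unique)
    ultimately show ?thesis by (intro exI[of _ "\<lambda>eps. avg eps u0"]) simp
  next
    case True
    let ?D = "UNIV - (- \<Omega>) \<times> (- \<Omega>)"
    obtain K0 where K0: "K0 \<in> borel_measurable borel" "AE z in lborel. K z = K0 z"
      "AE z in lborel. ennreal (lam * wker s (fst z - snd z)) \<le> K0 z"
      "AE z in lborel. K0 z \<le> ennreal (Lam * wker s (fst z - snd z))"
      by (rule kernel_borel_representative[OF K]) blast
    obtain u0 where u0: "u0 \<in> borel_measurable borel" "\<And>x. \<bar>u0 x\<bar> \<le> 1" "AE x in lborel. u x = u0 x"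
      and pm: "AE x in lborel. x \<in> \<Omega> \<longrightarrow> u0 x = 1 \<or> u0 x = -1"
      by (rule GK_finite_representative[OF order_refl True K0(2)]) blast
    have GKu: "GK K \<Omega> u = energy K0 u0 ?D" by (rule GK_eq_energy[OF u0(1) u u0(3) pm K0(2) \<Omega>m])
    have fr: "frontier \<Omega> \<in> null_sets lborel"
      by (rule lipschitz_boundary_translation[OF \<Omega>(3,1,2)]) blast
    have per: "perim s \<Omega> < \<infinity>"
      unfolding perim_def by (rule lipschitz_boundary_finite_wker_perimeter[OF \<Omega>(3,1,2) s])
    let ?ue = "recov \<Omega> u0"
    note L1 = recov_L1loc_tendsto[OF \<Omega>(1) fr u0(1,2) pm]
    have X: "?ue eps \<in> Xeps eps" if "0 < eps" for eps by (rule recov_Xeps[OF \<Omega>m u0(1,2) that])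
    have Geps: "GKeps eps K \<Omega> (?ue eps) = energy K0 (?ue eps) ?D" if "0 < eps" for eps
    proof -
      have "GK K \<Omega> (?ue eps) = energy K0 (?ue eps) ?D"
      proof (rule GK_eq_energy[OF _ _ _ _ K0(2) \<Omega>m])
        show "?ue eps \<in> borel_measurable borel" using \<Omega>m u0(1) by (rule borel_measurable_recov)
        show "?ue eps \<in> Xsp" using X[OF that] by (simp add: Xeps_def)
        show "AE x in lborel. x \<in> \<Omega> \<longrightarrow> ?ue eps x = 1 \<or> ?ue eps x = -1"
          by (intro AE_I2) (simp add: recov_in_domain[OF that] rnd_def)
      qed simp
      then show ?thesis using X[OF that] by (simp add: GKeps_def)
    qed
    have "Limsup (at_right 0) (\<lambda>eps. GKeps eps K \<Omega> (?ue eps)) \<le> GK K \<Omega> u"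
      unfolding Limsup_le_iff
    proof (intro allI impI, rule eventually_at_right_0_seqI)
      fix y and e :: "nat \<Rightarrow> real"
      assume y: "y > GK K \<Omega> u" and e: "\<And>n. 0 < e n" "e \<longlonglongrightarrow> 0"
        and "\<And>n. \<not> GKeps (e n) K \<Omega> (?ue (e n)) < y"
      then have ge: "y \<le> energy K0 (?ue (e n)) ?D" for n using Geps[OF e(1)] by (simp add: not_less)
      obtain q where q: "strict_mono q" "AE x in lborel. (\<lambda>k. ?ue (e (q k)) x) \<longlonglongrightarrow> u0 x"
        by (rule L1loc_AE_subseq[OF borel_measurable_recov[OF \<Omega>m u0(1)] u0(1) L1[OF e]]) blast
      \<comment> \<open>\<open>y\<close> may be infinite; the intermediate \<open>c\<close> is
        finite, and its distance to the energy of \<open>u\<close> serves as the error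
        \<open>\<eta>\<close>.\<close>
      obtain c where c: "GK K \<Omega> u < c" "c < y" using dense[OF y] by blast
      obtain a where a: "GK K \<Omega> u = ennreal a" "0 \<le> a" using True by (cases "GK K \<Omega> u") auto
      obtain c' where c': "c = ennreal c'" "0 \<le> c'" using c(2) by (cases c) auto
      have ac: "a < c'" using c(1) a c' by (simp add: ennreal_less_iff)
      have "eventually (\<lambda>n. energy K0 (?ue ((e \<circ> q) n)) ?D \<le> energy K0 u0 ?D + ennreal (c' - a)) sequentially"
      proof (rule recov_energy_limsup[OF s \<Omega>(1,2) per K0(1) lam K0(3,4) u0(1,2) pm])
        show "energy K0 u0 ?D < \<infinity>" using True GKu by simp
        show "(e \<circ> q) \<longlonglongrightarrow> 0" using e(2) q(1) by (rule LIMSEQ_subseq_LIMSEQ)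
      qed (use e(1) q(2) ac in auto)
      then obtain n where "energy K0 (?ue (e (q n))) ?D \<le> ennreal a + ennreal (c' - a)"
        using GKu a by (auto simp: eventually_sequentially)
      also have "\<dots> = c" using ac a c' by (simp add: ennreal_plus[symmetric] del: ennreal_plus)
      finally show False using ge[of "q n"] c(2) by simp
    qed
    moreover have "L1loc_tendsto ?ue u (at_right 0)"
      by (rule L1loc_tendsto_at_rightI[OF L1 u0(3)])
    ultimately show ?thesis using X by (intro exI[of _ ?ue]) auto
  qed
qed

section \<open>Compactness\<close>

lemma countable_int_lattice: "countable (int_lattice :: (real^'n) set)"
proof -
  have "int_lattice \<subseteq> range (\<lambda>z::int^'n. (\<chi> i. real_of_int (z $ i)))"
  proof
    fix x :: "real^'n" assume "x \<in> int_lattice"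
    then have "x $ i = real_of_int \<lfloor>x $ i\<rfloor>" for i by (auto simp: int_lattice_def elim: Ints_cases)
    then have "x = (\<chi> i. real_of_int ((\<chi> i. \<lfloor>x $ i\<rfloor>) $ i))" by (simp add: vec_eq_iff)
    then show "x \<in> range (\<lambda>z::int^'n. (\<chi> i. real_of_int (z $ i)))" by blast
  qed
  then show ?thesis by (rule countable_subset) simp
qed

lemma summable_increments_convergent:
  fixes f :: "nat \<Rightarrow> real"
  assumes "summable (\<lambda>n. \<bar>f (Suc n) - f n\<bar>)"
  shows "convergent f"
proof -
  have "summable (\<lambda>n. f (Suc n) - f n)" using assms by (rule summable_rabs_cancel)
  then have "convergent (\<lambda>n. \<Sum>k<n. f (Suc k) - f k)" by (simp add: summable_iff_convergent)
  then have "convergent (\<lambda>n. f n - f 0)" by (simp add: sum_lessThan_telescope)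
  then have "convergent (\<lambda>n. (f n - f 0) + f 0)" by (intro convergent_add convergent_const)
  then show ?thesis by simp
qed

text \<open>By \<open>avg_L1_error\<close> each function is close to its averages at a fine scale,
  uniformly in \<open>n\<close>. At a fixed scale the averages converge pointwise and boundedly,
  hence in mean on the ball. So the functions are Cauchy in mean there, and a subsequence with
  summable increments converges almost everywhere.\<close>

lemma seminorm_compactness:
  fixes v :: "nat \<Rightarrow> real^'n \<Rightarrow> real"
  assumes s: "0 < s" and vm [measurable]: "\<And>n. v n \<in> borel_measurable borel" and b: "\<And>n x. \<bar>v n x\<bar> \<le> 1"
    and B: "\<And>n. seminorm_on s (v n) UNIV \<le> ennreal M" and M: "0 \<le> M"
  obtains r where "strict_mono r" "AE x in lborel. x \<in> cball 0 \<rho> \<longrightarrow> convergent (\<lambda>k. v (r k) x)"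
proof -
  let ?B = "cball 0 \<rho> :: (real^'n) set"
  define \<epsilon> :: "nat \<Rightarrow> real" where "\<epsilon> j = 1 / real (Suc j)" for j
  have \<epsilon>: "0 < \<epsilon> j" for j by (simp add: \<epsilon>_def)
  \<comment> \<open>One representative point per cell, for all scales at once: a countable index
    set, so a diagonal subsequence makes every average converge.\<close>
  define f where "f n p = avg (\<epsilon> (fst p)) (v n) (\<epsilon> (fst p) *\<^sub>R snd p)" for n and p :: "nat \<times> (real^'n)"
  have "countable (UNIV \<times> int_lattice :: (nat \<times> (real^'n)) set)"
    by (intro countable_SIGMA countable_int_lattice) auto
  moreover have "norm (f n p) \<le> 1" for n p
    unfolding f_def real_norm_def by (rule abs_avg_le[OF vm b \<epsilon>])
  ultimately obtain k where k: "strict_mono k"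
    and kl: "\<And>p. p \<in> UNIV \<times> int_lattice \<Longrightarrow> \<exists>l. (\<lambda>n. f (k n) p) \<longlonglongrightarrow> l"
    using function_convergent_subsequence[of "UNIV \<times> int_lattice" f 1] by metis
  define V where "V n = v (k n)" for n
  have Vm [measurable]: "V n \<in> borel_measurable borel" for n by (simp add: V_def)
  have Vb: "\<bar>V n x\<bar> \<le> 1" for n x by (simp add: V_def b)
  have conv: "convergent (\<lambda>n. avg (\<epsilon> j) (V n) x)" for j x
  proof -
    obtain i where i: "i \<in> int_lattice" "ctr (\<epsilon> j) x = \<epsilon> j *\<^sub>R i" by (rule ctr_lattice)
    have "avg (\<epsilon> j) (V n) x = f (k n) (j, i)" for n
      unfolding f_def V_def fst_conv snd_conv by (rule avg_cong) (simp add: i ctr_scaled_lattice[OF \<epsilon>])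
    then show ?thesis using kl[of "(j, i)"] i(1) by (simp add: convergent_def)
  qed
  define a where "a j x = lim (\<lambda>n. avg (\<epsilon> j) (V n) x)" for j x
  have al: "(\<lambda>n. avg (\<epsilon> j) (V n) x) \<longlonglongrightarrow> a j x" for j x
    unfolding a_def using conv by (simp add: convergent_LIMSEQ_iff)
  have am [measurable]: "a j \<in> borel_measurable borel" for j
    by (rule borel_measurable_LIMSEQ_real[OF al]) measurable
  define c where "c = real CARD('n) powr (real CARD('n) + s)"
  let ?dist = "\<lambda>g h. \<integral>\<^sup>+x. indicator ?B x * ennreal \<bar>g x - h x\<bar> \<partial>lborel"
  have err: "?dist (avg (\<epsilon> j) (V n)) (V n) \<le> ennreal (c * \<epsilon> j powr s * M)" for j n
  proof -
    have "?dist (avg (\<epsilon> j) (V n)) (V n) \<le> (\<integral>\<^sup>+x. ennreal \<bar>avg (\<epsilon> j) (V n) x - V n x\<bar> \<partial>lborel)"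
      by (intro nn_integral_mono) (auto simp: indicator_def)
    also have "\<dots> \<le> ennreal (c * \<epsilon> j powr s) * seminorm_on s (V n) UNIV"
      unfolding c_def by (rule avg_L1_error[OF Vm Vb \<epsilon> s])
    also have "\<dots> \<le> ennreal (c * \<epsilon> j powr s) * ennreal M"
      using B by (intro mult_left_mono) (auto simp: V_def)
    also have "\<dots> = ennreal (c * \<epsilon> j powr s * M)"
      using M by (simp add: c_def ennreal_mult)
    finally show ?thesis .
  qed
  have lima: "(\<lambda>n. ?dist (avg (\<epsilon> j) (V n)) (a j)) \<longlonglongrightarrow> 0" for j
  proof -
    have "(\<lambda>n. ?dist (avg (\<epsilon> j) (V n)) (a j)) \<longlonglongrightarrow> (\<integral>\<^sup>+(x::real^'n). 0 \<partial>lborel)"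
    proof (rule nn_integral_dominated_convergence[where w = "\<lambda>x. 2 * indicator ?B x"])
      show "(\<integral>\<^sup>+x. 2 * indicator ?B x \<partial>lborel) < \<infinity>"
        using emeasure_lborel_cball_finite[of "0::real^'n" \<rho>]
        by (simp add: nn_integral_cmult_indicator ennreal_mult_less_top)
      have ab: "\<bar>a j x\<bar> \<le> 1" for x
        using LIMSEQ_le_const2[OF tendsto_rabs[OF al[of j x]], of 1] abs_avg_le[OF Vm Vb \<epsilon>] by blast
      have "\<bar>avg (\<epsilon> j) (V n) x - a j x\<bar> \<le> 2" for n x
        using ab[of x] abs_avg_le[OF Vm[of n] Vb \<epsilon>, of j x] by linarith
      then have "ennreal \<bar>avg (\<epsilon> j) (V n) x - a j x\<bar> \<le> ennreal 2" for n x by (intro ennreal_leI)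
      then show "AE x in lborel. indicator ?B x * ennreal \<bar>avg (\<epsilon> j) (V n) x - a j x\<bar> \<le> 2 * indicator ?B x" for n
        by (intro AE_I2) (auto simp: indicator_def)
      show "AE x in lborel. (\<lambda>n. indicator ?B x * ennreal \<bar>avg (\<epsilon> j) (V n) x - a j x\<bar>) \<longlonglongrightarrow> 0"
      proof (intro AE_I2)
        fix x
        have "(\<lambda>n. \<bar>avg (\<epsilon> j) (V n) x - a j x\<bar>) \<longlonglongrightarrow> 0"
          using al[of j x] by (intro tendsto_rabs_zero LIM_zero)
        then have "(\<lambda>n. indicator ?B x * ennreal \<bar>avg (\<epsilon> j) (V n) x - a j x\<bar>) \<longlonglongrightarrow> indicator ?B x * ennreal 0"
          by (intro ennreal_tendsto_cmult tendsto_ennrealI) (auto simp: indicator_def)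
        then show "(\<lambda>n. indicator ?B x * ennreal \<bar>avg (\<epsilon> j) (V n) x - a j x\<bar>) \<longlonglongrightarrow> 0" by simp
      qed
    qed measurable
    then show ?thesis by simp
  qed
  define P where "P q n \<longleftrightarrow> (\<forall>m\<ge>n. ?dist (V m) (V n) \<le> ennreal ((1/2) ^ q))" for q n
  have "eventually (P q) sequentially" for q
  proof -
    \<comment> \<open>Each of \<open>V m\<close> and \<open>V n\<close> is within
      \<open>2 * \<eta>\<close> of \<open>a j\<close>: one \<open>\<eta>\<close> for passing to the
      averages, one for their convergence.\<close>
    define \<eta> :: real where "\<eta> = (1/2) ^ q / 4"
    have \<eta>: "0 < \<eta>" by (simp add: \<eta>_def)
    have "\<epsilon> \<longlonglongrightarrow> 0" unfolding \<epsilon>_def by (rule LIMSEQ_Suc[OF lim_1_over_n])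
    then have "(\<lambda>j. c * \<epsilon> j powr s * M) \<longlonglongrightarrow> c * 0 * M"
      using \<epsilon> s by (intro tendsto_intros tendsto_zero_powrI[of _ _ _ s]) (auto intro!: always_eventually less_imp_le)
    then have "eventually (\<lambda>j. c * \<epsilon> j powr s * M < \<eta>) sequentially"
      using \<eta> by (intro order_tendstoD) auto
    then obtain j where j: "c * \<epsilon> j powr s * M < \<eta>" by (auto simp: eventually_sequentially)
    obtain N where N: "\<And>n. N \<le> n \<Longrightarrow> ?dist (avg (\<epsilon> j) (V n)) (a j) \<le> ennreal \<eta>"
      using tendsto_zero_ennrealD[OF lima \<eta>, of j] by (auto simp: eventually_sequentially)
    have near: "?dist (V n) (a j) \<le> ennreal (2 * \<eta>)" if "N \<le> n" for n
    proof -
      have "?dist (V n) (a j) \<le> (\<integral>\<^sup>+x. indicator ?B x * ennreal \<bar>avg (\<epsilon> j) (V n) x - V n x\<bar>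
          + indicator ?B x * ennreal \<bar>avg (\<epsilon> j) (V n) x - a j x\<bar> \<partial>lborel)"
        by (intro nn_integral_mono)
          (auto simp: indicator_def ennreal_plus[symmetric] intro!: ennreal_leI simp del: ennreal_plus)
      also have "\<dots> = ?dist (avg (\<epsilon> j) (V n)) (V n) + ?dist (avg (\<epsilon> j) (V n)) (a j)"
        by (rule nn_integral_add) measurable
      also have "\<dots> \<le> ennreal \<eta> + ennreal \<eta>"
        using j by (intro add_mono N that order_trans[OF err] ennreal_leI) simp
      also have "\<dots> = ennreal (2 * \<eta>)" using \<eta> by (simp add: ennreal_plus[symmetric] del: ennreal_plus)
      finally show ?thesis .
    qed
    have "P q n" if n: "N \<le> n" for n
      unfolding P_def
    proof (intro allI impI)
      fix m assume "n \<le> m"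
      then have m: "N \<le> m" using n by simp
      have "?dist (V m) (V n) \<le> (\<integral>\<^sup>+x. indicator ?B x * ennreal \<bar>V m x - a j x\<bar>
          + indicator ?B x * ennreal \<bar>V n x - a j x\<bar> \<partial>lborel)"
        by (intro nn_integral_mono)
          (auto simp: indicator_def ennreal_plus[symmetric] intro!: ennreal_leI simp del: ennreal_plus)
      also have "\<dots> = ?dist (V m) (a j) + ?dist (V n) (a j)"
        by (rule nn_integral_add) measurable
      also have "\<dots> \<le> ennreal (2 * \<eta>) + ennreal (2 * \<eta>)"
        by (intro add_mono near n m)
      also have "\<dots> = ennreal ((1/2) ^ q)"
        by (subst ennreal_plus[symmetric]) (simp_all add: \<eta>_def)
      finally show "?dist (V m) (V n) \<le> ennreal ((1/2) ^ q)" .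
    qed
    then show ?thesis by (auto simp: eventually_sequentially)
  qed
  then obtain r where r: "strict_mono r" "\<And>q. P q (r q)"
    by (rule strict_mono_choice[of P]) blast
  have "?dist (V (r (Suc q))) (V (r q)) \<le> ennreal ((1/2) ^ q)" for q
    using r(2)[of q] strict_monoD[OF r(1), of q "Suc q"] by (simp add: P_def)
  then have "AE x in lborel. (\<Sum>q. indicator ?B x * ennreal \<bar>V (r (Suc q)) x - V (r q) x\<bar>) \<noteq> \<infinity>"
    by (intro AE_suminf_finite) auto
  then have "AE x in lborel. x \<in> ?B \<longrightarrow> convergent (\<lambda>q. v ((k \<circ> r) q) x)"
  proof (eventually_elim, intro impI)
    fix x assume x: "(\<Sum>q. indicator ?B x * ennreal \<bar>V (r (Suc q)) x - V (r q) x\<bar>) \<noteq> \<infinity>" "x \<in> ?B"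
    then have "(\<Sum>q. ennreal \<bar>V (r (Suc q)) x - V (r q) x\<bar>) \<noteq> \<infinity>" by simp
    then have "summable (\<lambda>q. \<bar>V (r (Suc q)) x - V (r q) x\<bar>)"
      by (intro suminf_ennreal_finite_summable) auto
    then have "convergent (\<lambda>q. V (r q) x)" by (rule summable_increments_convergent)
    then show "convergent (\<lambda>q. v ((k \<circ> r) q) x)" by (simp add: V_def)
  qed
  with strict_mono_o[OF k r(1)] show thesis by (rule that)
qed

text \<open>The extensions by \<open>-1\<close> have uniformly bounded seminorm, since the perimeter
  term in \<open>rext_seminorm_le\<close> does not depend on \<open>n\<close>. They agree with
  \<open>un\<close> in \<open>\<Omega>\<close> up to null sets, so their limit there is the one
  sought.\<close>

lemma gamma_compactness:
  fixes un :: "nat \<Rightarrow> real^'n \<Rightarrow> real"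
  assumes K: "kernel_hyp K s lam Lam" and \<Omega>: "open \<Omega>" "bounded \<Omega>" "lipschitz_boundary \<Omega>"
    and un: "\<And>n. un n \<in> Xeps (e n)" and C: "\<And>n. GKeps (e n) K \<Omega> (un n) \<le> ennreal C"
  shows "\<exists>E r. E \<in> sets lebesgue \<and> E \<subseteq> \<Omega> \<and> strict_mono r \<and>
    (AE x in lebesgue. x \<in> \<Omega> \<longrightarrow> (\<lambda>k. un (r k) x) \<longlonglongrightarrow> indicator E x - indicator (- E) x)"
proof -
  have s: "0 < s" "s < 1" and lam: "0 < lam" "lam \<le> Lam" using K by (simp_all add: kernel_hyp_def)
  have \<Omega>m [measurable]: "\<Omega> \<in> sets borel" using \<Omega> by simp
  let ?D = "UNIV - (- \<Omega>) \<times> (- \<Omega>)"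
  have per: "perim s \<Omega> < \<infinity>"
    unfolding perim_def by (rule lipschitz_boundary_finite_wker_perimeter[OF \<Omega>(3,1,2) s])
  obtain K0 where K0: "K0 \<in> borel_measurable borel" "AE z in lborel. K z = K0 z"
    "AE z in lborel. ennreal (lam * wker s (fst z - snd z)) \<le> K0 z"
    by (rule kernel_borel_representative[OF K]) blast
  have le: "GK K \<Omega> (un n) \<le> ennreal C" for n using C[of n] un[of n] by (simp add: GKeps_def)
  have Cfin: "ennreal C < \<infinity>" by simp
  have "\<forall>n. \<exists>w. w \<in> borel_measurable borel \<and> (AE x in lborel. un n x = w x) \<and>
    (AE x in lborel. x \<in> \<Omega> \<longrightarrow> w x = 1 \<or> w x = -1) \<and> energy K0 w ?D \<le> ennreal C"
    by (intro allI, rule GK_finite_representative[OF le Cfin K0(2)]) blast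
  from choice[OF this]
  obtain w where w: "\<And>n. w n \<in> borel_measurable borel" "\<And>n. AE x in lborel. un n x = w n x"
    "\<And>n. AE x in lborel. x \<in> \<Omega> \<longrightarrow> w n x = 1 \<or> w n x = -1" "\<And>n. energy K0 (w n) ?D \<le> ennreal C"
    by auto
  define v where "v n = rext \<Omega> (w n)" for n
  have vm [measurable]: "v n \<in> borel_measurable borel" for n
    unfolding v_def using \<Omega>m w(1) by (rule borel_measurable_rext)
  have vpm: "v n x = 1 \<or> v n x = -1" for n x unfolding v_def by (rule rext_values)
  have "ennreal (1 / lam) * ennreal C + 4 * perim s \<Omega> < \<infinity>"
    using per by (simp add: ennreal_mult_less_top)
  then obtain M where M: "ennreal (1 / lam) * ennreal C + 4 * perim s \<Omega> = ennreal M" "0 \<le> M"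
    by (cases "ennreal (1 / lam) * ennreal C + 4 * perim s \<Omega>") auto
  have B: "seminorm_on s (v n) UNIV \<le> ennreal M" for n
  proof -
    have "seminorm_on s (v n) UNIV \<le> ennreal (1 / lam) * energy K0 (w n) ?D + 4 * perim s \<Omega>"
      unfolding v_def by (rule rext_seminorm_le[OF \<Omega>(1) K0(1) w(1) lam(1) K0(3) w(3)])
    also have "\<dots> \<le> ennreal (1 / lam) * ennreal C + 4 * perim s \<Omega>"
      by (intro add_right_mono mult_left_mono w(4)) simp
    finally show ?thesis by (simp add: M)
  qed
  have vb: "\<bar>v n x\<bar> \<le> 1" for n x using vpm[of n x] by auto
  obtain \<rho> where \<rho>: "\<forall>x\<in>\<Omega>. norm x \<le> \<rho>" using \<Omega>(2) unfolding bounded_iff by blast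
  obtain r where r: "strict_mono r" and conv: "AE x in lborel. x \<in> cball 0 \<rho> \<longrightarrow> convergent (\<lambda>k. v (r k) x)"
    by (rule seminorm_compactness[of s v M \<rho>, OF s(1) vm vb B M(2)]) blast
  \<comment> \<open>A convergent sequence of values \<open>\<plusminus>1\<close> is eventually
    constant. Stating the limit \<open>1\<close> in this form makes \<open>E\<close> measurable by
    countable operations.\<close>
  define E where "E = {x \<in> \<Omega>. \<exists>N. \<forall>k\<ge>N. v (r k) x = 1}"
  have "E \<in> sets lborel" unfolding E_def by measurable
  then have Em: "E \<in> sets lebesgue" by (rule sets_completionI_sets)
  have "AE x in lborel. \<forall>n. un n x = w n x" unfolding AE_all_countable using w(2) by blast
  moreover have "AE x in lborel. \<forall>n. x \<in> \<Omega> \<longrightarrow> w n x = v n x"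
    unfolding AE_all_countable v_def using AE_rext_eq[OF w(3)] by blast
  ultimately have "AE x in lborel. x \<in> \<Omega> \<longrightarrow> (\<lambda>k. un (r k) x) \<longlonglongrightarrow> indicator E x - indicator (- E) x"
    using conv
  proof (eventually_elim, intro impI)
    fix x assume x: "\<forall>n. un n x = w n x" "\<forall>n. x \<in> \<Omega> \<longrightarrow> w n x = v n x"
      "x \<in> cball 0 \<rho> \<longrightarrow> convergent (\<lambda>k. v (r k) x)" "x \<in> \<Omega>"
    then obtain l where l: "(\<lambda>k. v (r k) x) \<longlonglongrightarrow> l" using \<rho> by (auto simp: convergent_def)
    have "l \<in> {1, -1}"
      by (rule closed_sequentially[OF _ _ l]) (use vpm in \<open>auto intro: finite_imp_closed\<close>)
    moreover have "l = indicator E x - indicator (- E) x"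
    proof (cases "l = 1")
      case True
      then have "eventually (\<lambda>k. 0 < v (r k) x) sequentially" using l by (intro order_tendstoD) auto
      then have "eventually (\<lambda>k. v (r k) x = 1) sequentially"
        by eventually_elim (use vpm in \<open>metis less_minus_one_simps(3) not_less_iff_gr_or_eq\<close>)
      then have "x \<in> E" using x(4) by (simp add: E_def eventually_sequentially)
      then show ?thesis using True by simp
    next
      case False
      then have "eventually (\<lambda>k. v (r k) x < 0) sequentially"
        using l \<open>l \<in> {1, -1}\<close> by (intro order_tendstoD) auto
      then obtain N where "\<forall>k\<ge>N. v (r k) x < 0" by (auto simp: eventually_sequentially)
      then have "x \<notin> E" unfolding E_def by (smt (verit) mem_Collect_eq nle_le)
      then show ?thesis using False \<open>l \<in> {1, -1}\<close> by simp
    qed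
    ultimately show "(\<lambda>k. un (r k) x) \<longlonglongrightarrow> indicator E x - indicator (- E) x"
      using l x(1,2,4) by simp
  qed
  then have "AE x in lebesgue. x \<in> \<Omega> \<longrightarrow> (\<lambda>k. un (r k) x) \<longlonglongrightarrow> indicator E x - indicator (- E) x"
    unfolding AE_completion_iff .
  moreover have "E \<subseteq> \<Omega>" by (auto simp: E_def)
  ultimately show ?thesis using Em r by blast
qed

section \<open>Gamma-convergence\<close>

theorem theorem1p5:
  fixes K :: "(real^'n) \<times> (real^'n) \<Rightarrow> ennreal"
    and \<Omega> :: "(real^'n) set"
    and s lam Lam :: real
  assumes "CARD('n) \<ge> 2"
    and "kernel_hyp K s lam Lam"
    and "bounded \<Omega>" and "open \<Omega>" and "lipschitz_boundary \<Omega>"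
  shows
   "(\<forall>(ue :: real \<Rightarrow> real^'n \<Rightarrow> real) u.
        (\<forall>eps>0. ue eps \<in> Xeps eps) \<and> u \<in> Xsp \<and> L1loc_tendsto ue u (at_right 0) \<longrightarrow>
        Liminf (at_right 0) (\<lambda>eps. GKeps eps K \<Omega> (ue eps)) \<ge> GK K \<Omega> u)
  \<and> (\<forall>u \<in> Xsp. \<exists>ue :: real \<Rightarrow> real^'n \<Rightarrow> real.
        (\<forall>eps>0. ue eps \<in> Xeps eps) \<and> L1loc_tendsto ue u (at_right 0) \<and>
        Limsup (at_right 0) (\<lambda>eps. GKeps eps K \<Omega> (ue eps)) \<le> GK K \<Omega> u)
  \<and> (\<forall>(e :: nat \<Rightarrow> real) (un :: nat \<Rightarrow> real^'n \<Rightarrow> real) (C :: real).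
        (\<forall>n. 0 < e n \<and> e n < 1) \<and> e \<longlonglongrightarrow> 0 \<and> (\<forall>n. un n \<in> Xeps (e n)) \<and> C \<ge> 0 \<and>
        (\<forall>n. GKeps (e n) K \<Omega> (un n) \<le> ennreal C) \<longrightarrow>
        (\<exists>E r. E \<in> sets lebesgue \<and> E \<subseteq> \<Omega> \<and> strict_mono r \<and>
           (AE x in lebesgue. x \<in> \<Omega> \<longrightarrow>
              (\<lambda>k. un (r k) x) \<longlonglongrightarrow> indicator E x - indicator (-E) x)))"
proof (intro conjI allI ballI impI)
  fix ue :: "real \<Rightarrow> real^'n \<Rightarrow> real" and u
  assume "(\<forall>eps>0. ue eps \<in> Xeps eps) \<and> u \<in> Xsp \<and> L1loc_tendsto ue u (at_right 0)"
  then show "GK K \<Omega> u \<le> Liminf (at_right 0) (\<lambda>eps. GKeps eps K \<Omega> (ue eps))"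
    using gamma_liminf[OF assms(2,4)] by blast
next
  fix u :: "real^'n \<Rightarrow> real" assume "u \<in> Xsp"
  then show "\<exists>ue. (\<forall>eps>0. ue eps \<in> Xeps eps) \<and> L1loc_tendsto ue u (at_right 0) \<and>
      Limsup (at_right 0) (\<lambda>eps. GKeps eps K \<Omega> (ue eps)) \<le> GK K \<Omega> u"
    by (rule gamma_limsup[OF assms(2,4,3,5)])
next
  fix e :: "nat \<Rightarrow> real" and un :: "nat \<Rightarrow> real^'n \<Rightarrow> real" and C :: real
  assume "(\<forall>n. 0 < e n \<and> e n < 1) \<and> e \<longlonglongrightarrow> 0 \<and> (\<forall>n. un n \<in> Xeps (e n)) \<and> C \<ge> 0 \<and>
    (\<forall>n. GKeps (e n) K \<Omega> (un n) \<le> ennreal C)"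
  then show "\<exists>E r. E \<in> sets lebesgue \<and> E \<subseteq> \<Omega> \<and> strict_mono r \<and>
      (AE x in lebesgue. x \<in> \<Omega> \<longrightarrow> (\<lambda>k. un (r k) x) \<longlonglongrightarrow> indicator E x - indicator (- E) x)"
    by (intro gamma_compactness[OF assms(2,4,3,5)]) auto
qed

end
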